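(* Suppose that (i) $g_1(W)$ is nonincreasing and $g_3(W)/g_1(W)$ is nondecreasing; (ii) $\xi(\cdot)$ and $\eta(\cdot)$ are nondecreasing and satisfy $\lim_{W\to\infty}\xi(W)=1$ and $\lim_{W\to\infty}\eta(W)=1$; (iii) $\xi(W)\ge\xi_2(W)$ and $\eta(W)\ge\eta_2(W)$, where $$\xi_2(W)=\min\left(1,\ \frac{1}{g_1(W)}\cdot\frac{\beta^{(2)}_{p,n}(\boldsymbol\delta_\phi)}{n+2}\right),\qquad \eta_2(W)=\min\left(1,\ \frac{1}{g_1(W)}\left(g_3(W)+\frac{\beta^{(2)}_{p,n}(\boldsymbol\delta_\phi)}{n+2}\right)\right).$$ Then $\hat{\boldsymbol M}^*(\xi,\eta;\boldsymbol\delta_\phi)$ improves on $\hat{\boldsymbol M}^*_0(\boldsymbol\delta_\phi)$, as an estimator of $\boldsymbol M^*(\boldsymbol\delta_\phi)$, under the loss $L(\hat{\boldsymbol M}^*;\boldsymbol M^*(\boldsymbol\delta_\phi))=\mathrm{tr}\,(\hat{\boldsymbol M}^*-\boldsymbol M^*(\boldsymbol\delta_\phi))^2$.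
   Context: Let $p\ge 3$, $n\ge1$, and let $\boldsymbol X\sim N_p(\boldsymbol\theta,\sigma^2 I_p)$ and $S\sim\sigma^2\chi^2_n$ be independent, with $\boldsymbol\theta\in\mathbb R^p$ and $\sigma^2>0$ both unknown. Put $W=\|\boldsymbol X\|^2/S$. Consider the shrinkage estimator $\boldsymbol\delta_\phi=\left(1-\frac{\phi(W)}{W}\right)\boldsymbol X$, where $\phi$ is a locally absolutely continuous real function with $\phi$ and $\phi'$ finite, such that $\boldsymbol\delta_\phi$ improves on $\boldsymbol X$ under squared error loss. Its MSE matrix is $\boldsymbol M(\boldsymbol\delta_\phi)=E[(\boldsymbol\delta_\phi-\boldsymbol\theta)(\boldsymbol\delta_\phi-\boldsymbol\theta)']$, and its risk reduction matrix is $\boldsymbol M^*(\boldsymbol\delta_\phi)=\sigma^2I_p-\boldsymbol M(\boldsymbol\delta_\phi)$. For $i=1,2$ put $$g_i(W)=W^{n/2}\int_W^\infty t^{-n/2}\,\frac{h_i(t)}{t}\,dt,\quad h_1(W)=\frac{\phi(W)}{W},\quad h_2(W)=2\left(\frac{\phi(W)}{W}-\phi'(W)\right),\quad g_3(W)=g_2(W)+\frac{\phi^2(W)}{W}.$$ It is understood that $g_1(W)>0$. For functions $\xi,\eta$ define, with $\boldsymbol P=\boldsymbol X\boldsymbol X'/\|\boldsymbol X\|^2$, $$\hat{\boldsymbol M}^*(\xi,\eta;\boldsymbol\delta_\phi)=S\left\{g_1(W)\xi(W)(I_p-\boldsymbol P)+\bigl(g_1(W)\eta(W)-g_3(W)\bigr)\boldsymbol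 P\right\}.$$ The case $\xi\equiv\eta\equiv1$, denoted $\hat{\boldsymbol M}^*_0(\boldsymbol\delta_\phi)$, is the uniformly minimum variance unbiased estimator of $\boldsymbol M^*(\boldsymbol\delta_\phi)$. Let $$b(W)=\frac{4\phi(W)}{W}+\frac{(n+2)\phi^2(W)}{W}-4\phi'(W)-4\phi(W)\phi'(W).$$ For integers $j\ge0$ let $u\sim\chi^2_{p+2j}$ and $v\sim\chi^2_n$ be independent and set $$\beta^{(2)}_{p,n}(j;\boldsymbol\delta_\phi)=E\left[\frac{2\phi(u/v)}{u/v}-\frac{b(u/v)}{p+2j}\right],\qquad \beta^{(2)}_{p,n}(\boldsymbol\delta_\phi)=\sup_{j\ge0}\beta^{(2)}_{p,n}(j;\boldsymbol\delta_\phi).$$ An estimator improves on another under a given loss if its risk (expected loss) is less than or equal to that of the other for all $(\boldsymbol\theta,\sigma^2)$. *)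

theory Defs
  imports "HOL-Probability.Probability"
begin

section \<open>The statistical model\<close>

text \<open>
  The chi-square distribution with \<open>k\<close> degrees of freedom lives on the open half-line, so that
  \<open>W\<close> below is never formed with a non-positive denominator and functions given on
  \<open>(0, \<infinity>)\<close> need no particular values elsewhere.
\<close>

definition chi_square_density :: "nat \<Rightarrow> real \<Rightarrow> real" where
  "chi_square_density k x =
     x powr (real k / 2 - 1) * exp (- x / 2) / (2 powr (real k / 2) * Gamma (real k / 2))"

definition chi_square :: "nat \<Rightarrow> real measure" where
  "chi_square k = density (restrict_space lborel {0<..}) (\<lambda>x. ennreal (chi_square_density k x))"

text \<open>The distribution of \<open>\<sigma>\<^sup>2\<close> times a chi-square variable; \<open>\<sigma>2\<close> stands for \<open>\<sigma>\<^sup>2\<close> throughout.\<close>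

definition scaled_chi_square :: "real \<Rightarrow> nat \<Rightarrow> real measure" where
  "scaled_chi_square \<sigma>2 k = distr (chi_square k) (restrict_space borel {0<..}) (\<lambda>v. \<sigma>2 * v)"

text \<open>
  \<open>N\<^sub>p(\<theta>, \<sigma>\<^sup>2 I)\<close>: independent normal coordinates.
  The scale parameter of \<^const>\<open>normal_density\<close> is the standard deviation.
\<close>

definition multi_normal :: "real ^ 'p \<Rightarrow> real \<Rightarrow> (real ^ 'p) measure" where
  "multi_normal \<theta> \<sigma>2 =
     density lborel (\<lambda>x. ennreal (\<Prod>i\<in>UNIV. normal_density (\<theta> $ i) (sqrt \<sigma>2) (x $ i)))"

definition sample_law :: "nat \<Rightarrow> real ^ 'p \<Rightarrow> real \<Rightarrow> ((real ^ 'p) \<times> real) measure" where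
  "sample_law n \<theta> \<sigma>2 = multi_normal \<theta> \<sigma>2 \<Otimes>\<^sub>M scaled_chi_square \<sigma>2 n"

text \<open>
  Risk of an estimator \<open>T (X, S)\<close> for a nonnegative loss \<open>L \<theta> \<sigma>2\<close>; as an extended nonnegative
  real it is always meaningful, possibly infinite.
\<close>

definition risk ::
  "nat \<Rightarrow> (real ^ 'p \<Rightarrow> real \<Rightarrow> 'e \<Rightarrow> real) \<Rightarrow> (real ^ 'p \<Rightarrow> real \<Rightarrow> 'e) \<Rightarrow> real ^ 'p \<Rightarrow> real \<Rightarrow> ennreal"
  where
  "risk n L T \<theta> \<sigma>2 = (\<integral>\<^sup>+ (x, s). ennreal (L \<theta> \<sigma>2 (T x s)) \<partial>sample_law n \<theta> \<sigma>2)"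

definition improves_on ::
  "nat \<Rightarrow> (real ^ 'p \<Rightarrow> real \<Rightarrow> 'e \<Rightarrow> real) \<Rightarrow> (real ^ 'p \<Rightarrow> real \<Rightarrow> 'e) \<Rightarrow> (real ^ 'p \<Rightarrow> real \<Rightarrow> 'e) \<Rightarrow> bool"
  where
  "improves_on n L T T' \<longleftrightarrow> (\<forall>\<theta> \<sigma>2. \<sigma>2 > 0 \<longrightarrow> risk n L T \<theta> \<sigma>2 \<le> risk n L T' \<theta> \<sigma>2)"


section \<open>Shrinkage estimators and their risk reduction matrices\<close>

definition W_stat :: "real ^ 'p \<Rightarrow> real \<Rightarrow> real" where
  "W_stat x s = (norm x)\<^sup>2 / s"

definition shrinkage :: "(real \<Rightarrow> real) \<Rightarrow> real ^ 'p \<Rightarrow> real \<Rightarrow> real ^ 'p" where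
  "shrinkage \<phi> x s = (1 - \<phi> (W_stat x s) / W_stat x s) *\<^sub>R x"

definition squared_error :: "real ^ 'p \<Rightarrow> real \<Rightarrow> real ^ 'p \<Rightarrow> real" where
  "squared_error \<theta> \<sigma>2 d = (norm (d - \<theta>))\<^sup>2"

definition outer :: "real ^ 'p \<Rightarrow> real ^ 'p ^ 'p" where
  "outer v = (\<chi> i j. v $ i * v $ j)"

definition mse_matrix ::
  "nat \<Rightarrow> (real ^ 'p \<Rightarrow> real \<Rightarrow> real ^ 'p) \<Rightarrow> real ^ 'p \<Rightarrow> real \<Rightarrow> real ^ 'p ^ 'p" where
  "mse_matrix n \<delta> \<theta> \<sigma>2 = (\<integral> (x, s). outer (\<delta> x s - \<theta>) \<partial>sample_law n \<theta> \<sigma>2)"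

definition risk_reduction_matrix ::
  "nat \<Rightarrow> (real ^ 'p \<Rightarrow> real \<Rightarrow> real ^ 'p) \<Rightarrow> real ^ 'p \<Rightarrow> real \<Rightarrow> real ^ 'p ^ 'p" where
  "risk_reduction_matrix n \<delta> \<theta> \<sigma>2 = \<sigma>2 *\<^sub>R mat 1 - mse_matrix n \<delta> \<theta> \<sigma>2"

definition matrix_loss ::
  "nat \<Rightarrow> (real ^ 'p \<Rightarrow> real \<Rightarrow> real ^ 'p) \<Rightarrow> real ^ 'p \<Rightarrow> real \<Rightarrow> real ^ 'p ^ 'p \<Rightarrow> real" where
  "matrix_loss n \<delta> \<theta> \<sigma>2 A =
     (let D = A - risk_reduction_matrix n \<delta> \<theta> \<sigma>2 in trace (D ** D))"


section \<open>Regularity of the shrinkage function\<close>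

text \<open>
  Absolute continuity on a compact interval, the finite families of non-overlapping subintervals
  being the divisions of their unions. Local absolute continuity on \<open>(0, \<infinity>)\<close>, the range of \<open>W\<close>,
  is absolute continuity on each compact subinterval.
\<close>

definition abs_continuous_on :: "real \<Rightarrow> real \<Rightarrow> (real \<Rightarrow> real) \<Rightarrow> bool" where
  "abs_continuous_on a b f \<longleftrightarrow>
     (\<forall>\<epsilon>>0. \<exists>\<delta>>0. \<forall>\<D>. \<D> division_of \<Union>\<D> \<longrightarrow> \<Union>\<D> \<subseteq> {a..b} \<longrightarrow>
        (\<Sum>K\<in>\<D>. Sup K - Inf K) < \<delta> \<longrightarrow> (\<Sum>K\<in>\<D>. \<bar>f (Sup K) - f (Inf K)\<bar>) < \<epsilon>)"

definition locally_abs_continuous :: "(real \<Rightarrow> real) \<Rightarrow> bool" where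
  "locally_abs_continuous f \<longleftrightarrow> (\<forall>a b. 0 < a \<longrightarrow> a \<le> b \<longrightarrow> abs_continuous_on a b f)"


section \<open>The functions entering the estimators\<close>

text \<open>
  The derivative \<open>\<phi>'\<close> is \<^term>\<open>deriv \<phi>\<close>. It is used only under integral signs, and at the
  points where \<open>\<phi>\<close> is not differentiable, a null set, \<^const>\<open>deriv\<close> takes one fixed value, so
  that \<open>deriv \<phi>\<close> is Borel measurable on \<open>(0, \<infinity>)\<close>.
\<close>

definition h1 :: "(real \<Rightarrow> real) \<Rightarrow> real \<Rightarrow> real" where
  "h1 \<phi> w = \<phi> w / w"

definition h2 :: "(real \<Rightarrow> real) \<Rightarrow> real \<Rightarrow> real" where
  "h2 \<phi> w = 2 * (\<phi> w / w - deriv \<phi> w)"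

definition g_integrand :: "nat \<Rightarrow> (real \<Rightarrow> real) \<Rightarrow> real \<Rightarrow> real" where
  "g_integrand n h t = t powr (- (real n / 2)) * (h t / t)"

definition g_transform :: "nat \<Rightarrow> (real \<Rightarrow> real) \<Rightarrow> real \<Rightarrow> real" where
  "g_transform n h w = w powr (real n / 2) * (LINT t:{w<..}|lborel. g_integrand n h t)"

definition g1 :: "nat \<Rightarrow> (real \<Rightarrow> real) \<Rightarrow> real \<Rightarrow> real" where
  "g1 n \<phi> = g_transform n (h1 \<phi>)"

definition g2 :: "nat \<Rightarrow> (real \<Rightarrow> real) \<Rightarrow> real \<Rightarrow> real" where
  "g2 n \<phi> = g_transform n (h2 \<phi>)"

definition g3 :: "nat \<Rightarrow> (real \<Rightarrow> real) \<Rightarrow> real \<Rightarrow> real" where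
  "g3 n \<phi> w = g2 n \<phi> w + (\<phi> w)\<^sup>2 / w"

definition proj :: "real ^ 'p \<Rightarrow> real ^ 'p ^ 'p" where
  "proj x = (1 / (norm x)\<^sup>2) *\<^sub>R outer x"

definition M_hat ::
  "nat \<Rightarrow> (real \<Rightarrow> real) \<Rightarrow> (real \<Rightarrow> real) \<Rightarrow> (real \<Rightarrow> real) \<Rightarrow> real ^ 'p \<Rightarrow> real \<Rightarrow> real ^ 'p ^ 'p" where
  "M_hat n \<phi> \<xi> \<eta> x s =
     (let w = W_stat x s in
        s *\<^sub>R ((g1 n \<phi> w * \<xi> w) *\<^sub>R (mat 1 - proj x)
              + (g1 n \<phi> w * \<eta> w - g3 n \<phi> w) *\<^sub>R proj x))"

definition M_hat0 :: "nat \<Rightarrow> (real \<Rightarrow> real) \<Rightarrow> real ^ 'p \<Rightarrow> real \<Rightarrow> real ^ 'p ^ 'p" where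
  "M_hat0 n \<phi> = M_hat n \<phi> (\<lambda>_. 1) (\<lambda>_. 1)"

definition b_fun :: "nat \<Rightarrow> (real \<Rightarrow> real) \<Rightarrow> real \<Rightarrow> real" where
  "b_fun n \<phi> w = 4 * \<phi> w / w + (real n + 2) * (\<phi> w)\<^sup>2 / w - 4 * deriv \<phi> w - 4 * \<phi> w * deriv \<phi> w"

definition beta2_integrand :: "nat \<Rightarrow> nat \<Rightarrow> (real \<Rightarrow> real) \<Rightarrow> nat \<Rightarrow> real \<times> real \<Rightarrow> real" where
  "beta2_integrand p n \<phi> j =
     (\<lambda>(u, v). 2 * \<phi> (u / v) / (u / v) - b_fun n \<phi> (u / v) / (real p + 2 * real j))"

definition beta2_term :: "nat \<Rightarrow> nat \<Rightarrow> (real \<Rightarrow> real) \<Rightarrow> nat \<Rightarrow> real" where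
  "beta2_term p n \<phi> j =
     integral\<^sup>L (chi_square (p + 2 * j) \<Otimes>\<^sub>M chi_square n) (beta2_integrand p n \<phi> j)"

text \<open>The supremum is taken in the extended reals because it may be infinite.\<close>

definition beta2 :: "nat \<Rightarrow> nat \<Rightarrow> (real \<Rightarrow> real) \<Rightarrow> ereal" where
  "beta2 p n \<phi> = (SUP j. ereal (beta2_term p n \<phi> j))"

definition xi2 :: "nat \<Rightarrow> nat \<Rightarrow> (real \<Rightarrow> real) \<Rightarrow> real \<Rightarrow> ereal" where
  "xi2 p n \<phi> w = min 1 (ereal (1 / g1 n \<phi> w) * (beta2 p n \<phi> / ereal (real n + 2)))"

definition eta2 :: "nat \<Rightarrow> nat \<Rightarrow> (real \<Rightarrow> real) \<Rightarrow> real \<Rightarrow> ereal" where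
  "eta2 p n \<phi> w =
     min 1 (ereal (1 / g1 n \<phi> w) * (ereal (g3 n \<phi> w) + beta2 p n \<phi> / ereal (real n + 2)))"

end

theory Submission
  imports Defs "HOL-Real_Asymp.Real_Asymp" "HOL-Complex_Analysis.Cauchy_Integral_Formula"
begin

text \<open>
  Put \<open>\<psi>(w) = \<phi>(w) / w\<close>, \<open>\<kappa> = \<beta> / (n + 2)\<close> and let \<open>M\<close> be the risk reduction matrix. The heart of the
  matter is that \<open>v \<bullet> M v \<le> \<sigma>\<^sup>2 \<beta> |v|\<^sup>2\<close> for all \<open>v\<close>. Expanding the density of \<open>X\<close> in powers of
  \<open>x \<bullet> \<theta>\<close> represents \<open>v \<bullet> M v\<close> as a Poisson mixture in which \<open>W\<close> is a ratio of independent central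
  chi-square variables with \<open>p + 2 j + 2\<close> and \<open>n\<close> degrees of freedom. The terms with factor
  \<open>|v|\<^sup>2\<close> contain \<open>E (2 \<psi> - \<psi>\<^sup>2)\<close>, which is at most \<open>\<beta>(j)\<close>: the two sides differ by the integral
  of the derivative of \<open>(4 \<phi> + 2 \<phi>\<^sup>2) f\<close>, with \<open>f\<close> proportional to the density of \<open>W\<close>. The terms with
  factor \<open>(v \<bullet> \<theta>)\<^sup>2\<close> add up to something nonpositive, because \<open>E \<psi>\<close> decreases with the degrees of
  freedom when \<open>g\<^sub>1\<close> is nonincreasing.

  Given this inequality, the hypotheses on \<open>\<xi>\<close> and \<open>\<eta>\<close> bound the difference of the two losses below by
  \<open>2 \<kappa> (S\<^sup>2 - (n + 2) \<sigma>\<^sup>2 S) k(W)\<close> with \<open>k = g\<^sub>1 ((p - 1) (1 - \<xi>) + (1 - \<eta>))\<close> nonincreasing, and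
  \<open>\<kappa> \<ge> 0\<close> since \<open>M\<close> has nonnegative trace. For fixed \<open>X\<close> the factor \<open>k(W)\<close> increases with \<open>S\<close>, while
  \<open>S\<^sup>2 - (n + 2) \<sigma>\<^sup>2 S\<close> has mean \<open>0\<close> and changes sign once, so the expectation is nonnegative.
\<close>

section \<open>Absolutely continuous functions\<close>

text \<open>Square integrability of \<open>\<psi>(W) X\<close> has one source: since
  \<open>shrinkage \<phi>\<close> improves on \<open>X\<close>, its risk is finite for every mean.
  Under the central law this becomes exponential moments in every direction, so the series can be
  integrated term by term. The beta terms carry p + 2j degrees of freedom, while the quadratic
  factor (x . v)^2 puts p + 2j + 2 into the mixture; the integration by parts bridges the two. Since
  \<phi> is differentiable only almost everywhere, it rests on the fundamental theorem for
  absolutely continuous functions, and it gives an inequality because the boundary terms are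
  controlled in sign only. The quadratic form must be bounded for every single v, because the
  estimators weigh M along X and across X differently. The constant n + 2 equals E[S^2] /
  (\<sigma>^2 E[S]), so (n + 2) \<sigma>^2 \<kappa> = \<sigma>^2 \<beta> is exactly the bound on the
  form. Risks are extended reals: terms are added to both sides instead of subtracted, and the last
  cancellation needs its own finiteness argument.\<close>

lemma abs_continuous_onD:
  assumes "abs_continuous_on a b f" "0 < e"
  obtains d where "0 < d"
    "\<And>\<D>. \<D> division_of \<Union>\<D> \<Longrightarrow> \<Union>\<D> \<subseteq> {a..b} \<Longrightarrow>
       (\<Sum>K\<in>\<D>. Sup K - Inf K) < d \<Longrightarrow> (\<Sum>K\<in>\<D>. \<bar>f (Sup K) - f (Inf K)\<bar>) < e"
  using assms unfolding abs_continuous_on_def by (metis (no_types, lifting))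

lemma division_of_real_Icc:
  assumes "\<D> division_of S" "K \<in> \<D>"
  shows "Inf K \<le> Sup K" "K = {Inf K..Sup K}" "Inf K \<in> K" "Sup K \<in> (K::real set)"
proof -
  obtain u v where K: "K = cbox u v" "K \<noteq> {}"
    using division_ofD(3,4)[OF assms] by blast
  then have "u \<le> v" by simp
  then show "Inf K \<le> Sup K" "K = {Inf K..Sup K}" "Inf K \<in> K" "Sup K \<in> K"
    using K by (auto simp: cbox_interval)
qed

lemma abs_continuous_on_imp_continuous_on:
  assumes "abs_continuous_on a b f"
  shows "continuous_on {a..b} f"
  unfolding continuous_on_iff
proof (intro ballI allI impI)
  fix x e :: real assume x: "x \<in> {a..b}" and e: "0 < e"
  obtain d where d: "0 < d" "\<And>\<D>. \<D> division_of \<Union>\<D> \<Longrightarrow> \<Union>\<D> \<subseteq> {a..b} \<Longrightarrow>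
       (\<Sum>K\<in>\<D>. Sup K - Inf K) < d \<Longrightarrow> (\<Sum>K\<in>\<D>. \<bar>f (Sup K) - f (Inf K)\<bar>) < e"
    using abs_continuous_onD[OF assms e] by blast
  have *: "\<bar>f v - f u\<bar> < e" if "u \<in> {a..b}" "v \<in> {a..b}" "u \<le> v" "v - u < d" for u v
    using d(2)[of "{{u..v}}"] division_of_self[of u v] that by (auto simp: cbox_interval)
  have "dist (f y) (f x) < e" if "y \<in> {a..b}" "dist y x < d" for y
    using *[of x y] *[of y x] that x by (cases "x \<le> y") (auto simp: dist_real_def)
  then show "\<exists>d>0. \<forall>y\<in>{a..b}. dist y x < d \<longrightarrow> dist (f y) (f x) < e"
    using d(1) by blast
qed

text \<open>One criterion serves all closure properties in use: sums of increments over a division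
  inherit smallness from those of \<open>u\<close> and \<open>v\<close>. Lipschitz functions are the
  case of the identity, and splitting the increment of a product covers products of bounded
  factors.\<close>

lemma abs_continuous_on_dominated:
  assumes u: "abs_continuous_on a b u" and v: "abs_continuous_on a b v" and C: "0 \<le> C"
    and le: "\<And>x y. x \<in> {a..b} \<Longrightarrow> y \<in> {a..b} \<Longrightarrow> \<bar>f y - f x\<bar> \<le> C * (\<bar>u y - u x\<bar> + \<bar>v y - v x\<bar>)"
  shows "abs_continuous_on a b f"
  unfolding abs_continuous_on_def
proof (intro allI impI)
  fix e :: real assume e: "0 < e"
  \<comment> \<open>The 1 added to \<open>C\<close> keeps the division legitimate for
    \<open>C = 0\<close> and makes the final factor \<open>C / (C + 1)\<close> strictly less than
    1.\<close>
  define e' where "e' = e / (2 * (C + 1))"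
  have e': "0 < e'" using e C by (simp add: e'_def)
  obtain d1 where d1: "0 < d1" "\<And>\<D>. \<D> division_of \<Union>\<D> \<Longrightarrow> \<Union>\<D> \<subseteq> {a..b} \<Longrightarrow>
       (\<Sum>K\<in>\<D>. Sup K - Inf K) < d1 \<Longrightarrow> (\<Sum>K\<in>\<D>. \<bar>u (Sup K) - u (Inf K)\<bar>) < e'"
    using abs_continuous_onD[OF u e'] by blast
  obtain d2 where d2: "0 < d2" "\<And>\<D>. \<D> division_of \<Union>\<D> \<Longrightarrow> \<Union>\<D> \<subseteq> {a..b} \<Longrightarrow>
       (\<Sum>K\<in>\<D>. Sup K - Inf K) < d2 \<Longrightarrow> (\<Sum>K\<in>\<D>. \<bar>v (Sup K) - v (Inf K)\<bar>) < e'"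
    using abs_continuous_onD[OF v e'] by blast
  have "(\<Sum>K\<in>\<D>. \<bar>f (Sup K) - f (Inf K)\<bar>) < e"
    if D: "\<D> division_of \<Union>\<D>" "\<Union>\<D> \<subseteq> {a..b}" "(\<Sum>K\<in>\<D>. Sup K - Inf K) < min d1 d2" for \<D>
  proof -
    have "(\<Sum>K\<in>\<D>. \<bar>f (Sup K) - f (Inf K)\<bar>)
        \<le> (\<Sum>K\<in>\<D>. C * (\<bar>u (Sup K) - u (Inf K)\<bar> + \<bar>v (Sup K) - v (Inf K)\<bar>))"
    proof (rule sum_mono)
      fix K assume "K \<in> \<D>"
      then show "\<bar>f (Sup K) - f (Inf K)\<bar> \<le> C * (\<bar>u (Sup K) - u (Inf K)\<bar> + \<bar>v (Sup K) - v (Inf K)\<bar>)"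
        using division_of_real_Icc[OF D(1)] D(2) by (intro le) blast+
    qed
    also have "\<dots> = C * ((\<Sum>K\<in>\<D>. \<bar>u (Sup K) - u (Inf K)\<bar>) + (\<Sum>K\<in>\<D>. \<bar>v (Sup K) - v (Inf K)\<bar>))"
      by (simp add: sum_distrib_left sum.distrib distrib_left)
    also have "\<dots> \<le> C * (e' + e')"
      using d1(2)[OF D(1,2)] d2(2)[OF D(1,2)] D(3) C by (intro mult_left_mono) auto
    also have "\<dots> = C / (C + 1) * e"
      using C by (simp add: e'_def divide_simps)
    also have "\<dots> < 1 * e"
      using C e by (intro mult_strict_right_mono) auto
    finally show ?thesis by simp
  qed
  then show "\<exists>\<delta>>0. \<forall>\<D>. \<D> division_of \<Union>\<D> \<longrightarrow> \<Union>\<D> \<subseteq> {a..b} \<longrightarrow>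
        (\<Sum>K\<in>\<D>. Sup K - Inf K) < \<delta> \<longrightarrow> (\<Sum>K\<in>\<D>. \<bar>f (Sup K) - f (Inf K)\<bar>) < e"
    using d1(1) d2(1) by (intro exI[of _ "min d1 d2"]) auto
qed

lemma abs_continuous_on_ident: "abs_continuous_on a b (\<lambda>x. x)"
  unfolding abs_continuous_on_def
proof (intro allI impI)
  fix e :: real assume e: "0 < e"
  have "(\<Sum>K\<in>\<D>. \<bar>Sup K - Inf K\<bar>) = (\<Sum>K\<in>\<D>. Sup K - Inf K)"
    if "\<D> division_of \<Union>\<D>" for \<D> :: "real set set"
    using division_of_real_Icc(1)[OF that] by (intro sum.cong) auto
  then show "\<exists>\<delta>>0. \<forall>\<D>. \<D> division_of \<Union>\<D> \<longrightarrow> \<Union>\<D> \<subseteq> {a..b} \<longrightarrow>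
        (\<Sum>K\<in>\<D>. Sup K - Inf K) < \<delta> \<longrightarrow> (\<Sum>K\<in>\<D>. \<bar>Sup K - Inf K\<bar>) < e"
    using e by (intro exI[of _ e]) auto
qed

lemma abs_continuous_on_lipschitz:
  assumes "0 \<le> C" "\<And>x y. x \<in> {a..b} \<Longrightarrow> y \<in> {a..b} \<Longrightarrow> \<bar>f y - f x\<bar> \<le> C * \<bar>y - x\<bar>"
  shows "abs_continuous_on a b f"
proof (rule abs_continuous_on_dominated[OF abs_continuous_on_ident abs_continuous_on_ident assms(1)])
  fix x y assume "x \<in> {a..b}" "y \<in> {a..b}"
  then have "\<bar>f y - f x\<bar> \<le> C * \<bar>y - x\<bar>" by (rule assms(2))
  also have "\<dots> \<le> C * (\<bar>y - x\<bar> + \<bar>y - x\<bar>)" using assms(1) by (intro mult_left_mono) auto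
  finally show "\<bar>f y - f x\<bar> \<le> C * (\<bar>y - x\<bar> + \<bar>y - x\<bar>)" .
qed

text \<open>Intervals tagged in the exceptional null set contribute little: a gauge confines them to
  an open set of small measure, where absolute continuity bounds the increments of \<open>f\<close>.\<close>
theorem abs_continuous_on_has_integral:
  assumes ac: "abs_continuous_on a b f" and ab: "a \<le> b" and N: "negligible N"
    and deriv: "\<And>x. x \<in> {a..b} - N \<Longrightarrow> (f has_real_derivative f' x) (at x)"
  shows "(f' has_integral f b - f a) {a..b}"
proof -
  \<comment> \<open>With value 0 on \<open>N\<close>, a tag in \<open>N\<close> leaves only the
    increment of \<open>f\<close> to estimate; the original values return through the spike rule at
    the end.\<close>
  define g where "g x = (if x \<in> N then 0 else f' x)" for x
  have "(g has_integral f b - f a) {a..b}"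
    unfolding has_integral_real
  proof (intro allI impI)
    fix e :: real assume e: "0 < e"
    define e1 where "e1 = e / (2 * (b - a + 1))"
    have e1: "0 < e1" using e ab by (simp add: e1_def)
    have "\<exists>r>0. x \<in> {a..b} - N \<longrightarrow> (\<forall>y. \<bar>y - x\<bar> < r \<longrightarrow> \<bar>f y - f x - f' x * (y - x)\<bar> \<le> e1 * \<bar>y - x\<bar>)" for x
    proof (cases "x \<in> {a..b} - N")
      case True
      have "(f has_derivative (\<lambda>h. f' x * h)) (at x)"
        using deriv[OF True] by (simp add: has_field_derivative_def)
      then obtain r where "r > 0" "\<forall>y. norm (y - x) < r \<longrightarrow> norm (f y - f x - f' x * (y - x)) \<le> e1 * norm (y - x)"
        using e1 unfolding has_derivative_at_alt by blast
      then show ?thesis by auto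
    qed (auto intro: exI[of _ 1])
    then obtain r where r: "\<And>x. r x > 0"
      "\<And>x y. x \<in> {a..b} - N \<Longrightarrow> \<bar>y - x\<bar> < r x \<Longrightarrow> \<bar>f y - f x - f' x * (y - x)\<bar> \<le> e1 * \<bar>y - x\<bar>"
      by metis
    obtain d where d: "0 < d" "\<And>\<D>. \<D> division_of \<Union>\<D> \<Longrightarrow> \<Union>\<D> \<subseteq> {a..b} \<Longrightarrow>
       (\<Sum>K\<in>\<D>. Sup K - Inf K) < d \<Longrightarrow> (\<Sum>K\<in>\<D>. \<bar>f (Sup K) - f (Inf K)\<bar>) < e / 2"
      using abs_continuous_onD[OF ac half_gt_zero[OF e]] by blast
    obtain T where T: "open T" "N \<subseteq> T" "T - N \<in> lmeasurable" "emeasure lebesgue (T - N) < ennreal d"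
      using sets_lebesgue_outer_open[OF negligible_imp_sets[OF N] d(1)] by blast
    have Tm: "T \<in> lmeasurable"
      using T(2,3) N by (metis Un_Diff_cancel2 Un_absorb2 fmeasurable.Un negligible_imp_measurable)
    have Td: "measure lebesgue T < d"
    proof -
      have "measure lebesgue T = measure lebesgue (T - N)"
        using N Tm by (simp add: measure_Diff_null_set negligible_iff_null_sets fmeasurableD)
      then show ?thesis
        using T(3,4) d(1) by (simp add: emeasure_eq_measure2 ennreal_less_iff)
    qed
    define \<gamma> where "\<gamma> x = (if x \<in> N then T else ball x (r x))" for x
    have gauge: "gauge \<gamma>"
      using T r(1) by (auto simp: gauge_def \<gamma>_def)
    have "norm (sum (\<lambda>(x,k). measure lborel k *\<^sub>R g x) \<D> - (f b - f a)) < e"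
      if p: "\<D> tagged_division_of {a..b}" and fine: "\<gamma> fine \<D>" for \<D>
    proof -
      define P1 where "P1 = {(x,K)\<in>\<D>. x \<notin> N}"
      define P2 where "P2 = {(x,K)\<in>\<D>. x \<in> N}"
      have fin: "finite \<D>" using p by blast
      have P: "\<D> = P1 \<union> P2" "P1 \<inter> P2 = {}" "finite P1" "finite P2"
        using fin by (auto simp: P1_def P2_def intro: finite_subset)
      have Icc: "x \<in> K \<and> K \<subseteq> {a..b} \<and> K = {Inf K..Sup K} \<and> Inf K \<le> Sup K" if xK: "(x,K) \<in> \<D>" for x K
      proof -
        obtain u v where "K = {u..v}" "x \<in> K" "K \<subseteq> {a..b}"
          using tagged_division_ofD(2,3,4)[OF p xK] by (auto simp: cbox_interval)
        then show ?thesis by auto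
      qed
      have incr: "sum (\<lambda>(x,K). f (Sup K) - f (Inf K)) \<D> = f b - f a"
        and len: "sum (\<lambda>(x,K). Sup K - Inf K) \<D> = b - a"
        using additive_tagged_division_1[OF ab p, of f] additive_tagged_division_1[OF ab p, of "\<lambda>x. x"] by auto
      have "sum (\<lambda>(x,k). measure lborel k *\<^sub>R g x) \<D> - (f b - f a)
        = sum (\<lambda>(x,K). measure lborel K * g x - (f (Sup K) - f (Inf K))) \<D>"
        unfolding incr[symmetric] by (simp add: sum_subtractf[symmetric] case_prod_unfold)
      also have "\<dots> = sum (\<lambda>(x,K). measure lborel K * g x - (f (Sup K) - f (Inf K))) P1
        + sum (\<lambda>(x,K). measure lborel K * g x - (f (Sup K) - f (Inf K))) P2"
        unfolding P(1) by (rule sum.union_disjoint) (use P in auto)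
      finally have split: "sum (\<lambda>(x,k). measure lborel k *\<^sub>R g x) \<D> - (f b - f a) = \<dots>" .
      have "\<bar>sum (\<lambda>(x,K). measure lborel K * g x - (f (Sup K) - f (Inf K))) P1\<bar>
          \<le> sum (\<lambda>(x,K). e1 * (Sup K - Inf K)) P1"
      proof (rule order_trans[OF sum_abs], rule sum_mono, clarify)
        fix x K assume xK: "(x,K) \<in> P1"
        then have xD: "(x,K) \<in> \<D>" and xN: "x \<notin> N" by (auto simp: P1_def)
        note I = Icc[OF xD]
        define u v where "u = Inf K" and "v = Sup K"
        have uv: "K = {u..v}" "u \<le> v" "x \<in> {u..v}" using I by (auto simp: u_def v_def)
        have "K \<subseteq> ball x (r x)" using fineD[OF fine xD] xN by (simp add: \<gamma>_def)
        moreover have "u \<in> K" "v \<in> K" using uv by auto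
        ultimately have "\<bar>u - x\<bar> < r x" "\<bar>v - x\<bar> < r x"
          by (auto simp: dist_real_def subset_iff abs_minus_commute)
        moreover have "x \<in> {a..b} - N" using I xN by auto
        \<comment> \<open>The tag lies between the endpoints, so the two one-sided linearisation
          errors add up to \<open>e1\<close> times the length of the interval.\<close>
        ultimately have "\<bar>f u - f x - f' x * (u - x)\<bar> \<le> e1 * (x - u)" "\<bar>f v - f x - f' x * (v - x)\<bar> \<le> e1 * (v - x)"
          using r(2)[of x u] r(2)[of x v] uv by auto
        moreover have "measure lborel K * g x - (f (Sup K) - f (Inf K)) =
           (f u - f x - f' x * (u - x)) - (f v - f x - f' x * (v - x))"
          unfolding u_def[symmetric] v_def[symmetric] using uv xN by (simp add: g_def algebra_simps)
        ultimately show "\<bar>measure lborel K * g x - (f (Sup K) - f (Inf K))\<bar> \<le> e1 * (Sup K - Inf K)"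
          unfolding u_def[symmetric] v_def[symmetric] by (simp add: algebra_simps)
      qed
      also have "\<dots> \<le> sum (\<lambda>(x,K). e1 * (Sup K - Inf K)) \<D>"
        using Icc e1 fin by (intro sum_mono2) (auto simp: P1_def split: prod.splits)
      also have "\<dots> = e1 * (b - a)"
        by (simp add: len[symmetric] sum_distrib_left case_prod_unfold)
      also have "\<dots> < e / 2"
        using e ab by (simp add: e1_def field_simps)
      finally have 1: "\<bar>sum (\<lambda>(x,K). measure lborel K * g x - (f (Sup K) - f (Inf K))) P1\<bar> < e / 2" .
      have pp: "P2 tagged_partial_division_of {a..b}"
        by (rule tagged_partial_division_subset[of \<D>]) (use p P in \<open>auto simp: tagged_division_of_def\<close>)
      have td: "P2 tagged_division_of (\<Union>(snd ` P2))"
        by (rule tagged_partial_division_of_Union_self[OF pp])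
      have dv: "(snd ` P2) division_of \<Union>(snd ` P2)"
        by (rule division_of_tagged_division[OF td])
      have "sum (\<lambda>K. Sup K - Inf K) (snd ` P2) = sum (measure lborel) (snd ` P2)"
        using division_of_real_Icc[OF dv] by (intro sum.cong refl) (metis measure_lborel_Icc)
      also have "\<dots> = measure lebesgue (\<Union>(snd ` P2))"
        unfolding content_division[OF dv, symmetric]
        using division_ofD(4)[OF dv] by (intro sum.cong refl) (metis borel_closed closed_cbox measure_completion sets_lborel)
      also have "\<dots> \<le> measure lebesgue T"
      proof (rule measure_mono_fmeasurable)
        show "\<Union>(snd ` P2) \<subseteq> T"
        proof (rule Union_least)
          fix K assume "K \<in> snd ` P2"
          then obtain x where "(x, K) \<in> \<D>" "x \<in> N" by (auto simp: P2_def)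
          then show "K \<subseteq> T" using fineD[OF fine, of x K] by (simp add: \<gamma>_def)
        qed
        show "\<Union>(snd ` P2) \<in> sets lebesgue"
          using lmeasurable_division[OF dv] by (rule fmeasurableD)
        show "T \<in> lmeasurable" by (rule Tm)
      qed
      also have "\<dots> < d" by (rule Td)
      finally have small: "sum (\<lambda>K. Sup K - Inf K) (snd ` P2) < d" .
      have sub: "\<Union>(snd ` P2) \<subseteq> {a..b}" using Icc by (fastforce simp: P2_def)
      \<comment> \<open>Different tagged pairs can share an interval only if it is degenerate. The
        reindexing rule therefore wants the value 0 on degenerate boxes; the empty one needs a case
        of its own because its \<open>Sup\<close> and \<open>Inf\<close> are unspecified.\<close>
      define incr where "incr K = (if K = {} then 0 else \<bar>f (Sup K) - f (Inf K)\<bar>)" for K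
      have "\<bar>sum (\<lambda>(x,K). measure lborel K * g x - (f (Sup K) - f (Inf K))) P2\<bar>
          \<le> sum (\<lambda>(x,K). \<bar>f (Sup K) - f (Inf K)\<bar>) P2"
        by (rule order_trans[OF sum_abs], rule sum_mono) (auto simp: P2_def g_def)
      also have "\<dots> = sum (\<lambda>(x,K). incr K) P2"
        using Icc by (intro sum.cong refl) (force simp: P2_def incr_def)
      also have "\<dots> = sum incr (snd ` P2)"
      proof (rule sum.over_tagged_division_lemma[OF td])
        fix u v :: real assume "box u v = {}"
        then show "incr (cbox u v) = 0"
          by (cases "u = v") (auto simp: cbox_interval incr_def)
      qed
      also have "\<dots> = sum (\<lambda>K. \<bar>f (Sup K) - f (Inf K)\<bar>) (snd ` P2)"
        using division_ofD(3)[OF dv] by (intro sum.cong refl) (simp add: incr_def)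
      also have "\<dots> < e / 2" by (rule d(2)[OF dv sub small])
      finally show ?thesis using 1 split by auto
    qed
    then show "\<exists>\<gamma>. gauge \<gamma> \<and> (\<forall>\<D>. \<D> tagged_division_of {a..b} \<and> \<gamma> fine \<D> \<longrightarrow>
        norm (sum (\<lambda>(x,k). measure lborel k *\<^sub>R g x) \<D> - (f b - f a)) < e)"
      using gauge by blast
  qed
  then show ?thesis
    by (rule has_integral_spike[OF N, rotated]) (auto simp: g_def)
qed

lemma locally_abs_continuous_FTC:
  assumes lac: "\<And>a b. 0 < a \<Longrightarrow> a \<le> b \<Longrightarrow> abs_continuous_on a b f"
    and deriv: "AE w in lborel. 0 < w \<longrightarrow> (f has_real_derivative f' w) (at w)"
    and int: "set_integrable lborel {0<..} f'" and ab: "0 < a" "a \<le> b"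
  shows "(LINT w:{a..b}|lborel. f' w) = f b - f a"
proof -
  obtain N where N: "N \<in> null_sets lborel"
      "{w \<in> space lborel. \<not> (0 < w \<longrightarrow> (f has_real_derivative f' w) (at w))} \<subseteq> N"
    using deriv unfolding eventually_ae_filter by (elim bexE) (rule that)
  have neg: "negligible N"
    using N(1) by (simp add: negligible_iff_null_sets null_sets_completionI)
  have "(f' has_integral f b - f a) {a..b}"
  proof (rule abs_continuous_on_has_integral[OF lac[OF ab] ab(2) neg])
    fix w assume "w \<in> {a..b} - N"
    then show "(f has_real_derivative f' w) (at w)"
      using subsetD[OF N(2), of w] ab by auto
  qed
  moreover have "set_integrable lborel {a..b} f'"
    by (rule set_integrable_subset[OF int]) (use ab in auto)
  ultimately show ?thesis
    by (simp add: set_borel_integral_eq_integral integral_unique)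
qed

section \<open>The beta prime density and its boundary terms\<close>

text \<open>The unnormalised beta prime density: for m = N/2 and k = n/2 that of U/V with
  independent chi-square U and V. The Gamma factors are kept apart in \<open>ratio_const\<close>, so
  that shifts of \<open>m\<close> and \<open>k\<close> are elementary identities.\<close>

definition fden :: "real \<Rightarrow> real \<Rightarrow> real \<Rightarrow> real" where
  "fden m k w = w powr (m - 1) * (1 + w) powr (- (m + k))"

lemma fden_nonneg [simp]: "0 \<le> fden m k w"
  by (simp add: fden_def)

lemma borel_measurable_fden [measurable]: "fden m k \<in> borel_measurable borel"
  unfolding fden_def by measurable

lemma powr_minus_one_divide: "0 < x \<Longrightarrow> x powr (a - 1) = x powr a / (x::real)"
  by (simp add: powr_diff)

text \<open>Two more degrees of freedom in the numerator cost only a factor in (0, 1); this drives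
  both the integrability transfers and the monotonicity in the degrees of freedom.\<close>

lemma fden_Suc_left:
  assumes "0 < w"
  shows "fden (m + 1) k w = fden m k w * (w / (1 + w))"
proof -
  have "- (m + 1 + k) = - (m + k) - 1" by simp
  then have X: "(1 + w) powr (- (m + 1 + k)) = (1 + w) powr (- (m + k)) / (1 + w)"
    using powr_minus_one_divide[of "1 + w" "- (m + k)"] assms by (simp only:)
  show ?thesis
    unfolding fden_def X using powr_minus_one_divide[of w m] assms by simp
qed

lemma fden_Suc_right:
  assumes "0 < w"
  shows "fden m (k + 1) w = fden m k w / (1 + w)"
proof -
  have "- (m + (k + 1)) = - (m + k) - 1" by simp
  then have X: "(1 + w) powr (- (m + (k + 1))) = (1 + w) powr (- (m + k)) / (1 + w)"
    using powr_minus_one_divide[of "1 + w" "- (m + k)"] assms by (simp only:)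
  show ?thesis unfolding fden_def X by simp
qed

lemma has_real_derivative_fden:
  assumes "0 < w"
  shows "(fden m k has_real_derivative fden m k w * ((m - 1) / w - (m + k) / (1 + w))) (at w)"
proof -
  have 1: "((\<lambda>w. w powr (m - 1)) has_real_derivative (m - 1) * w powr (m - 1 - 1)) (at w)"
    using assms by (rule has_real_derivative_powr)
  have 2: "((\<lambda>w. (1 + w) powr (- (m + k))) has_real_derivative (- (m + k)) * (1 + w) powr (- (m + k) - 1) * 1) (at w)"
    using assms by (intro DERIV_chain2[OF has_real_derivative_powr]) (auto intro!: derivative_eq_intros)
  have "((\<lambda>w. w powr (m - 1) * (1 + w) powr (- (m + k))) has_real_derivative
      w powr (m - 1) * (1 + w) powr (- (m + k)) * ((m - 1) / w - (m + k) / (1 + w))) (at w)"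
    by (rule DERIV_cong[OF DERIV_mult[OF 1 2]])
       (use assms in \<open>simp only: powr_minus_one_divide[of w "m - 1"] powr_minus_one_divide[of "1 + w" "- (m + k)"]
          add_pos_pos zero_less_one; simp add: diff_divide_distrib add_divide_distrib algebra_simps\<close>)
  then show ?thesis by (simp add: fden_def[abs_def])
qed

lemma continuous_on_fden: "continuous_on {0<..} (fden m k)"
  by (intro continuous_at_imp_continuous_on ballI DERIV_isCont[OF has_real_derivative_fden]) simp

text \<open>The condition \<open>1 < m\<close> means more than two degrees of freedom in the
  numerator, which is what the assumption p >= 3 supplies.\<close>

lemma fden_tendsto_0_at_right:
  assumes "1 < m"
  shows "(fden m k \<longlongrightarrow> 0) (at_right 0)"
proof -
  have "((\<lambda>w. w powr (m - 1) * (1 + w) powr (- (m + k))) \<longlongrightarrow> 0 * (1 + 0) powr (- (m + k))) (at_right 0)"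
  proof (intro tendsto_mult tendsto_powr tendsto_add tendsto_const tendsto_ident_at)
    show "((\<lambda>w::real. w powr (m - 1)) \<longlongrightarrow> 0) (at_right 0)"
      by (rule tendsto_zero_powrI[where b = "m - 1"])
         (use assms in \<open>auto intro!: tendsto_eq_intros eventually_at_right_less[THEN eventually_mono]\<close>)
  qed auto
  then show ?thesis by (simp add: fden_def[abs_def])
qed

lemma fden_tendsto_0_at_top:
  assumes "0 < k"
  shows "(fden m k \<longlongrightarrow> 0) at_top"
proof -
  \<comment> \<open>Pairing \<open>1 + w\<close> with \<open>w\<close> isolates the true decay
    \<open>w powr (- 1 - k)\<close> from a factor tending to 1.\<close>
  have "((\<lambda>w::real. w powr (- 1 - k) * (w / (1 + w)) powr (m + k)) \<longlongrightarrow> 0 * 1 powr (m + k)) at_top"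
  proof (intro tendsto_mult tendsto_powr tendsto_const)
    show "((\<lambda>w::real. w powr (- 1 - k)) \<longlongrightarrow> 0) at_top"
      using assms by (intro tendsto_neg_powr filterlim_ident) auto
    show "((\<lambda>w::real. w / (1 + w)) \<longlongrightarrow> 1) at_top" by real_asymp
  qed auto
  moreover have "\<forall>\<^sub>F w in at_top. w powr (- 1 - k) * (w / (1 + w)) powr (m + k) = fden m k w"
    using eventually_gt_at_top[of 0]
  proof eventually_elim
    fix w :: real assume "0 < w"
    moreover from this have "w powr (- 1 - k) * w powr (m + k) = w powr (m - 1)"
      by (simp add: powr_add[symmetric])
    ultimately show "w powr (- 1 - k) * (w / (1 + w)) powr (m + k) = fden m k w"
      using powr_minus_divide[of "1 + w" "m + k"] by (simp add: fden_def powr_divide)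
  qed
  ultimately have "(fden m k \<longlongrightarrow> 0 * 1 powr (m + k)) at_top"
    by (rule Lim_transform_eventually)
  then show ?thesis by simp
qed

lemma abs_continuous_on_fden:
  assumes "0 < a"
  shows "abs_continuous_on a b (fden m k)"
proof (cases "a \<le> b")
  case True
  define D where "D w = fden m k w * ((m - 1) / w - (m + k) / (1 + w))" for w
  have "continuous_on {a..b} D"
    unfolding D_def using assms
    by (intro continuous_intros continuous_on_subset[OF continuous_on_fden]) auto
  then have "bounded (D ` {a..b})"
    by (intro compact_imp_bounded compact_continuous_image) auto
  then obtain C where C: "0 < C" "\<And>w. w \<in> {a..b} \<Longrightarrow> \<bar>D w\<bar> \<le> C"
    unfolding bounded_pos by auto
  have "norm (fden m k y - fden m k x) \<le> C * norm (y - x)" if "x \<in> {a..b}" "y \<in> {a..b}" for x y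
  proof (rule field_differentiable_bound[of "{a..b}" "fden m k" D C])
    show "(fden m k has_field_derivative D z) (at z within {a..b})" if "z \<in> {a..b}" for z
      unfolding D_def using that assms by (intro DERIV_subset[OF has_real_derivative_fden]) auto
  qed (use that C in auto)
  then show ?thesis
    using C(1) by (intro abs_continuous_on_lipschitz[of C]) auto
next
  case False
  then show ?thesis
    by (intro abs_continuous_on_lipschitz[of 0]) auto
qed

lemma abs_continuous_on_bounded:
  assumes "abs_continuous_on a b f"
  obtains C where "0 < C" "\<And>x. x \<in> {a..b} \<Longrightarrow> \<bar>f x\<bar> \<le> C"
proof -
  have "bounded (f ` {a..b})"
    by (intro compact_imp_bounded compact_continuous_image abs_continuous_on_imp_continuous_on assms) auto
  then show thesis using that unfolding bounded_pos by auto
qed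

text \<open>The term \<open>4 \<phi> + 2 \<phi>\<^sup>2\<close> is bounded below, so the boundary term at infinity is
  nonnegative in the limit; at \<open>0\<close> it is bounded by a multiple of \<open>\<phi>\<^sup>2 f\<close> plus a vanishing term,
  and \<open>\<phi>\<^sup>2 f\<close> cannot stay away from \<open>0\<close> when \<open>\<phi>\<^sup>2 f / w\<close> is integrable.\<close>
lemma integral_derivative_quadratic_nonneg:
  fixes m k :: real
  assumes lac: "locally_abs_continuous \<phi>"
    and diff: "AE w in lborel. 0 < w \<longrightarrow> (\<phi> has_real_derivative \<phi>' w) (at w)"
    and m: "1 < m" and k: "0 < k"
  defines "D \<equiv> \<lambda>w. (4 * \<phi>' w + 4 * \<phi> w * \<phi>' w) * fden m k w
     + (4 * \<phi> w + 2 * (\<phi> w)\<^sup>2) * (fden m k w * ((m - 1) / w - (m + k) / (1 + w)))"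
  assumes int: "set_integrable lborel {0<..} D"
    and int2: "set_integrable lborel {0<..1} (\<lambda>w. (\<phi> w)\<^sup>2 / w * fden m k w)"
  shows "0 \<le> (LINT w:{0<..}|lborel. D w)"
proof -
  define H where "H w = (4 * \<phi> w + 2 * (\<phi> w)\<^sup>2) * fden m k w" for w
  have deriv: "AE w in lborel. 0 < w \<longrightarrow> (H has_real_derivative D w) (at w)"
    using diff
  proof (eventually_elim, intro impI)
    fix w :: real assume w: "0 < w" "0 < w \<longrightarrow> (\<phi> has_real_derivative \<phi>' w) (at w)"
    then have "(\<phi> has_real_derivative \<phi>' w) (at w)" by simp
    then show "(H has_real_derivative D w) (at w)"
      unfolding H_def D_def
      by (auto intro!: derivative_eq_intros has_real_derivative_fden[OF w(1)] simp: algebra_simps power2_eq_square add_divide_distrib)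
  qed
  have Hac: "abs_continuous_on a b H" if ab: "0 < a" "a \<le> b" for a b
  proof -
    have ac: "abs_continuous_on a b \<phi>" using lac ab by (simp add: locally_abs_continuous_def)
    obtain A where A: "0 < A" "\<And>x. x \<in> {a..b} \<Longrightarrow> \<bar>\<phi> x\<bar> \<le> A"
      using abs_continuous_on_bounded[OF ac] by blast
    obtain B where B: "0 < B" "\<And>x. x \<in> {a..b} \<Longrightarrow> \<bar>fden m k x\<bar> \<le> B"
      using abs_continuous_on_bounded[OF abs_continuous_on_fden[OF ab(1)]] by blast
    \<comment> \<open>The increment of the product \<open>H\<close> splits into a factor bounded by
      \<open>4 * A + 2 * A\<^sup>2\<close> times the increment of the density, and a factor bounded
      by \<open>B * (4 + 4 * A)\<close> times the increment of \<open>\<phi>\<close>.\<close>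
    define C where "C = (4 * A + 2 * A\<^sup>2) + B * (4 + 4 * A)"
    have C: "0 \<le> C" using A(1) B(1) by (simp add: C_def)
    show ?thesis
    proof (rule abs_continuous_on_dominated[OF ac abs_continuous_on_fden[OF ab(1)] C])
      fix x y assume xy: "x \<in> {a..b}" "y \<in> {a..b}"
      note bd = A(2)[OF xy(1)] A(2)[OF xy(2)] B(2)[OF xy(1)]
      have "(\<phi> y)\<^sup>2 \<le> A\<^sup>2" using power_mono[OF bd(2), of 2] by simp
      then have 1: "\<bar>4 * \<phi> y + 2 * (\<phi> y)\<^sup>2\<bar> \<le> 4 * A + 2 * A\<^sup>2"
        using bd(2) zero_le_power2[of "\<phi> y"] zero_le_power2[of A] unfolding abs_le_iff by (elim conjE, intro conjI) linarith+
      have 2: "\<bar>fden m k x * (4 + 2 * (\<phi> y + \<phi> x))\<bar> \<le> B * (4 + 4 * A)"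
        unfolding abs_mult using bd B(1) by (intro mult_mono) auto
      have "\<bar>H y - H x\<bar> = \<bar>(4 * \<phi> y + 2 * (\<phi> y)\<^sup>2) * (fden m k y - fden m k x)
          + (fden m k x * (4 + 2 * (\<phi> y + \<phi> x))) * (\<phi> y - \<phi> x)\<bar>"
        by (simp add: H_def algebra_simps power2_eq_square)
      also have "\<dots> \<le> (4 * A + 2 * A\<^sup>2) * \<bar>fden m k y - fden m k x\<bar> + (B * (4 + 4 * A)) * \<bar>\<phi> y - \<phi> x\<bar>"
        by (rule order_trans[OF abs_triangle_ineq])
           (unfold abs_mult[of "4 * \<phi> y + 2 * (\<phi> y)\<^sup>2"] abs_mult[of "fden m k x * (4 + 2 * (\<phi> y + \<phi> x))"],
            intro add_mono mult_right_mono 1 2 abs_ge_zero)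
      also have "\<dots> \<le> C * (\<bar>\<phi> y - \<phi> x\<bar> + \<bar>fden m k y - fden m k x\<bar>)"
      proof -
        have "(4 * A + 2 * A\<^sup>2) * \<bar>fden m k y - fden m k x\<bar> \<le> C * \<bar>fden m k y - fden m k x\<bar>"
             "(B * (4 + 4 * A)) * \<bar>\<phi> y - \<phi> x\<bar> \<le> C * \<bar>\<phi> y - \<phi> x\<bar>"
          using A(1) B(1) by (auto intro!: mult_right_mono simp: C_def)
        then show ?thesis by (simp add: distrib_left)
      qed
      finally show "\<bar>H y - H x\<bar> \<le> C * (\<bar>\<phi> y - \<phi> x\<bar> + \<bar>fden m k y - fden m k x\<bar>)" .
    qed
  qed
  have FTC: "(LINT w:{a..b}|lborel. D w) = H b - H a" if "0 < a" "a \<le> b" for a b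
    by (rule locally_abs_continuous_FTC[OF Hac deriv int that])
  have int_top: "set_integrable lborel {1..} D" and int_bot: "set_integrable lborel {0<..1} D"
    by (rule set_integrable_subset[OF int]; auto)+
  have lim_top: "((\<lambda>b. H b - H 1) \<longlongrightarrow> (LINT w:{1..}|lborel. D w)) at_top"
    using tendsto_set_lebesgue_integral_at_top[OF _ int_top]
    by (rule tendsto_cong[THEN iffD1, rotated])
       (auto intro!: eventually_mono[OF eventually_ge_at_top[of 1]] FTC)
  have lim_bot: "((\<lambda>a. H 1 - H a) \<longlongrightarrow> (LINT w:{0<..1}|lborel. D w)) (at_right 0)"
    using tendsto_set_lebesgue_integral_at_right[OF zero_less_one _ int_bot]
    by (rule tendsto_cong[THEN iffD1, rotated])
       (auto intro!: eventually_mono[OF eventually_at_right_real[of 0 1]] FTC)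
  have tot: "(LINT w:{0<..}|lborel. D w) = (LINT w:{0<..1}|lborel. D w) + (LINT w:{1..}|lborel. D w)"
  proof -
    have "{0<..} = {0<..1} \<union> {1::real..}" by auto
    then show ?thesis
      using int_top int_bot AE_lborel_singleton[of "1::real"]
      by (simp only:) (rule set_integral_Un_AE, auto elim: eventually_mono)
  qed
  have Htop: "- H 1 \<le> (LINT w:{1..}|lborel. D w)"
  proof -
    have "((\<lambda>b. - 2 * fden m k b - H 1) \<longlongrightarrow> - 2 * 0 - H 1) at_top"
      by (intro tendsto_intros fden_tendsto_0_at_top k)
    \<comment> \<open>Completing the square,
      \<open>4 \<phi> + 2 \<phi>\<^sup>2 = 2 (\<phi> + 1)\<^sup>2 - 2\<close>, so \<open>H\<close>
      is at least minus twice the density, which vanishes at infinity.\<close>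
    moreover have "- 2 * fden m k b - H 1 \<le> H b - H 1" for b
    proof -
      have "H b + 2 * fden m k b = 2 * (\<phi> b + 1)\<^sup>2 * fden m k b"
        by (simp add: H_def algebra_simps power2_eq_square)
      then have "0 \<le> H b + 2 * fden m k b" by simp
      then show ?thesis by simp
    qed
    ultimately show ?thesis
      using tendsto_le[OF _ lim_top] by fastforce
  qed
  define L where "L = H 1 - (LINT w:{0<..1}|lborel. D w)"
  have limL: "(H \<longlongrightarrow> L) (at_right 0)"
    using tendsto_diff[OF tendsto_const[of "H 1"] lim_bot] by (simp add: L_def)
  have "L \<le> 0"
  proof (rule ccontr)
    assume "\<not> L \<le> 0"
    then have L: "0 < L" by simp
    have "\<forall>\<^sub>F a in at_right 0. L / 2 < H a" using limL L by (intro order_tendstoD(1)) auto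
    moreover have "\<forall>\<^sub>F a in at_right 0. fden m k a < L / 8"
      using fden_tendsto_0_at_right[OF m] L by (intro order_tendstoD(2)) auto
    ultimately have "\<forall>\<^sub>F a in at_right 0. L / 16 \<le> (\<phi> a)\<^sup>2 * fden m k a"
    proof eventually_elim
      fix a assume a: "L / 2 < H a" "fden m k a < L / 8"
      \<comment> \<open>This square yields
        \<open>4 \<phi> + 2 \<phi>\<^sup>2 \<le> 2 + 4 \<phi>\<^sup>2\<close>. Then L/2 < 2 (L/8) +
        4 \<open>\<phi>\<^sup>2 f\<close> leaves more than L/16, and dividing by w gives a
        logarithmically divergent lower bound.\<close>
      have "0 \<le> 2 * (\<phi> a - 1)\<^sup>2 * fden m k a" by simp
      then have "H a \<le> 2 * fden m k a + 4 * ((\<phi> a)\<^sup>2 * fden m k a)"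
        by (simp add: H_def algebra_simps power2_eq_square)
      then show "L / 16 \<le> (\<phi> a)\<^sup>2 * fden m k a" using a by simp
    qed
    then obtain c0 where c0: "0 < c0" "\<And>a. 0 < a \<Longrightarrow> a < c0 \<Longrightarrow> L / 16 \<le> (\<phi> a)\<^sup>2 * fden m k a"
      unfolding eventually_at_right_field by blast
    define c where "c = min c0 1"
    have c: "0 < c" "\<And>a. 0 < a \<Longrightarrow> a < c \<Longrightarrow> L / 16 \<le> (\<phi> a)\<^sup>2 * fden m k a" "c \<le> 1"
      using c0 by (auto simp: c_def)
    define I where "I = (LINT w:{0<..1}|lborel. (\<phi> w)\<^sup>2 / w * fden m k w)"
    have bound: "L / 16 * (ln (c / 2) - ln a) \<le> I" if a: "0 < a" "a \<le> c / 2" for a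
    proof -
      have "((\<lambda>w. L / 16 / w) has_integral (L / 16 * ln (c / 2) - L / 16 * ln a)) {a..c/2}"
        using a by (intro fundamental_theorem_of_calculus)
          (auto intro!: derivative_eq_intros simp: has_real_derivative_iff_has_vector_derivative[symmetric])
      moreover have si: "set_integrable lborel {a..c/2} (\<lambda>w. (\<phi> w)\<^sup>2 / w * fden m k w)"
        by (rule set_integrable_subset[OF int2]) (use a c(3) in auto)
      have "((\<lambda>w. (\<phi> w)\<^sup>2 / w * fden m k w) has_integral
          (LINT w:{a..c/2}|lborel. (\<phi> w)\<^sup>2 / w * fden m k w)) {a..c/2}"
        unfolding set_borel_integral_eq_integral(2)[OF si]
        by (rule integrable_integral[OF set_borel_integral_eq_integral(1)[OF si]])
      ultimately have "L / 16 * ln (c / 2) - L / 16 * ln a \<le> (LINT w:{a..c/2}|lborel. (\<phi> w)\<^sup>2 / w * fden m k w)"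
      proof (rule has_integral_le)
        fix w assume w: "w \<in> {a..c/2}"
        then have "L / 16 \<le> (\<phi> w)\<^sup>2 * fden m k w" using a c(1) by (intro c(2)) auto
        then show "L / 16 / w \<le> (\<phi> w)\<^sup>2 / w * fden m k w"
          using w a divide_right_mono[of "L / 16" "(\<phi> w)\<^sup>2 * fden m k w" w] by simp
      qed
      also have "\<dots> \<le> I"
        unfolding I_def set_lebesgue_integral_def
        by (rule integral_mono) (use a c(3) si int2 in \<open>auto simp: set_integrable_def indicator_def\<close>)
      finally show ?thesis by (simp add: algebra_simps)
    qed
    \<comment> \<open>Solves L/16 (ln (c/2) - ln a) = |I| + 1, so that the logarithmic lower bound
      exceeds the finite integral \<open>I\<close>.\<close>
    define a where "a = c / 2 * exp (- (16 * (\<bar>I\<bar> + 1) / L))"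
    have "0 < a" "a \<le> c / 2" using c(1) L by (auto simp: a_def mult_le_cancel_left1)
    then have "\<bar>I\<bar> + 1 \<le> I"
    proof -
      have "ln a = ln (c / 2) + - (16 * (\<bar>I\<bar> + 1) / L)"
        unfolding a_def using c(1) by (subst ln_mult_pos) auto
      then have "L / 16 * (ln (c / 2) - ln a) = \<bar>I\<bar> + 1" using L by simp
      then show ?thesis using bound[OF \<open>0 < a\<close> \<open>a \<le> c / 2\<close>] by simp
    qed
    then show False by simp
  qed
  then show ?thesis
    using tot Htop by (simp add: L_def)
qed

section \<open>Ratios of chi-square variables\<close>

lemma space_chi_square [simp]: "space (chi_square k) = {0<..}"
  by (simp add: chi_square_def space_restrict_space)

lemma sets_chi_square [simp, measurable_cong]: "sets (chi_square k) = sets (restrict_space borel {0<..})"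
  by (simp add: chi_square_def sets_restrict_space)

lemma measurable_chi_square_id [measurable]: "(\<lambda>x. x) \<in> borel_measurable (chi_square k)"
  by (subst measurable_cong_sets[OF sets_chi_square refl]) (rule measurable_restrict_space1, simp)

lemma borel_measurable_chi_square_density [measurable]: "chi_square_density k \<in> borel_measurable borel"
  unfolding chi_square_density_def by measurable

lemma chi_square_density_nonneg [simp]: "0 < k \<Longrightarrow> 0 \<le> chi_square_density k x"
  unfolding chi_square_density_def by (intro divide_nonneg_pos mult_nonneg_nonneg mult_pos_pos Gamma_real_pos) auto

lemma nn_integral_chi_square:
  assumes [measurable]: "f \<in> borel_measurable borel"
  shows "(\<integral>\<^sup>+x. f x \<partial>chi_square k) = (\<integral>\<^sup>+x. ennreal (chi_square_density k x) * f x * indicator {0<..} x \<partial>lborel)"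
  unfolding chi_square_def
  by (subst nn_integral_density)
     (auto simp: nn_integral_restrict_space intro!: measurable_restrict_space1)

lemma nn_integral_gamma:
  fixes s c :: real
  assumes s: "0 < s" and c: "0 < c"
  shows "(\<integral>\<^sup>+v. ennreal (v powr (s - 1) * exp (- (c * v))) * indicator {0<..} v \<partial>lborel) = ennreal (Gamma s / c powr s)"
proof -
  have "ennreal (Gamma s) = (\<integral>\<^sup>+t. ennreal (indicator {0..} t * t powr (s - 1) / exp t) \<partial>lborel)"
    using Gamma_conv_nn_integral_real[OF s] .
  also have "\<dots> = ennreal c * (\<integral>\<^sup>+v. ennreal (indicator {0..} (0 + c * v) * (0 + c * v) powr (s - 1) / exp (0 + c * v)) \<partial>lborel)"
    by (subst nn_integral_real_affine[of _ c 0]) (use c in auto)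
  also have "\<dots> = ennreal c * (\<integral>\<^sup>+v. ennreal (c powr (s - 1)) * (ennreal (v powr (s - 1) * exp (- (c * v))) * indicator {0<..} v) \<partial>lborel)"
    using c by (intro arg_cong[where f="\<lambda>x. ennreal c * x"] nn_integral_cong)
      (auto simp: indicator_def powr_mult exp_minus divide_inverse ennreal_mult[symmetric] zero_le_mult_iff not_less)
  also have "\<dots> = ennreal (c powr s) * (\<integral>\<^sup>+v. ennreal (v powr (s - 1) * exp (- (c * v))) * indicator {0<..} v \<partial>lborel)"
    using c by (subst nn_integral_cmult) (auto simp: mult.assoc[symmetric] ennreal_mult[symmetric] powr_minus_one_divide)
  finally have "ennreal (Gamma s) = \<dots>" .
  then have "ennreal (1 / c powr s) * ennreal (Gamma s) = ennreal (1 / c powr s) * (ennreal (c powr s) *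
      (\<integral>\<^sup>+v. ennreal (v powr (s - 1) * exp (- (c * v))) * indicator {0<..} v \<partial>lborel))"
    by simp
  then show ?thesis
    using c s by (simp add: mult.assoc[symmetric] ennreal_mult[symmetric])
qed

lemma prob_space_chi_square:
  assumes "0 < k"
  shows "prob_space (chi_square k)"
proof
  define C where "C = 2 powr (real k / 2) * Gamma (real k / 2)"
  have Gk: "0 < Gamma (real k / 2)" using assms by (intro Gamma_real_pos) auto
  have C: "0 < C" unfolding C_def using assms by (intro mult_pos_pos Gamma_real_pos) auto
  have "emeasure (chi_square k) (space (chi_square k)) = (\<integral>\<^sup>+x. 1 \<partial>chi_square k)"
    by simp
  also have "\<dots> = (\<integral>\<^sup>+x. ennreal (1 / C) * (ennreal (x powr (real k / 2 - 1) * exp (- (1 / 2 * x))) * indicator {0<..} x) \<partial>lborel)"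
    using C by (subst nn_integral_chi_square)
      (auto intro!: nn_integral_cong simp: chi_square_density_def C_def[symmetric] ennreal_mult[symmetric] indicator_def)
  also have "\<dots> = ennreal (1 / C) * ennreal (Gamma (real k / 2) / (1 / 2) powr (real k / 2))"
    using assms by (subst nn_integral_gamma[of "real k / 2" "1 / 2", symmetric]) (auto intro!: nn_integral_cmult)
  also have "\<dots> = 1"
    using C Gk by (simp add: ennreal_mult[symmetric] C_def powr_divide)
  finally show "emeasure (chi_square k) (space (chi_square k)) = 1" .
qed

definition ratio_law :: "nat \<Rightarrow> nat \<Rightarrow> real measure" where
  "ratio_law N n = distr (chi_square N \<Otimes>\<^sub>M chi_square n) borel (\<lambda>(u, v). u / v)"

definition ratio_const :: "nat \<Rightarrow> nat \<Rightarrow> real" where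
  "ratio_const N n = Gamma (real N / 2 + real n / 2) / (Gamma (real N / 2) * Gamma (real n / 2))"

lemma ratio_const_pos: "0 < N \<Longrightarrow> 0 < n \<Longrightarrow> 0 < ratio_const N n"
  unfolding ratio_const_def by (intro divide_pos_pos mult_pos_pos Gamma_real_pos) auto

lemma ratio_const_Suc_Suc:
  assumes "0 < N" "0 < n"
  shows "ratio_const (N + 2) n = ratio_const N n * ((real N + real n) / real N)"
proof -
  have 1: "Gamma (real N / 2 + 1) = real N / 2 * Gamma (real N / 2)"
    using assms by (intro Gamma_plus1) (auto simp: nonpos_Ints_def)
  have 2: "Gamma (real N / 2 + real n / 2 + 1) = (real N / 2 + real n / 2) * Gamma (real N / 2 + real n / 2)"
    using assms by (intro Gamma_plus1) (auto elim!: nonpos_Ints_cases)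
  have e: "real (N + 2) / 2 = real N / 2 + 1" "real (N + 2) / 2 + real n / 2 = real N / 2 + real n / 2 + 1"
    "real N / 2 + 1 + real n / 2 = real N / 2 + real n / 2 + 1"
    by (auto simp: field_simps)
  show ?thesis
    unfolding ratio_const_def e 1 2 using assms Gamma_real_pos[of "real N / 2"] Gamma_real_pos[of "real n / 2"]
    by (simp add: divide_simps)
qed

lemma measurable_chi_square_pair_ratio [measurable]:
  "(\<lambda>(u, v). u / v) \<in> borel_measurable (chi_square N \<Otimes>\<^sub>M chi_square n)"
  by measurable

text \<open>For fixed v substitute u = v w and exchange the integrals: what remains in v is a gamma
  integral with shape m + k and rate (1 + w)/2, which produces both the power of 1 + w and the
  constant.\<close>

lemma ratio_law_eq:
  assumes N: "0 < N" and n: "0 < n"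
  shows "ratio_law N n = density lborel (\<lambda>w. ennreal (indicator {0<..} w * (ratio_const N n * fden (real N / 2) (real n / 2) w)))"
proof (rule measure_eqI)
  interpret cN: prob_space "chi_square N" by (rule prob_space_chi_square[OF N])
  interpret cn: prob_space "chi_square n" by (rule prob_space_chi_square[OF n])
  interpret P: pair_prob_space "chi_square N" "chi_square n" ..
  define m k where "m = real N / 2" and "k = real n / 2"
  have mk: "0 < m" "0 < k" using N n by (auto simp: m_def k_def)
  have G: "0 < Gamma m" "0 < Gamma k" "0 < Gamma (m + k)" using mk by auto
  fix A assume "A \<in> sets (ratio_law N n)"
  then have [measurable]: "A \<in> sets borel" by (simp add: ratio_law_def)
  have "emeasure (ratio_law N n) A = (\<integral>\<^sup>+w. indicator A w \<partial>ratio_law N n)"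
    by (simp add: ratio_law_def)
  also have "\<dots> = (\<integral>\<^sup>+z. indicator A (fst z / snd z) \<partial>(chi_square N \<Otimes>\<^sub>M chi_square n))"
    unfolding ratio_law_def by (subst nn_integral_distr) (auto simp: case_prod_unfold)
  also have "\<dots> = (\<integral>\<^sup>+v. (\<integral>\<^sup>+u. indicator A (u / v) \<partial>chi_square N) \<partial>chi_square n)"
    by (subst P.nn_integral_snd[symmetric]) auto
  also have "\<dots> = (\<integral>\<^sup>+v. (\<integral>\<^sup>+w. ennreal (v * chi_square_density N (v * w)) * indicator A w * indicator {0<..} w \<partial>lborel) \<partial>chi_square n)"
  proof (rule nn_integral_cong)
    fix v assume "v \<in> space (chi_square n)"
    then have v: "0 < v" by simp
    have "(\<integral>\<^sup>+u. indicator A (u / v) \<partial>chi_square N) = (\<integral>\<^sup>+u. ennreal (chi_square_density N u) * indicator A (u / v) * indicator {0<..} u \<partial>lborel)"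
      by (subst nn_integral_chi_square) auto
    also have "\<dots> = ennreal \<bar>v\<bar> * (\<integral>\<^sup>+w. ennreal (chi_square_density N (0 + v * w)) * indicator A ((0 + v * w) / v) * indicator {0<..} (0 + v * w) \<partial>lborel)"
      by (subst nn_integral_real_affine[of _ v 0]) (use v in auto)
    also have "\<dots> = (\<integral>\<^sup>+w. ennreal v * (ennreal (chi_square_density N (0 + v * w)) * indicator A ((0 + v * w) / v) * indicator {0<..} (0 + v * w)) \<partial>lborel)"
      using v by (subst nn_integral_cmult) auto
    also have "\<dots> = (\<integral>\<^sup>+w. ennreal (v * chi_square_density N (v * w)) * indicator A w * indicator {0<..} w \<partial>lborel)"
      using v N by (intro nn_integral_cong) (auto simp: indicator_def ennreal_mult zero_less_mult_iff mult.assoc)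
    finally show "(\<integral>\<^sup>+u. indicator A (u / v) \<partial>chi_square N) = \<dots>" .
  qed
  also have "\<dots> = (\<integral>\<^sup>+v. (\<integral>\<^sup>+w. ennreal (chi_square_density n v) * (ennreal (v * chi_square_density N (v * w)) * indicator A w * indicator {0<..} w) * indicator {0<..} v \<partial>lborel) \<partial>lborel)"
    by (subst nn_integral_chi_square) (auto simp: nn_integral_cmult nn_integral_multc)
  also have "\<dots> = (\<integral>\<^sup>+w. (\<integral>\<^sup>+v. ennreal (chi_square_density n v) * (ennreal (v * chi_square_density N (v * w)) * indicator A w * indicator {0<..} w) * indicator {0<..} v \<partial>lborel) \<partial>lborel)"
    by (rule lborel_pair.Fubini') measurable
  also have "\<dots> = (\<integral>\<^sup>+w. ennreal (indicator {0<..} w * (ratio_const N n * fden m k w)) * indicator A w \<partial>lborel)"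
  proof (rule nn_integral_cong)
    fix w :: real
    define K where "K = w powr (m - 1) / (2 powr m * Gamma m * (2 powr k * Gamma k))"
    have K: "0 \<le> K" unfolding K_def using G by (intro divide_nonneg_pos) auto
    show "(\<integral>\<^sup>+v. ennreal (chi_square_density n v) * (ennreal (v * chi_square_density N (v * w)) * indicator A w * indicator {0<..} w) * indicator {0<..} v \<partial>lborel)
      = ennreal (indicator {0<..} w * (ratio_const N n * fden m k w)) * indicator A w"
    proof (cases "0 < w \<and> w \<in> A")
      case True
      then have w: "0 < w" and wA: "w \<in> A" by auto
      have pt: "chi_square_density n v * (v * chi_square_density N (v * w)) = K * (v powr (m + k - 1) * exp (- ((1 + w) / 2 * v)))"
        if v: "0 < v" for v
      proof -
        have "v powr (m + k - 1) = v powr (k - 1) * (v * v powr (m - 1))"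
          using v powr_add[of v "k - 1" "1 + (m - 1)"] powr_add[of v 1 "m - 1"] by (simp add: algebra_simps)
        moreover have "exp (- ((1 + w) / 2 * v)) = exp (- v / 2) * exp (- (v * w) / 2)"
          by (simp add: exp_add[symmetric] field_simps)
        moreover have "(v * w) powr (m - 1) = v powr (m - 1) * w powr (m - 1)"
          using v w by (simp add: powr_mult)
        ultimately show ?thesis
          unfolding chi_square_density_def K_def m_def[symmetric] k_def[symmetric] by (simp add: mult_ac)
      qed
      have "(\<integral>\<^sup>+v. ennreal (chi_square_density n v) * (ennreal (v * chi_square_density N (v * w)) * indicator A w * indicator {0<..} w) * indicator {0<..} v \<partial>lborel)
        = (\<integral>\<^sup>+v. ennreal K * (ennreal (v powr (m + k - 1) * exp (- ((1 + w) / 2 * v))) * indicator {0<..} v) \<partial>lborel)"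
        using w wA N n K by (intro nn_integral_cong) (auto simp: indicator_def ennreal_mult[symmetric] pt)
      also have "\<dots> = ennreal K * ennreal (Gamma (m + k) / ((1 + w) / 2) powr (m + k))"
        using w mk by (subst nn_integral_gamma[of "m + k" "(1 + w) / 2", symmetric]) (auto intro!: nn_integral_cmult)
      also have "\<dots> = ennreal (ratio_const N n * fden m k w)"
      proof -
        have "K * (Gamma (m + k) / ((1 + w) / 2) powr (m + k)) = ratio_const N n * fden m k w"
          unfolding K_def ratio_const_def fden_def m_def[symmetric] k_def[symmetric]
          using w G by (simp add: powr_divide powr_minus_divide powr_add[of 2] del: minus_add_distrib)
        then show ?thesis using K G w by (simp add: ennreal_mult[symmetric])
      qed
      finally show ?thesis using w wA by simp
    qed (auto simp: indicator_def)
  qed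
  also have "\<dots> = emeasure (density lborel (\<lambda>w. ennreal (indicator {0<..} w * (ratio_const N n * fden m k w)))) A"
    by (subst emeasure_density) auto
  finally show "emeasure (ratio_law N n) A = emeasure (density lborel (\<lambda>w. ennreal (indicator {0<..} w * (ratio_const N n * fden (real N / 2) (real n / 2) w)))) A"
    by (simp add: m_def k_def)
qed (simp add: ratio_law_def)

lemma prob_space_ratio_law:
  assumes "0 < N" "0 < n"
  shows "prob_space (ratio_law N n)"
proof -
  interpret cN: prob_space "chi_square N" by (rule prob_space_chi_square[OF assms(1)])
  interpret cn: prob_space "chi_square n" by (rule prob_space_chi_square[OF assms(2)])
  interpret P: pair_prob_space "chi_square N" "chi_square n" ..
  show ?thesis unfolding ratio_law_def by (rule P.prob_space_distr) measurable
qed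

lemma sets_ratio_law [simp, measurable_cong]: "sets (ratio_law N n) = sets borel"
  by (simp add: ratio_law_def)

lemma
  fixes F :: "real \<Rightarrow> real"
  assumes "0 < N" "0 < n" and [measurable]: "F \<in> borel_measurable borel"
  shows integrable_ratio_law_iff:
      "integrable (ratio_law N n) F \<longleftrightarrow> set_integrable lborel {0<..} (\<lambda>w. F w * fden (real N / 2) (real n / 2) w)" (is ?A)
    and integral_ratio_law:
      "integral\<^sup>L (ratio_law N n) F = ratio_const N n * (LINT w:{0<..}|lborel. F w * fden (real N / 2) (real n / 2) w)" (is ?B)
proof -
  let ?c = "ratio_const N n" and ?f = "fden (real N / 2) (real n / 2)"
  have c: "0 < ?c" using assms by (simp add: ratio_const_pos)
  have e: "indicator {0<..} w * (?c * ?f w) * F w = ?c * (indicator {0<..} w * (F w * ?f w))" for w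
    by simp
  have "integrable (ratio_law N n) F \<longleftrightarrow> integrable lborel (\<lambda>w. indicator {0<..} w * (?c * ?f w) * F w)"
    unfolding ratio_law_eq[OF assms(1,2)] using c
    by (subst integrable_density) (auto intro!: AE_I2)
  then show ?A unfolding e set_integrable_def using c by (simp add: integrable_mult_right_iff)
  have "integral\<^sup>L (ratio_law N n) F = (\<integral>w. indicator {0<..} w * (?c * ?f w) * F w \<partial>lborel)"
    unfolding ratio_law_eq[OF assms(1,2)] using c
    by (subst integral_density) (auto intro!: AE_I2)
  then show ?B unfolding e set_lebesgue_integral_def by simp
qed

section \<open>Monotonicity in the degrees of freedom\<close>

lemma set_integrable_fden:
  assumes "0 < N" "0 < n"
  shows "set_integrable lborel {0<..} (fden (real N / 2) (real n / 2))" (is ?A)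
    and "ratio_const N n * (LINT w:{0<..}|lborel. fden (real N / 2) (real n / 2) w) = 1" (is ?B)
proof -
  interpret prob_space "ratio_law N n" by (rule prob_space_ratio_law[OF assms])
  have "integrable (ratio_law N n) (\<lambda>_. 1 :: real)" by simp
  then show ?A using integrable_ratio_law_iff[OF assms, of "\<lambda>_. 1"] by simp
  have "integral\<^sup>L (ratio_law N n) (\<lambda>_. 1 :: real) = 1" using prob_space by simp
  then show ?B using integral_ratio_law[OF assms, of "\<lambda>_. 1"] by simp
qed

lemma set_integrable_fden_Suc:
  assumes [measurable]: "F \<in> borel_measurable borel"
    and int: "set_integrable lborel {0<..} (\<lambda>w. F w * fden m k w)"
  shows "set_integrable lborel {0<..} (\<lambda>w. F w * fden (m + 1) k w)"
    and "set_integrable lborel {0<..} (\<lambda>w. F w * fden m (k + 1) w)"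
proof -
  have le: "\<bar>F w * fden m k w * c\<bar> \<le> \<bar>F w * fden m k w\<bar>" if "0 \<le> c" "c \<le> 1" for w c
    using that by (subst abs_mult) (simp add: mult_left_le)
  have b: "norm (F w * fden (m + 1) k w) \<le> norm (F w * fden m k w)"
    "norm (F w * fden m (k + 1) w) \<le> norm (F w * fden m k w)" if "0 < w" for w
    using le[of "w / (1 + w)" w] le[of "1 / (1 + w)" w] that
    by (simp_all add: fden_Suc_left fden_Suc_right)
  show "set_integrable lborel {0<..} (\<lambda>w. F w * fden (m + 1) k w)"
    by (rule set_integrable_bound[OF int])
       (use b(1) in \<open>auto simp: set_borel_measurable_def\<close>)
  show "set_integrable lborel {0<..} (\<lambda>w. F w * fden m (k + 1) w)"
    by (rule set_integrable_bound[OF int])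
       (use b(2) in \<open>auto simp: set_borel_measurable_def\<close>)
qed

text \<open>The powers combine to w^(s-1) (1 + w)^(-s-1) with s = m + k, the derivative of
  (w/(1+w))^s / s. It is the inner integral in the Fubini argument for the transform g.\<close>

lemma nn_integral_powr_fden:
  fixes m k t :: real
  assumes mk: "0 < m + k" and t: "0 < t"
  shows "(\<integral>\<^sup>+w. ennreal (indicator {0<..<t} w * (w powr k * fden m (k + 1) w)) \<partial>lborel)
    = ennreal ((t / (1 + t)) powr (m + k) / (m + k))"
proof -
  define s where "s = m + k"
  have s: "0 < s" using mk by (simp add: s_def)
  define U where "U w = (w / (1 + w)) powr s / s" for w :: real
  have "((\<lambda>w. w powr k * fden m (k + 1) w) has_integral U t - U 0) {0..t}"
  proof (rule fundamental_theorem_of_calculus_interior)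
    show "continuous_on {0..t} U"
      unfolding U_def using s by (intro continuous_intros continuous_on_powr') auto
    fix w assume "w \<in> {0<..<t}"
    then have w: "0 < w" by simp
    have "((\<lambda>w::real. w / (1 + w)) has_real_derivative 1 / (1 + w)^2) (at w)"
      using w by (auto intro!: derivative_eq_intros simp: power2_eq_square field_simps)
    from DERIV_chain2[OF has_real_derivative_powr this, of s]
    have "((\<lambda>w. (w / (1 + w)) powr s) has_real_derivative s * (w / (1 + w)) powr (s - 1) * (1 / (1 + w)^2)) (at w)"
      using w by simp
    then have "(U has_real_derivative s * (w / (1 + w)) powr (s - 1) * (1 / (1 + w)^2) / s) (at w)"
      unfolding U_def[abs_def] by (rule DERIV_cdivide)
    moreover have "s * (w / (1 + w)) powr (s - 1) * (1 / (1 + w)^2) / s = w powr k * fden m (k + 1) w"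
    proof -
      have "w powr (s - 1) = w powr k * w powr (m - 1)"
        by (simp add: s_def powr_add[symmetric] algebra_simps)
      moreover have "(1 + w) powr (- (m + (k + 1))) = 1 / ((1 + w) powr (s - 1) * (1 + w)^2)"
      proof -
        have "(1 + w)^2 = (1 + w) powr 2" using w by simp
        then show ?thesis
          using w by (simp add: s_def powr_add[symmetric] powr_minus_divide[symmetric] algebra_simps del: powr_numeral)
      qed
      ultimately show ?thesis
        using s w by (simp add: fden_def powr_divide)
    qed
    ultimately show "(U has_vector_derivative w powr k * fden m (k + 1) w) (at w)"
      by (simp add: has_real_derivative_iff_has_vector_derivative)
  qed (use t in auto)
  then have "((\<lambda>w. w powr k * fden m (k + 1) w) has_integral U t) {0<..<t}"
    using s by (simp add: has_integral_Icc_iff_Ioo U_def)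
  then have "((\<lambda>w. indicator {0<..<t} w * (w powr k * fden m (k + 1) w)) has_integral U t) UNIV"
    by (subst (asm) has_integral_restrict_UNIV[symmetric])
       (auto elim!: has_integral_eq[rotated] simp: indicator_def)
  then show ?thesis
    unfolding U_def s_def by (intro nn_integral_has_integral_lborel) auto
qed

text \<open>The outer integrand of the same Fubini argument: the factor (t/(1+t))^(m+k) left by the
  inner integral restores the density with \<open>k\<close> in place of
  \<open>k + 1\<close>.\<close>

lemma powr_transform_fden:
  fixes t :: real
  assumes "0 < t"
  shows "t powr (- k) * (x / t) * (t / (1 + t)) powr (m + k) = x * fden m k t"
proof -
  have "t powr (- k) * t powr (m + k) = t powr (m - 1) * t"
    using powr_minus_one_divide[OF assms, of m] assms by (simp add: powr_add[symmetric])
  moreover have "(t / (1 + t)) powr (m + k) = t powr (m + k) * (1 + t) powr (- (m + k))"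
    using assms by (simp add: powr_divide powr_minus_divide del: minus_add_distrib)
  moreover have "t powr (- k) * (x / t) * (t powr (m + k) * (1 + t) powr (- (m + k)))
      = (t powr (- k) * t powr (m + k)) * (x / t) * (1 + t) powr (- (m + k))"
    by (simp only: mult_ac)
  ultimately have "t powr (- k) * (x / t) * (t / (1 + t)) powr (m + k)
      = (t powr (m - 1) * t) * (x / t) * (1 + t) powr (- (m + k))"
    by (simp only:)
  then show ?thesis
    using assms by (simp add: fden_def)
qed

text \<open>Fubini on the region \<open>0 < w < t\<close>: this is the chi-square identity \<open>E [S g(W)] = 2 \<sigma>\<^sup>2 E [h(W)]\<close>
  in terms of the density of \<open>W\<close>.\<close>
lemma set_integral_g_transform:
  fixes m k :: real
  assumes m: "0 < m" and k: "0 < k" and [measurable]: "\<psi> \<in> borel_measurable borel"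
    and int: "set_integrable lborel {0<..} (\<lambda>t. \<psi> t * fden m k t)"
  defines "G \<equiv> \<lambda>w. LINT t:{w<..}|lborel. t powr (- k) * (\<psi> t / t)"
  shows "set_integrable lborel {0<..} (\<lambda>w. w powr k * G w * fden m (k + 1) w)" (is ?A)
    and "(LINT t:{0<..}|lborel. \<psi> t * fden m k t)
       = (m + k) * (LINT w:{0<..}|lborel. w powr k * G w * fden m (k + 1) w)" (is ?B)
proof -
  define A where "A w = w powr k * fden m (k + 1) w" for w
  define B where "B t = t powr (- k) * (\<psi> t / t)" for t
  have [measurable]: "A \<in> borel_measurable borel" "B \<in> borel_measurable borel"
    unfolding A_def B_def by measurable
  have A0: "0 \<le> A w" for w by (simp add: A_def)
  define K where "K w t = indicator {0<..} t * B t * (indicator {0<..<t} w * A w)" for w t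
  have Km: "(\<lambda>(w, t). K w t) \<in> borel_measurable (lborel \<Otimes>\<^sub>M lborel)"
  proof -
    have "(\<lambda>(w, t). K w t) = (\<lambda>z. (if 0 < snd z then 1 else 0) * B (snd z) * ((if 0 < fst z \<and> fst z < snd z then 1 else 0) * A (fst z)))"
      by (auto simp: K_def fun_eq_iff indicator_def)
    then show ?thesis by simp
  qed
  have inner: "(\<integral>\<^sup>+w. ennreal (indicator {0<..<t} w * A w) \<partial>lborel) = ennreal ((t / (1 + t)) powr (m + k) / (m + k))"
    if "0 < t" for t
    unfolding A_def using m k that by (intro nn_integral_powr_fden) auto
  \<comment> \<open>Integrating the absolute kernel over w first returns the assumed integrand
    divided by m + k, so the single integrability assumption on \<open>\<psi>\<close> justifies the
    exchange.\<close>
  have nn: "(\<integral>\<^sup>+w. ennreal \<bar>K w t\<bar> \<partial>lborel) = ennreal (indicator {0<..} t * \<bar>\<psi> t * fden m k t\<bar> / (m + k))" for t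
  proof (cases "0 < t")
    case True
    have "(\<integral>\<^sup>+w. ennreal \<bar>K w t\<bar> \<partial>lborel) = (\<integral>\<^sup>+w. ennreal \<bar>B t\<bar> * ennreal (indicator {0<..<t} w * A w) \<partial>lborel)"
      using True A0 by (intro nn_integral_cong) (auto simp: K_def abs_mult ennreal_mult[symmetric])
    also have "\<dots> = ennreal \<bar>B t\<bar> * ennreal ((t / (1 + t)) powr (m + k) / (m + k))"
      by (subst nn_integral_cmult) (simp_all add: inner[OF True])
    also have "\<dots> = ennreal (\<bar>B t * (t / (1 + t)) powr (m + k)\<bar> / (m + k))"
      using m k by (subst ennreal_mult[symmetric]) (auto simp: abs_mult)
    also have "B t * (t / (1 + t)) powr (m + k) = \<psi> t * fden m k t"
      unfolding B_def by (rule powr_transform_fden[OF True])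
    finally show ?thesis using True by simp
  qed (simp add: K_def)
  have intK: "integrable (lborel \<Otimes>\<^sub>M lborel) (\<lambda>(w, t). K w t)"
  proof (rule integrableI_bounded[OF Km])
    have "(\<integral>\<^sup>+z. ennreal (norm (case z of (w, t) \<Rightarrow> K w t)) \<partial>(lborel \<Otimes>\<^sub>M lborel))
      = (\<integral>\<^sup>+t. (\<integral>\<^sup>+w. ennreal (norm (case (w, t) of (w, t) \<Rightarrow> K w t)) \<partial>lborel) \<partial>lborel)"
      by (rule lborel_pair.nn_integral_snd[symmetric]) (use Km in measurable)
    also have "\<dots> = (\<integral>\<^sup>+t. ennreal (indicator {0<..} t * \<bar>\<psi> t * fden m k t\<bar> / (m + k)) \<partial>lborel)"
      by (simp add: nn)
    also have "\<dots> < \<infinity>"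
    proof -
      have "integrable lborel (\<lambda>t. indicator {0<..} t * \<bar>\<psi> t * fden m k t\<bar> / (m + k))"
        using integrable_norm[OF int[unfolded set_integrable_def]]
        by (intro integrable_divide) (simp add: abs_mult)
      then have "(\<integral>\<^sup>+t. ennreal (norm (indicator {0<..} t * \<bar>\<psi> t * fden m k t\<bar> / (m + k))) \<partial>lborel) < \<infinity>"
        by (simp add: integrable_iff_bounded)
      then show ?thesis using m k by simp
    qed
    finally show "(\<integral>\<^sup>+z. ennreal (norm (case z of (w, t) \<Rightarrow> K w t)) \<partial>(lborel \<Otimes>\<^sub>M lborel)) < \<infinity>" .
  qed
  have w_int: "(\<integral>t. K w t \<partial>lborel) = indicator {0<..} w * (w powr k * G w * fden m (k + 1) w)" for w
  proof -
    have "(\<integral>t. K w t \<partial>lborel) = (\<integral>t. (indicator {0<..} w * A w) * (indicator {w<..} t * B t) \<partial>lborel)"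
      by (intro Bochner_Integration.integral_cong) (auto simp: K_def indicator_def)
    also have "\<dots> = (indicator {0<..} w * A w) * (\<integral>t. indicator {w<..} t * B t \<partial>lborel)"
      by (rule integral_mult_right_zero)
    also have "\<dots> = (indicator {0<..} w * A w) * G w"
      by (simp add: G_def set_lebesgue_integral_def B_def)
    finally show ?thesis by (simp add: A_def mult_ac)
  qed
  have t_int: "(\<integral>w. K w t \<partial>lborel) = indicator {0<..} t * (\<psi> t * fden m k t) / (m + k)" for t
  proof (cases "0 < t")
    case True
    have "(\<integral>w. K w t \<partial>lborel) = B t * (\<integral>w. indicator {0<..<t} w * A w \<partial>lborel)"
      using True by (simp add: K_def)
    also have "(\<integral>w. indicator {0<..<t} w * A w \<partial>lborel) = (t / (1 + t)) powr (m + k) / (m + k)"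
      using m k True A0 by (subst integral_eq_nn_integral) (auto simp: inner)
    also have "B t * ((t / (1 + t)) powr (m + k) / (m + k)) = \<psi> t * fden m k t / (m + k)"
      using powr_transform_fden[OF True, of k "\<psi> t" m] by (simp add: B_def)
    finally show ?thesis using True by simp
  qed (simp add: K_def)
  show ?A
    using lborel_pair.integrable_fst'[OF intK] by (simp add: w_int set_integrable_def)
  have "(\<integral>t. (\<integral>w. K w t \<partial>lborel) \<partial>lborel) = (\<integral>w. (\<integral>t. K w t \<partial>lborel) \<partial>lborel)"
    by (rule lborel_pair.Fubini_integral) (use intK in simp)
  then show ?B
    using m k by (simp add: w_int t_int set_lebesgue_integral_def field_simps)
qed

text \<open>Both expectations are rewritten as integrals of g against densities with n + 2 degrees
  of freedom in the denominator. Their difference is then g integrated against a weight proportional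
  to m - (k + 1) w, which has total mass 0 and passes once from positive to negative; a
  nonincreasing g makes that nonnegative, by Chebyshev's argument.\<close>

lemma integral_ratio_law_antimono:
  assumes N: "0 < N" and n: "0 < n" and [measurable]: "\<psi> \<in> borel_measurable borel"
    and int: "integrable (ratio_law N n) \<psi>"
    and anti: "antimono_on {0<..} (\<lambda>w. w powr (real n / 2) * (LINT t:{w<..}|lborel. t powr (- (real n / 2)) * (\<psi> t / t)))"
  shows "integrable (ratio_law (N + 2) n) \<psi>"
    and "integral\<^sup>L (ratio_law (N + 2) n) \<psi> \<le> integral\<^sup>L (ratio_law N n) \<psi>"
proof -
  define m k where "m = real N / 2" and "k = real n / 2"
  have mk: "0 < m" "0 < k" using N n by (auto simp: m_def k_def)
  have e: "real (N + 2) / 2 = m + 1" "real (n + 2) / 2 = k + 1" by (simp_all add: m_def k_def)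
  define g where "g w = w powr k * (LINT t:{w<..}|lborel. t powr (- k) * (\<psi> t / t))" for w
  have anti: "g y \<le> g x" if "0 < x" "x \<le> y" for x y
    using monotone_onD[OF anti, of x y] that by (simp add: g_def k_def)
  have i0: "set_integrable lborel {0<..} (\<lambda>t. \<psi> t * fden m k t)"
    using int integrable_ratio_law_iff[OF N n, of \<psi>] by (simp add: m_def k_def)
  have i1: "set_integrable lborel {0<..} (\<lambda>t. \<psi> t * fden (m + 1) k t)"
    by (rule set_integrable_fden_Suc(1)[OF _ i0]) simp
  have N2: "0 < N + 2" by simp
  show "integrable (ratio_law (N + 2) n) \<psi>"
    using i1 integrable_ratio_law_iff[OF N2 n, of \<psi>, unfolded e k_def[symmetric]] by simp
  define I1 I2 where "I1 = (LINT w:{0<..}|lborel. g w * fden m (k + 1) w)"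
    and "I2 = (LINT w:{0<..}|lborel. g w * fden (m + 1) (k + 1) w)"
  define J1 J2 where "J1 = (LINT w:{0<..}|lborel. fden m (k + 1) w)"
    and "J2 = (LINT w:{0<..}|lborel. fden (m + 1) (k + 1) w)"
  note T0 = set_integral_g_transform[OF mk _ i0, folded g_def]
  have m1: "0 < m + 1" using mk by simp
  note T1 = set_integral_g_transform[OF m1 mk(2) _ i1, folded g_def]
  have n2: "0 < n + 2" by simp
  have j1: "set_integrable lborel {0<..} (fden m (k + 1))" "ratio_const N (n + 2) * J1 = 1"
    using set_integrable_fden[OF N n2, unfolded e m_def[symmetric]] by (simp_all add: J1_def)
  have j2: "set_integrable lborel {0<..} (fden (m + 1) (k + 1))" "ratio_const (N + 2) (n + 2) * J2 = 1"
    using set_integrable_fden[OF N2 n2, unfolded e] by (simp_all add: J2_def)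
  \<comment> \<open>The weight has total mass 0: a comparison of the normalising constants for N and
    N + 2 degrees of freedom.\<close>
  have J: "m * J1 = (m + 1 + k) * J2"
  proof -
    have "ratio_const (N + 2) (n + 2) = ratio_const N (n + 2) * ((m + 1 + k) / m)"
      unfolding ratio_const_Suc_Suc[OF N n2] using N by (simp add: m_def k_def field_simps)
    then have "ratio_const N (n + 2) * ((m + 1 + k) * J2) = m * (ratio_const (N + 2) (n + 2) * J2)"
      using mk by simp
    also have "\<dots> = ratio_const N (n + 2) * (m * J1)"
      unfolding j2(2) using j1(2) by simp
    finally have "ratio_const N (n + 2) * ((m + 1 + k) * J2) = ratio_const N (n + 2) * (m * J1)" .
    then show ?thesis using ratio_const_pos[OF N n2] by simp
  qed
  \<comment> \<open>The value of \<open>g\<close> at the sign change of m - (k + 1) w; subtracting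
    it changes nothing by \<open>J\<close> and makes the integrand pointwise nonnegative.\<close>
  define c where "c = g (m / (k + 1))"
  have "0 \<le> (LINT w:{0<..}|lborel. (m * (g w * fden m (k + 1) w) - (m + 1 + k) * (g w * fden (m + 1) (k + 1) w))
      - (m * c * fden m (k + 1) w - (m + 1 + k) * c * fden (m + 1) (k + 1) w))"
    unfolding set_lebesgue_integral_def
  proof (rule integral_nonneg_AE, rule AE_I2)
    fix w :: real
    have "0 \<le> (m * (g w * fden m (k + 1) w) - (m + 1 + k) * (g w * fden (m + 1) (k + 1) w))
      - (m * c * fden m (k + 1) w - (m + 1 + k) * c * fden (m + 1) (k + 1) w)" if w: "0 < w"
    proof -
      have "(m * (g w * fden m (k + 1) w) - (m + 1 + k) * (g w * fden (m + 1) (k + 1) w))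
        - (m * c * fden m (k + 1) w - (m + 1 + k) * c * fden (m + 1) (k + 1) w)
        = fden m (k + 1) w * ((g w - c) * (m - (m + 1 + k) * (w / (1 + w))))"
        unfolding fden_Suc_left[OF w] by (simp only: right_diff_distrib left_diff_distrib mult_ac)
      also have "m - (m + 1 + k) * (w / (1 + w)) = (m - (k + 1) * w) / (1 + w)"
        using w by (simp add: field_simps)
      also have "0 \<le> fden m (k + 1) w * ((g w - c) * ((m - (k + 1) * w) / (1 + w)))"
      proof (cases "w \<le> m / (k + 1)")
        case True
        then have "c \<le> g w" "0 \<le> m - (k + 1) * w"
          unfolding c_def using w mk by (auto intro: anti simp: field_simps)
        then show ?thesis using w by simp
      next
        case False
        then have "g w \<le> c" "m - (k + 1) * w \<le> 0"
          unfolding c_def using w mk by (auto intro!: anti simp: field_simps)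
        then have "0 \<le> (g w - c) * (m - (k + 1) * w)" by (intro mult_nonpos_nonpos) auto
        then have "0 \<le> fden m (k + 1) w * ((g w - c) * (m - (k + 1) * w) / (1 + w))" using w by simp
        then show ?thesis by simp
      qed
      finally show ?thesis .
    qed
    then show "0 \<le> indicator {0<..} w *\<^sub>R ((m * (g w * fden m (k + 1) w) - (m + 1 + k) * (g w * fden (m + 1) (k + 1) w))
      - (m * c * fden m (k + 1) w - (m + 1 + k) * c * fden (m + 1) (k + 1) w))"
      by (cases "0 < w") (auto simp: indicator_def)
  qed
  also have "\<dots> = (m * I1 - (m + 1 + k) * I2) - (m * c * J1 - (m + 1 + k) * c * J2)"
    unfolding I1_def I2_def J1_def J2_def
    using T0(1) T1(1) j1(1) j2(1) by (subst set_integral_diff set_integral_mult_right set_integrable_mult_right | simp)+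
  also have "m * c * J1 - (m + 1 + k) * c * J2 = 0"
    using J by (metis (no_types, opaque_lifting) cancel_comm_monoid_add_class.diff_cancel mult.assoc mult.commute)
  finally have main: "(m + 1 + k) * I2 \<le> m * I1" by simp
  have c0: "0 < ratio_const N n" by (rule ratio_const_pos[OF N n])
  have "integral\<^sup>L (ratio_law (N + 2) n) \<psi> = ratio_const (N + 2) n * ((m + 1 + k) * I2)"
    using integral_ratio_law[OF N2 n, of \<psi>, unfolded e k_def[symmetric]] T1(2) by (simp add: I2_def)
  also have "\<dots> = ratio_const N n * ((m + k) / m) * ((m + 1 + k) * I2)"
    unfolding ratio_const_Suc_Suc[OF N n] using N by (simp add: m_def k_def field_simps)
  also have "\<dots> \<le> ratio_const N n * ((m + k) / m) * (m * I1)"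
    using main c0 mk by (intro mult_left_mono) auto
  also have "\<dots> = ratio_const N n * ((m + k) * I1)" using mk by simp
  also have "\<dots> = integral\<^sup>L (ratio_law N n) \<psi>"
    using integral_ratio_law[OF N n, of \<psi>] T0(2) by (simp add: m_def[symmetric] k_def[symmetric] I1_def)
  finally show "integral\<^sup>L (ratio_law (N + 2) n) \<psi> \<le> integral\<^sup>L (ratio_law N n) \<psi>" .
qed

text \<open>Up to constants the density shrinks by (w/(1+w))^c with c >= 0. No parity condition on
  N' - N is imposed, since the exponential series raises the degrees of freedom one at a
  time.\<close>

lemma ratio_law_integrable_mono:
  fixes F :: "real \<Rightarrow> real"
  assumes "0 < N" "N \<le> N'" "0 < n" and [measurable]: "F \<in> borel_measurable borel"
    and int: "integrable (ratio_law N n) F"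
  shows "integrable (ratio_law N' n) F"
proof -
  have N': "0 < N'" using assms by simp
  define m m' k c where "m = real N / 2" and "m' = real N' / 2" and "k = real n / 2" and "c = m' - m"
  have c: "0 \<le> c" using assms(2) by (simp add: c_def m_def m'_def)
  have i: "set_integrable lborel {0<..} (\<lambda>w. F w * fden m k w)"
    using int integrable_ratio_law_iff[OF assms(1,3), of F] by (simp add: m_def k_def)
  have le: "fden m' k w \<le> fden m k w" if w: "0 < w" for w
  proof -
    have "w powr (m' - 1) = w powr (m - 1) * w powr c"
      by (simp add: c_def powr_add[symmetric])
    moreover have "- (m' + k) = - (m + k) + - c" by (simp add: c_def)
    then have "(1 + w) powr (- (m' + k)) = (1 + w) powr (- (m + k)) * (1 + w) powr (- c)"
      by (simp only: powr_add)
    ultimately have "fden m' k w = fden m k w * (w powr c * (1 + w) powr (- c))"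
      by (simp only: fden_def mult_ac)
    also have "w powr c * (1 + w) powr (- c) = (w / (1 + w)) powr c"
      using w by (simp add: powr_divide powr_minus_divide)
    also have "fden m k w * (w / (1 + w)) powr c \<le> fden m k w * 1"
      using w c by (intro mult_left_mono powr_le1) auto
    finally show ?thesis by simp
  qed
  have "set_integrable lborel {0<..} (\<lambda>w. F w * fden m' k w)"
  proof (rule set_integrable_bound[OF i])
    show "set_borel_measurable lborel {0<..} (\<lambda>w. F w * fden m' k w)"
      unfolding set_borel_measurable_def by simp
    show "AE w in lborel. w \<in> {0<..} \<longrightarrow> norm (F w * fden m' k w) \<le> norm (F w * fden m k w)"
      using le by (intro AE_I2) (auto simp: abs_mult intro!: mult_left_mono)
  qed
  then show ?thesis
    using integrable_ratio_law_iff[OF N' assms(3), of F] by (simp add: m'_def k_def)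
qed

section \<open>The lower bound for the beta terms\<close>

lemma locally_abs_continuous_imp_continuous_on:
  assumes "locally_abs_continuous \<phi>"
  shows "continuous_on {0<..} \<phi>"
proof (rule continuous_at_imp_continuous_on, rule ballI)
  fix w :: real assume "w \<in> {0<..}"
  then have w: "0 < w" by simp
  have "continuous_on {w/2..2*w} \<phi>"
    using assms w by (intro abs_continuous_on_imp_continuous_on) (simp add: locally_abs_continuous_def)
  then have "continuous_on {w/2<..<2*w} \<phi>" by (rule continuous_on_subset) auto
  then show "isCont \<phi> w"
    using w by (simp add: continuous_on_eq_continuous_at)
qed

lemma borel_measurable_positive_part:
  fixes f :: "real \<Rightarrow> real"
  assumes "continuous_on {0<..} f"
  shows "(\<lambda>w. if 0 < w then f w else 0) \<in> borel_measurable borel"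
proof -
  have "(\<lambda>w. if 0 < w then f w else 0) = (\<lambda>w. indicator {0<..} w *\<^sub>R f w)"
    by (auto simp: fun_eq_iff indicator_def)
  then show ?thesis
    using borel_measurable_continuous_on_indicator[OF _ assms] by simp
qed

text \<open>The limit of difference quotients along 1/(i+1) is Borel whether or not it exists as a
  derivative, and it is the derivative where there is one. Under integrals it can stand in for
  \<open>deriv \<phi>\<close>.\<close>

lemma measurable_derivative_ae:
  assumes "continuous_on {0<..} \<phi>"
  obtains D where "D \<in> borel_measurable borel"
    "\<And>w. 0 < w \<Longrightarrow> \<phi> differentiable (at w) \<Longrightarrow> D w = deriv \<phi> (w :: real)"
proof -
  define f where "f w = (if 0 < w then \<phi> w else 0)" for w
  have [measurable]: "f \<in> borel_measurable borel"
    unfolding f_def using borel_measurable_positive_part[OF assms] .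
  define D where "D w = lim (\<lambda>i. (f (w + 1 / real (Suc i)) - f w) / (1 / real (Suc i)))" for w
  have m: "D \<in> borel_measurable borel"
    unfolding D_def by measurable
  have "D w = deriv \<phi> w" if w: "0 < w" "\<phi> differentiable (at w)" for w
  proof -
    have "(\<phi> has_real_derivative deriv \<phi> w) (at w)"
      using w by (simp add: DERIV_deriv_iff_real_differentiable)
    then have "((\<lambda>h. (\<phi> (w + h) - \<phi> w) / h) \<longlongrightarrow> deriv \<phi> w) (at 0)"
      by (simp add: DERIV_def)
    moreover have "filterlim (\<lambda>i. 1 / real (Suc i)) (at 0) sequentially"
      using LIMSEQ_inverse_real_of_nat by (auto simp: filterlim_at inverse_eq_divide)
    ultimately have "(\<lambda>i. (\<phi> (w + 1 / real (Suc i)) - \<phi> w) / (1 / real (Suc i))) \<longlonglongrightarrow> deriv \<phi> w"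
      by (rule filterlim_compose)
    moreover have "(\<phi> (w + 1 / real (Suc i)) - \<phi> w) / (1 / real (Suc i)) = (f (w + 1 / real (Suc i)) - f w) / (1 / real (Suc i))" for i
    proof -
      have "0 < w + 1 / real (Suc i)" using w by (intro add_pos_pos) auto
      then show ?thesis using w by (simp add: f_def)
    qed
    ultimately show ?thesis unfolding D_def by (simp add: limI)
  qed
  with m that show thesis by blast
qed

text \<open>After clearing denominators the two integrands differ by the derivative of
  \<open>(4 \<phi> + 2 \<phi>\<^sup>2) f\<close>, where \<open>f\<close> is proportional to the density of \<open>W\<close>.\<close>
lemma beta2_integral_lower_bound:
  assumes N: "3 \<le> N" and n: "0 < n"
    and lac: "locally_abs_continuous \<phi>"
    and diff: "AE w in lborel. 0 < w \<longrightarrow> \<phi> differentiable (at w)"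
  defines "\<psi> \<equiv> \<lambda>w. if 0 < w then \<phi> w / w else 0"
    and "F \<equiv> \<lambda>w. 2 * \<phi> w / w - b_fun n \<phi> w / real N"
  assumes int1: "integrable (ratio_law (N + 2) n) (\<lambda>w. (\<psi> w)\<^sup>2)"
    and int2: "integrable (chi_square N \<Otimes>\<^sub>M chi_square n) (\<lambda>(u, v). F (u / v))"
  shows "integral\<^sup>L (ratio_law (N + 2) n) (\<lambda>w. 2 * \<psi> w - (\<psi> w)\<^sup>2)
    \<le> integral\<^sup>L (chi_square N \<Otimes>\<^sub>M chi_square n) (\<lambda>(u, v). F (u / v))"
proof -
  have N0: "0 < N" and N2: "0 < N + 2" using N by auto
  define m k where "m = real N / 2" and "k = real n / 2"
  have mk: "1 < m" "0 < k" using N n by (auto simp: m_def k_def)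
  have e: "real (N + 2) / 2 = m + 1" by (simp add: m_def)
  have cont: "continuous_on {0<..} \<phi>" by (rule locally_abs_continuous_imp_continuous_on[OF lac])
  define f where "f w = (if 0 < w then \<phi> w else 0)" for w
  have [measurable]: "f \<in> borel_measurable borel"
    unfolding f_def using borel_measurable_positive_part[OF cont] .
  have \<psi>f: "\<psi> = (\<lambda>w. f w / w)" by (auto simp: \<psi>_def f_def fun_eq_iff)
  have [measurable]: "\<psi> \<in> borel_measurable borel" unfolding \<psi>f by measurable
  obtain D where [measurable]: "D \<in> borel_measurable borel"
    and D: "\<And>w. 0 < w \<Longrightarrow> \<phi> differentiable (at w) \<Longrightarrow> D w = deriv \<phi> w"
    using measurable_derivative_ae[OF cont] by blast
  have diffD: "AE w in lborel. 0 < w \<longrightarrow> (\<phi> has_real_derivative D w) (at w)"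
    using diff by eventually_elim (simp add: D DERIV_deriv_iff_real_differentiable)
  \<comment> \<open>\<open>F\<close> with its ingredients replaced by functions Borel on the whole
    line, so that the integral can be moved to \<open>ratio_law\<close>; the two agree almost
    everywhere on the half-line.\<close>
  define F' where "F' w = 2 * f w / w - (4 * f w / w + (real n + 2) * (f w)\<^sup>2 / w - 4 * D w - 4 * f w * D w) / real N" for w
  have [measurable]: "F' \<in> borel_measurable borel" unfolding F'_def by measurable
  have "AE w in lborel. 0 < w \<longrightarrow> F w = F' w"
    using diff by eventually_elim (simp add: F_def F'_def b_fun_def D f_def)
  then have "AE w in ratio_law N n. F w = F' w"
    unfolding ratio_law_eq[OF N0 n] by (subst AE_density) (auto elim!: eventually_mono simp: indicator_def split: if_splits)
  then have ae: "AE z in chi_square N \<Otimes>\<^sub>M chi_square n. F (fst z / snd z) = F' (fst z / snd z)"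
    unfolding ratio_law_def using AE_distrD[OF measurable_chi_square_pair_ratio] by (force simp: case_prod_unfold)
  have Fm: "(\<lambda>z. F (fst z / snd z)) \<in> borel_measurable (chi_square N \<Otimes>\<^sub>M chi_square n)"
    using borel_measurable_integrable[OF int2] by (simp add: case_prod_unfold)
  have F'm: "(\<lambda>z. F' (fst z / snd z)) \<in> borel_measurable (chi_square N \<Otimes>\<^sub>M chi_square n)"
    by measurable
  have FF': "integral\<^sup>L (chi_square N \<Otimes>\<^sub>M chi_square n) (\<lambda>(u, v). F (u / v)) = integral\<^sup>L (ratio_law N n) F'"
    unfolding ratio_law_def using integral_cong_AE[OF Fm F'm ae]
    by (subst integral_distr) (simp_all add: case_prod_unfold)
  have "integrable (ratio_law N n) F'"
    unfolding ratio_law_def using integrable_cong_AE[OF Fm F'm ae] int2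
    by (subst integrable_distr_eq) (simp_all add: case_prod_unfold)
  then have i1: "set_integrable lborel {0<..} (\<lambda>w. F' w * fden m k w)"
    using integrable_ratio_law_iff[OF N0 n, of F'] by (simp add: m_def k_def)
  interpret P2: prob_space "ratio_law (N + 2) n" by (rule prob_space_ratio_law[OF N2 n])
  have \<psi>_int: "integrable (ratio_law (N + 2) n) \<psi>"
    by (rule P2.square_integrable_imp_integrable[OF _ int1]) (simp add: measurable_cong_sets[OF sets_ratio_law refl])
  define q where "q w = 2 * \<psi> w - (\<psi> w)\<^sup>2" for w
  have [measurable]: "q \<in> borel_measurable borel" unfolding q_def by measurable
  have "integrable (ratio_law (N + 2) n) q" unfolding q_def using \<psi>_int int1 by simp
  then have i2: "set_integrable lborel {0<..} (\<lambda>w. q w * fden (m + 1) k w)"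
    using integrable_ratio_law_iff[OF N2 n, of q, unfolded e k_def[symmetric]] by simp
  define H where "H w = (4 * D w + 4 * \<phi> w * D w) * fden m k w
     + (4 * \<phi> w + 2 * (\<phi> w)\<^sup>2) * (fden m k w * ((m - 1) / w - (m + k) / (1 + w)))" for w
  \<comment> \<open>By 1/(w (1 + w)) = 1/w - 1/(1 + w), the terms in 1/(1 + w) all come from
    \<open>q\<close>. Those in 1/w match because the coefficient n + 2 = 2k + 2 of
    \<open>\<phi>\<^sup>2 / w\<close> in \<open>b_fun\<close> leaves 2 (m + k) - (2k + 2) = 2 (m -
    1).\<close>
  have H: "H w = 2 * m * (F' w * fden m k w) - 2 * (m + k) * (q w * fden (m + 1) k w)" if w: "0 < w" for w
  proof -
    have nz: "w \<noteq> 0" "1 + w \<noteq> 0" "m \<noteq> 0" using w mk by auto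
    have F'w: "2 * m * F' w = 4 * m * \<phi> w / w - (4 * \<phi> w / w + (2 * k + 2) * (\<phi> w)\<^sup>2 / w - 4 * D w - 4 * \<phi> w * D w)"
      using w N by (simp add: F'_def f_def m_def k_def field_simps)
    have qw: "q w = 2 * \<phi> w / w - (\<phi> w)\<^sup>2 / w\<^sup>2"
      using w by (simp add: q_def \<psi>_def power_divide)
    have *: "(4 * D w + 4 * \<phi> w * D w) + (4 * \<phi> w + 2 * (\<phi> w)\<^sup>2) * ((m - 1) / w - (m + k) / (1 + w))
      = 2 * m * F' w - 2 * (m + k) * (q w * (w / (1 + w)))"
      unfolding F'w qw using nz by (simp add: divide_simps power2_eq_square) (simp add: algebra_simps)
    have gen1: "A * y + Q * (y * d) = (A + Q * d) * y" and gen2: "(2 * m * A - d * (Q * x)) * y = 2 * m * (A * y) - d * (Q * (y * x))"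
      for A Q d x y :: real
      by (simp_all add: algebra_simps)
    have "H w = ((4 * D w + 4 * \<phi> w * D w) + (4 * \<phi> w + 2 * (\<phi> w)\<^sup>2) * ((m - 1) / w - (m + k) / (1 + w))) * fden m k w"
      unfolding H_def by (rule gen1)
    also have "\<dots> = (2 * m * F' w - 2 * (m + k) * (q w * (w / (1 + w)))) * fden m k w"
      by (simp only: *)
    also have "\<dots> = 2 * m * (F' w * fden m k w) - 2 * (m + k) * (q w * fden (m + 1) k w)"
      unfolding fden_Suc_left[OF w] by (rule gen2)
    finally show ?thesis .
  qed
  have iH: "set_integrable lborel {0<..} H"
  proof -
    have "set_integrable lborel {0<..} (\<lambda>w. 2 * m * (F' w * fden m k w) - 2 * (m + k) * (q w * fden (m + 1) k w))"
      using i1 i2 by (intro set_integral_diff set_integrable_mult_right) auto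
    then show ?thesis by (subst set_integrable_cong[OF refl refl H]) auto
  qed
  have "set_integrable lborel {0<..} (\<lambda>w. (\<psi> w)\<^sup>2 * fden (m + 1) k w)"
    using int1 integrable_ratio_law_iff[OF N2 n, of "\<lambda>w. (\<psi> w)\<^sup>2", unfolded e k_def[symmetric]] by simp
  \<comment> \<open>The factor 2 bounds 1 + w on (0, 1], which is lost in passing from the density
    with m + 1 to the one with m.\<close>
  then have i3: "set_integrable lborel {0<..1} (\<lambda>w. 2 * ((\<psi> w)\<^sup>2 * fden (m + 1) k w))"
    by (intro set_integrable_mult_right) (rule set_integrable_subset, auto)
  have i4: "set_integrable lborel {0<..1} (\<lambda>w. (\<phi> w)\<^sup>2 / w * fden m k w)"
  proof (rule set_integrable_bound[OF i3])
    have "(\<lambda>w. indicator {0<..1} w *\<^sub>R ((\<phi> w)\<^sup>2 / w * fden m k w)) = (\<lambda>w. indicator {0<..1} w *\<^sub>R ((f w)\<^sup>2 / w * fden m k w))"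
      by (auto simp: fun_eq_iff f_def indicator_def)
    then show "set_borel_measurable lborel {0<..1} (\<lambda>w. (\<phi> w)\<^sup>2 / w * fden m k w)"
      unfolding set_borel_measurable_def by simp
    show "AE w in lborel. w \<in> {0<..1} \<longrightarrow> norm ((\<phi> w)\<^sup>2 / w * fden m k w) \<le> norm (2 * ((\<psi> w)\<^sup>2 * fden (m + 1) k w))"
    proof (rule AE_I2, rule impI)
      fix w :: real assume "w \<in> {0<..1}"
      then have w: "0 < w" "w \<le> 1" by auto
      have "(\<phi> w)\<^sup>2 / w * fden m k w = (1 + w) * ((\<psi> w)\<^sup>2 * fden (m + 1) k w)"
        unfolding fden_Suc_left[OF w(1)] using w by (simp add: \<psi>_def power_divide power2_eq_square)
      also have "\<dots> \<le> 2 * ((\<psi> w)\<^sup>2 * fden (m + 1) k w)"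
        using w by (intro mult_right_mono) auto
      finally show "norm ((\<phi> w)\<^sup>2 / w * fden m k w) \<le> norm (2 * ((\<psi> w)\<^sup>2 * fden (m + 1) k w))"
        using w by simp
    qed
  qed
  have "0 \<le> (LINT w:{0<..}|lborel. H w)"
    unfolding H_def
    by (rule integral_derivative_quadratic_nonneg[OF lac diffD mk iH[unfolded H_def] i4])
  also have "\<dots> = (LINT w:{0<..}|lborel. 2 * m * (F' w * fden m k w) - 2 * (m + k) * (q w * fden (m + 1) k w))"
    by (rule set_lebesgue_integral_cong) (auto simp: H)
  also have "\<dots> = 2 * m * (LINT w:{0<..}|lborel. F' w * fden m k w) - 2 * (m + k) * (LINT w:{0<..}|lborel. q w * fden (m + 1) k w)"
    using i1 i2 by (subst set_integral_diff) (auto intro!: set_integrable_mult_right)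
  finally have main: "(m + k) * (LINT w:{0<..}|lborel. q w * fden (m + 1) k w) \<le> m * (LINT w:{0<..}|lborel. F' w * fden m k w)"
    unfolding mult.assoc by linarith
  have c0: "0 < ratio_const N n" by (rule ratio_const_pos[OF N0 n])
  have "integral\<^sup>L (ratio_law (N + 2) n) q = ratio_const (N + 2) n * (LINT w:{0<..}|lborel. q w * fden (m + 1) k w)"
    using integral_ratio_law[OF N2 n, of q, unfolded e k_def[symmetric]] by simp
  also have "\<dots> = ratio_const N n / m * ((m + k) * (LINT w:{0<..}|lborel. q w * fden (m + 1) k w))"
    unfolding ratio_const_Suc_Suc[OF N0 n] using N0 by (simp add: m_def k_def field_simps)
  also have "\<dots> \<le> ratio_const N n / m * (m * (LINT w:{0<..}|lborel. F' w * fden m k w))"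
    using main c0 mk by (intro mult_left_mono) auto
  also have "\<dots> = integral\<^sup>L (ratio_law N n) F'"
    using mk by (subst integral_ratio_law[OF N0 n]) (auto simp: m_def k_def)
  finally show ?thesis unfolding FF' q_def[abs_def] .
qed

section \<open>The standard normal distribution\<close>

lemma prod_normal_density:
  fixes \<theta> x :: "real ^ 'p::finite"
  assumes "0 < \<sigma>"
  shows "(\<Prod>i\<in>UNIV. normal_density (\<theta> $ i) \<sigma> (x $ i))
    = (1 / sqrt (2 * pi * \<sigma>\<^sup>2)) ^ CARD('p) * exp (- (norm (x - \<theta>))\<^sup>2 / (2 * \<sigma>\<^sup>2))"
proof -
  have "(norm (x - \<theta>))\<^sup>2 = (\<Sum>i\<in>UNIV. (x $ i - \<theta> $ i)\<^sup>2)"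
    unfolding power2_norm_eq_inner by (simp add: inner_vec_def power2_eq_square)
  then have "exp (- (norm (x - \<theta>))\<^sup>2 / (2 * \<sigma>\<^sup>2)) = (\<Prod>i\<in>UNIV. exp (- (x $ i - \<theta> $ i)\<^sup>2 / (2 * \<sigma>\<^sup>2)))"
    by (simp add: exp_sum[symmetric] sum_negf sum_divide_distrib)
  then show ?thesis
    by (simp add: normal_density_def prod.distrib prod_dividef power_divide del: real_sqrt_mult)
qed

definition gauss_density :: "real ^ 'p::finite \<Rightarrow> real" where
  "gauss_density x = (1 / sqrt (2 * pi)) ^ CARD('p) * exp (- (norm x)\<^sup>2 / 2)"

lemma gauss_density_nonneg [simp]: "0 \<le> gauss_density x"
  by (simp add: gauss_density_def)

lemma borel_measurable_gauss_density [measurable]: "gauss_density \<in> borel_measurable borel"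
  unfolding gauss_density_def[abs_def] by measurable

lemma multi_normal_standard: "multi_normal (0 :: real ^ 'p::finite) 1 = density lborel (\<lambda>x. ennreal (gauss_density x))"
  unfolding multi_normal_def using prod_normal_density[of 1 "0 :: real ^ 'p"]
  by (simp add: gauss_density_def)

lemma sets_multi_normal [simp, measurable_cong]: "sets (multi_normal \<theta> v) = sets borel"
  and space_multi_normal [simp]: "space (multi_normal \<theta> v) = UNIV"
  by (simp_all add: multi_normal_def)

lemma prob_space_multi_normal_standard: "prob_space (multi_normal (0 :: real ^ 'p::finite) 1)"
proof
  have inj: "inj (\<lambda>i. axis i 1 :: real ^ 'p)" by (auto simp: inj_def axis_eq_axis)
  have B: "(Basis :: (real ^ 'p) set) = range (\<lambda>i. axis i 1)" by (auto simp: Basis_vec_def)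
  have "emeasure (multi_normal (0 :: real ^ 'p) 1) (space (multi_normal 0 1))
      = (\<integral>\<^sup>+x. ennreal (\<Prod>i\<in>UNIV. normal_density 0 1 (x $ i)) \<partial>(lborel :: (real ^ 'p) measure))"
    by (simp add: multi_normal_def emeasure_density)
  also have "\<dots> = (\<integral>\<^sup>+x. (\<Prod>b\<in>Basis. ennreal (normal_density 0 1 (x \<bullet> b))) \<partial>(lborel :: (real ^ 'p) measure))"
    by (simp add: B prod.reindex[OF inj] inner_axis prod_ennreal[symmetric])
  also have "\<dots> = (\<Prod>b\<in>(Basis :: (real ^ 'p) set). (\<integral>\<^sup>+x. ennreal (normal_density 0 1 x) \<partial>lborel))"
    by (rule nn_integral_lborel_prod) auto
  also have "(\<integral>\<^sup>+x. ennreal (normal_density 0 1 x) \<partial>lborel) = 1"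
    by (subst nn_integral_eq_integral) auto
  finally show "emeasure (multi_normal (0 :: real ^ 'p) 1) (space (multi_normal 0 1)) = 1" by simp
qed

lemma nn_integral_multi_normal_standard:
  assumes [measurable]: "f \<in> borel_measurable borel"
  shows "(\<integral>\<^sup>+x. f x \<partial>multi_normal 0 1) = (\<integral>\<^sup>+x. ennreal (gauss_density x) * f x \<partial>lborel)"
  unfolding multi_normal_standard by (subst nn_integral_density) auto

lemma nn_integral_lborel_affine:
  fixes t :: "'a::euclidean_space"
  assumes [measurable]: "f \<in> borel_measurable borel" and c: "0 < c"
  shows "(\<integral>\<^sup>+x. f x \<partial>lborel) = ennreal (c ^ DIM('a)) * (\<integral>\<^sup>+x. f (t + c *\<^sub>R x) \<partial>lborel)"
  using c by (subst lborel_affine[of c t])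
     (auto simp: nn_integral_density nn_integral_distr nn_integral_cmult)

lemma multi_normal_eq_distr:
  fixes \<theta> :: "real ^ 'p::finite"
  assumes s: "0 < \<sigma>"
  shows "multi_normal \<theta> (\<sigma>\<^sup>2) = distr (multi_normal 0 1) borel (\<lambda>x. \<theta> + \<sigma> *\<^sub>R x)"
proof (rule measure_eqI)
  fix A assume "A \<in> sets (multi_normal \<theta> (\<sigma>\<^sup>2))"
  then have [measurable]: "A \<in> sets borel" by simp
  define d where "d x = (1 / sqrt (2 * pi * \<sigma>\<^sup>2)) ^ CARD('p) * exp (- (norm (x - \<theta>))\<^sup>2 / (2 * \<sigma>\<^sup>2))" for x
  have [measurable]: "d \<in> borel_measurable borel" unfolding d_def by measurable
  have dg: "\<sigma> ^ CARD('p) * d (\<theta> + \<sigma> *\<^sub>R x) = gauss_density x" for x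
  proof -
    have "sqrt (2 * pi * \<sigma>\<^sup>2) = sqrt (2 * pi) * \<sigma>" using s by (simp add: real_sqrt_mult)
    then have "\<sigma> * (1 / sqrt (2 * pi * \<sigma>\<^sup>2)) = 1 / sqrt (2 * pi)" using s by simp
    then have "\<sigma> ^ CARD('p) * (1 / sqrt (2 * pi * \<sigma>\<^sup>2)) ^ CARD('p) = (1 / sqrt (2 * pi)) ^ CARD('p)"
      by (metis power_mult_distrib)
    then show ?thesis
      using s by (simp add: d_def gauss_density_def power_mult_distrib mult.assoc[symmetric] del: real_sqrt_mult)
  qed
  have "emeasure (multi_normal \<theta> (\<sigma>\<^sup>2)) A = (\<integral>\<^sup>+x. ennreal (d x) * indicator A x \<partial>lborel)"
    unfolding multi_normal_def using s by (subst emeasure_density) (auto simp: prod_normal_density d_def)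
  also have "\<dots> = ennreal (\<sigma> ^ CARD('p)) * (\<integral>\<^sup>+x. ennreal (d (\<theta> + \<sigma> *\<^sub>R x)) * indicator A (\<theta> + \<sigma> *\<^sub>R x) \<partial>lborel)"
    by (subst nn_integral_lborel_affine[OF _ s, of _ \<theta>]) auto
  also have "\<dots> = (\<integral>\<^sup>+x. ennreal (gauss_density x) * indicator A (\<theta> + \<sigma> *\<^sub>R x) \<partial>lborel)"
    using s by (subst nn_integral_cmult[symmetric])
      (auto simp: dg[symmetric] ennreal_mult mult.assoc d_def)
  also have "\<dots> = (\<integral>\<^sup>+x. indicator A (\<theta> + \<sigma> *\<^sub>R x) \<partial>multi_normal 0 1)"
    by (subst nn_integral_multi_normal_standard) auto
  also have "\<dots> = emeasure (distr (multi_normal 0 1) borel (\<lambda>x. \<theta> + \<sigma> *\<^sub>R x)) A"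
    by (subst nn_integral_distr[symmetric, of "\<lambda>x. \<theta> + \<sigma> *\<^sub>R x" "multi_normal 0 1" borel "indicator A"]) auto
  finally show "emeasure (multi_normal \<theta> (\<sigma>\<^sup>2)) A = emeasure (distr (multi_normal 0 1) borel (\<lambda>x. \<theta> + \<sigma> *\<^sub>R x)) A" .
qed simp

lemma prob_space_multi_normal:
  fixes \<theta> :: "real ^ 'p::finite"
  assumes "0 < v"
  shows "prob_space (multi_normal \<theta> v)"
proof -
  interpret prob_space "multi_normal (0 :: real ^ 'p) 1" by (rule prob_space_multi_normal_standard)
  have "v = (sqrt v)\<^sup>2" using assms by simp
  moreover have "prob_space (distr (multi_normal 0 1) borel (\<lambda>x. \<theta> + sqrt v *\<^sub>R x))"
    by (rule prob_space_distr) measurable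
  ultimately show ?thesis
    using multi_normal_eq_distr[of "sqrt v" \<theta>] assms by simp
qed

text \<open>Completing the square moves the mean into an exponential factor; its power series in x .
  \<tau> is what the mixture representation expands.\<close>

lemma multi_normal_tilt:
  fixes \<tau> :: "real ^ 'p::finite"
  shows "multi_normal \<tau> 1 = density (multi_normal 0 1) (\<lambda>x. ennreal (exp (x \<bullet> \<tau> - (norm \<tau>)\<^sup>2 / 2)))"
proof -
  have e: "gauss_density x * exp (x \<bullet> \<tau> - (norm \<tau>)\<^sup>2 / 2) = (\<Prod>i\<in>UNIV. normal_density (\<tau> $ i) (sqrt 1) (x $ i))" for x
  proof -
    have "- (norm x)\<^sup>2 / 2 + (x \<bullet> \<tau> - (norm \<tau>)\<^sup>2 / 2) = - (norm (x - \<tau>))\<^sup>2 / 2"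
      by (simp add: power2_norm_eq_inner inner_diff_left inner_diff_right inner_commute field_simps)
    then show ?thesis
      using prod_normal_density[of 1 \<tau> x] by (simp add: gauss_density_def exp_add[symmetric])
  qed
  show ?thesis
    unfolding multi_normal_standard multi_normal_def[of \<tau>]
    by (subst density_density_eq) (auto simp: ennreal_mult[symmetric] e)
qed

text \<open>Push-forward of \<open>q(x) dx\<close> under \<open>|x|\<^sup>2\<close>: homogeneity determines it up to a constant.\<close>
lemma radial_homogeneous_distr:
  fixes q :: "'a::euclidean_space \<Rightarrow> real"
  assumes [measurable]: "q \<in> borel_measurable borel" and q0: "\<And>x. 0 \<le> q x"
    and hom: "\<And>c x. 0 < c \<Longrightarrow> q (c *\<^sub>R x) = c ^ d * q x"
    and T: "(\<integral>\<^sup>+x. ennreal (q x) * indicator {..1} ((norm x)\<^sup>2) \<partial>lborel) = ennreal T" "0 \<le> T"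
  defines "a \<equiv> (real DIM('a) + real d) / 2"
  shows "distr (density lborel (\<lambda>x. ennreal (q x))) borel (\<lambda>x. (norm x)\<^sup>2)
    = density lborel (\<lambda>t. ennreal (indicator {0<..} t * (a * T * t powr (a - 1))))" (is "?\<mu> = ?\<nu>")
proof -
  have a: "0 < a" by (simp add: a_def add_pos_nonneg)
  have mu: "emeasure ?\<mu> {..r} = (\<integral>\<^sup>+x. ennreal (q x) * indicator {..r} ((norm x)\<^sup>2) \<partial>lborel)" for r
  proof -
    have "emeasure ?\<mu> {..r} = (\<integral>\<^sup>+t. indicator {..r} t \<partial>?\<mu>)" by simp
    also have "\<dots> = (\<integral>\<^sup>+x. indicator {..r} ((norm x)\<^sup>2) \<partial>density lborel (\<lambda>x. ennreal (q x)))"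
      by (rule nn_integral_distr) auto
    also have "\<dots> = (\<integral>\<^sup>+x. ennreal (q x) * indicator {..r} ((norm x)\<^sup>2) \<partial>lborel)"
      by (rule nn_integral_density) auto
    finally show ?thesis .
  qed
  \<comment> \<open>Rescaling by the square root of r contributes r^(DIM/2) from Lebesgue measure
    and r^(d/2) from homogeneity, hence the exponent \<open>a\<close>. Half-lines determine the
    measure.\<close>
  have eq: "emeasure ?\<mu> {..r} = (if 0 < r then ennreal (T * r powr a) else 0)" for r
  proof (cases "0 < r")
    case True
    define c where "c = sqrt r"
    have c: "0 < c" "c\<^sup>2 = r" using True by (auto simp: c_def)
    have pw: "c ^ (DIM('a) + d) = r powr a"
      using True by (simp add: c_def powr_realpow[symmetric] powr_half_sqrt[symmetric] powr_powr a_def)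
    have "emeasure ?\<mu> {..r} = ennreal (c ^ DIM('a)) * (\<integral>\<^sup>+x. ennreal (q (0 + c *\<^sub>R x)) * indicator {..r} ((norm (0 + c *\<^sub>R x))\<^sup>2) \<partial>lborel)"
      unfolding mu by (subst nn_integral_lborel_affine[OF _ c(1), of _ 0]) auto
    also have "\<dots> = ennreal (c ^ DIM('a)) * (\<integral>\<^sup>+x. ennreal (c ^ d) * (ennreal (q x) * indicator {..1} ((norm x)\<^sup>2)) \<partial>lborel)"
      using c True q0 by (intro arg_cong[where f="\<lambda>x. ennreal (c ^ DIM('a)) * x"] nn_integral_cong)
        (auto simp: hom indicator_def power_mult_distrib ennreal_mult mult.assoc)
    also have "\<dots> = ennreal (c ^ DIM('a)) * (ennreal (c ^ d) * ennreal T)"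
      by (subst nn_integral_cmult) (auto simp: T(1))
    also have "\<dots> = ennreal (T * r powr a)"
      using c T(2) by (simp add: ennreal_mult[symmetric] pw[symmetric] power_add mult_ac)
    finally show ?thesis using True by simp
  next
    case False
    have "emeasure ?\<mu> {..r} = (\<integral>\<^sup>+x. 0 \<partial>(lborel :: 'a measure))"
      unfolding mu
    proof (rule nn_integral_cong_AE)
      show "AE x in lborel. ennreal (q x) * indicator {..r} ((norm x)\<^sup>2) = 0"
        using AE_lborel_singleton[of "0 :: 'a"]
      proof eventually_elim
        fix x :: 'a assume "x \<noteq> 0"
        then have "0 < (norm x)\<^sup>2" by simp
        then have "\<not> (norm x)\<^sup>2 \<le> r" using False by linarith
        then show "ennreal (q x) * indicator {..r} ((norm x)\<^sup>2) = 0" by simp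
      qed
    qed
    then show ?thesis using False by simp
  qed
  have nu: "emeasure ?\<nu> {..r} = (if 0 < r then ennreal (T * r powr a) else 0)" for r
  proof (cases "0 < r")
    case True
    have "((\<lambda>x. a * T * x powr (a - 1)) has_integral (a * T * (r powr (a - 1 + 1) / (a - 1 + 1)))) {0..r}"
      using a True by (intro has_integral_mult_right has_integral_powr_from_0) auto
    then have "((\<lambda>x. indicator {0..r} x * (a * T * x powr (a - 1))) has_integral (T * r powr a)) UNIV"
      using a by (subst (asm) has_integral_restrict_UNIV[symmetric])
         (auto elim!: has_integral_eq[rotated] simp: indicator_def)
    then have "(\<integral>\<^sup>+x. ennreal (indicator {0..r} x * (a * T * x powr (a - 1))) \<partial>lborel) = ennreal (T * r powr a)"
      using a T(2) by (intro nn_integral_has_integral_lborel) auto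
    moreover have "emeasure ?\<nu> {..r} = (\<integral>\<^sup>+x. ennreal (indicator {0..r} x * (a * T * x powr (a - 1))) \<partial>lborel)"
      by (subst emeasure_density) (auto simp: indicator_def intro!: nn_integral_cong)
    ultimately show ?thesis using True by simp
  next
    case False
    have "emeasure ?\<nu> {..r} = (\<integral>\<^sup>+t. ennreal (indicator {0<..} t * (a * T * t powr (a - 1))) * indicator {..r} t \<partial>lborel)"
      by (rule emeasure_density) auto
    also have "\<dots> = (\<integral>\<^sup>+x. 0 \<partial>(lborel :: real measure))"
      using False by (intro nn_integral_cong) (auto simp: indicator_def)
    finally show ?thesis using False by simp
  qed
  show ?thesis
  proof (rule measure_eqI_generator_eq[where E="range atMost" and \<Omega>=UNIV and A="\<lambda>i. {..real i}"])
    show "Int_stable (range (atMost :: real \<Rightarrow> _))" by (auto simp: Int_stable_def)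
    show "sets ?\<mu> = sigma_sets UNIV (range atMost)" "sets ?\<nu> = sigma_sets UNIV (range atMost)"
      by (simp_all add: borel_eq_atMost)
    show "emeasure ?\<mu> X = emeasure ?\<nu> X" if "X \<in> range atMost" for X
      using that eq nu by auto
    show "(\<Union>i. {..real i}) = UNIV" using real_arch_simple by auto
    show "emeasure ?\<mu> {..real i} \<noteq> \<infinity>" for i by (simp add: eq)
  qed auto
qed

text \<open>The Gaussian density depends on x only through its norm, so it multiplies the radial
  power t^(a-1) by exp(-t/2). With a = (p + d)/2 this is a chi-square density up to a constant: the
  weight q adds d degrees of freedom.\<close>

lemma nn_integral_gauss_radial_homogeneous:
  fixes q :: "real ^ 'p::finite \<Rightarrow> real"
  assumes qm [measurable]: "q \<in> borel_measurable borel" and q0: "\<And>x. 0 \<le> q x"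
    and hom: "\<And>c x. 0 < c \<Longrightarrow> q (c *\<^sub>R x) = c ^ d * q x"
    and fin: "(\<integral>\<^sup>+x. ennreal (q x) \<partial>multi_normal 0 1) < \<infinity>"
    and fm [measurable]: "f \<in> borel_measurable borel"
  shows "(\<integral>\<^sup>+x. f ((norm x)\<^sup>2) * ennreal (q x) \<partial>multi_normal 0 1)
    = (\<integral>\<^sup>+x. ennreal (q x) \<partial>multi_normal 0 1) * (\<integral>\<^sup>+t. f t \<partial>chi_square (CARD('p) + d))"
proof -
  define a where "a = (real CARD('p) + real d) / 2"
  have a: "0 < a" by (simp add: a_def add_pos_nonneg)
  define c0 where "c0 = (1 / sqrt (2 * pi)) ^ CARD('p)"
  have c0: "0 < c0" by (simp add: c0_def)
  have gd: "gauss_density x = c0 * exp (- (norm x)\<^sup>2 / 2)" for x :: "real ^ 'p" by (simp add: gauss_density_def c0_def)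
  define T where "T = enn2real (\<integral>\<^sup>+x. ennreal (q x) * indicator {..1} ((norm x)\<^sup>2) \<partial>lborel)"
  \<comment> \<open>On the unit ball the Gaussian density is at least
    \<open>c0 * exp (- 1 / 2)\<close>, so finiteness of the Gaussian moment makes the Lebesgue
    integral over the ball finite.\<close>
  have "(\<integral>\<^sup>+x. ennreal (q x) * indicator {..1} ((norm x)\<^sup>2) \<partial>lborel)
      \<le> (\<integral>\<^sup>+x. ennreal (exp (1 / 2) / c0) * (ennreal (gauss_density x) * ennreal (q x)) \<partial>lborel)"
  proof (rule nn_integral_mono)
    fix x :: "real ^ 'p"
    have "1 \<le> exp (1 / 2) * exp (- (norm x)\<^sup>2 / 2)" if "(norm x)\<^sup>2 \<le> 1"
      using that by (simp add: exp_add[symmetric])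
    then have "q x \<le> exp (1 / 2) / c0 * (gauss_density x * q x)" if "(norm x)\<^sup>2 \<le> 1"
      using that c0 q0[of x] mult_right_mono[of 1 "exp (1 / 2) * exp (- (norm x)\<^sup>2 / 2)" "q x"] by (simp add: gd)
    then show "ennreal (q x) * indicator {..1} ((norm x)\<^sup>2)
        \<le> ennreal (exp (1 / 2) / c0) * (ennreal (gauss_density x) * ennreal (q x))"
      using c0 q0[of x] by (auto simp: indicator_def ennreal_mult[symmetric] intro!: ennreal_leI)
  qed
  also have "\<dots> = ennreal (exp (1 / 2) / c0) * (\<integral>\<^sup>+x. ennreal (q x) \<partial>multi_normal 0 1)"
    by (subst nn_integral_multi_normal_standard) (auto intro!: nn_integral_cmult)
  also have "\<dots> < \<infinity>" using fin by (simp add: ennreal_mult_less_top)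
  finally have T: "(\<integral>\<^sup>+x. ennreal (q x) * indicator {..1} ((norm x)\<^sup>2) \<partial>lborel) = ennreal T" "0 \<le> T"
    by (auto simp: T_def)
  have rad: "distr (density lborel (\<lambda>x. ennreal (q x))) borel (\<lambda>x. (norm x)\<^sup>2)
    = density lborel (\<lambda>t. ennreal (indicator {0<..} t * (a * T * t powr (a - 1))))"
    using radial_homogeneous_distr[OF qm q0 hom T] by (simp add: a_def)
  define C where "C = c0 * (a * T) * (2 powr a * Gamma a)"
  have G: "0 < Gamma a" using a by simp
  have C: "0 \<le> C" using c0 a T(2) G by (simp add: C_def)
  have N: "0 < CARD('p) + d" by simp
  have N2: "real (CARD('p) + d) / 2 = a" by (simp add: a_def)
  have main: "(\<integral>\<^sup>+x. h ((norm x)\<^sup>2) * ennreal (q x) \<partial>multi_normal 0 1) = ennreal C * (\<integral>\<^sup>+t. h t \<partial>chi_square (CARD('p) + d))"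
    if [measurable]: "h \<in> borel_measurable borel" for h
  proof -
    have "(\<integral>\<^sup>+x. h ((norm x)\<^sup>2) * ennreal (q x) \<partial>multi_normal 0 1)
      = (\<integral>\<^sup>+x. ennreal (q x) * (ennreal (c0 * exp (- (norm x)\<^sup>2 / 2)) * h ((norm x)\<^sup>2)) \<partial>lborel)"
      by (subst nn_integral_multi_normal_standard) (auto simp: gd mult_ac)
    also have "\<dots> = (\<integral>\<^sup>+t. ennreal (c0 * exp (- t / 2)) * h t \<partial>distr (density lborel (\<lambda>x. ennreal (q x))) borel (\<lambda>x. (norm x)\<^sup>2))"
      by (subst nn_integral_distr) (auto simp: nn_integral_density)
    also have "\<dots> = (\<integral>\<^sup>+t. ennreal (indicator {0<..} t * (a * T * t powr (a - 1))) * (ennreal (c0 * exp (- t / 2)) * h t) \<partial>lborel)"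
      unfolding rad by (subst nn_integral_density) auto
    also have "\<dots> = (\<integral>\<^sup>+t. ennreal C * (ennreal (chi_square_density (CARD('p) + d) t) * h t * indicator {0<..} t) \<partial>lborel)"
    proof (rule nn_integral_cong)
      fix t :: real
      have "(a * T * t powr (a - 1)) * (c0 * exp (- t / 2)) = C * chi_square_density (CARD('p) + d) t"
        unfolding chi_square_density_def N2 C_def using G by simp
      then have "ennreal (a * T * t powr (a - 1)) * ennreal (c0 * exp (- t / 2)) = ennreal C * ennreal (chi_square_density (CARD('p) + d) t)"
        using a T(2) c0 C N by (simp add: ennreal_mult[symmetric])
      then show "ennreal (indicator {0<..} t * (a * T * t powr (a - 1))) * (ennreal (c0 * exp (- t / 2)) * h t)
          = ennreal C * (ennreal (chi_square_density (CARD('p) + d) t) * h t * indicator {0<..} t)"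
        by (auto simp: indicator_def mult.assoc[symmetric])
    qed
    also have "\<dots> = ennreal C * (\<integral>\<^sup>+t. h t \<partial>chi_square (CARD('p) + d))"
      by (subst nn_integral_chi_square) (auto intro!: nn_integral_cmult)
    finally show ?thesis .
  qed
  interpret chi: prob_space "chi_square (CARD('p) + d)" by (rule prob_space_chi_square[OF N])
  \<comment> \<open>The constant is identified by the test function 1, with no explicit
    evaluation.\<close>
  have "(\<integral>\<^sup>+x. ennreal (q x) \<partial>multi_normal 0 1) = ennreal C"
    using main[of "\<lambda>_. 1"] chi.emeasure_space_1 by simp
  then show ?thesis using main[OF fm] by simp
qed

section \<open>The noncentral law as a mixture\<close>

definition base_law :: "nat \<Rightarrow> ((real ^ 'p::finite) \<times> real) measure" where
  "base_law n = multi_normal 0 1 \<Otimes>\<^sub>M chi_square n"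

lemma measurable_base_law_fst [measurable]: "fst \<in> borel_measurable (base_law n)"
  unfolding base_law_def by measurable

lemma measurable_base_law_snd [measurable]: "snd \<in> borel_measurable (base_law n)"
  unfolding base_law_def by measurable

lemma measurable_base_law_ratio [measurable]: "(\<lambda>z. (norm (fst z))\<^sup>2 / snd z) \<in> borel_measurable (base_law n)"
  by measurable

lemma prob_space_base_law:
  assumes "0 < n"
  shows "prob_space (base_law n :: ((real ^ 'p::finite) \<times> real) measure)"
proof -
  interpret cn: prob_space "chi_square n" by (rule prob_space_chi_square[OF assms])
  interpret G: prob_space "multi_normal (0 :: real ^ 'p) 1" by (rule prob_space_multi_normal_standard)
  interpret P: pair_prob_space "multi_normal (0 :: real ^ 'p) 1" "chi_square n" ..
  show ?thesis unfolding base_law_def by (rule P.prob_space_axioms)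
qed

text \<open>For each fixed s the radial lemma replaces the squared norm by a chi-square variable
  with d extra degrees of freedom and splits off the total mass of q; averaging over s turns this
  into the law of the ratio.\<close>

lemma homogeneous_ratio_distr:
  fixes q :: "real ^ 'p::finite \<Rightarrow> real"
  assumes n: "0 < n" and qm [measurable]: "q \<in> borel_measurable borel" and q0: "\<And>x. 0 \<le> q x"
    and hom: "\<And>c x. 0 < c \<Longrightarrow> q (c *\<^sub>R x) = c ^ d * q x"
    and int: "integrable (multi_normal 0 1) q"
  shows "distr (density (base_law n) (\<lambda>z. ennreal (q (fst z)))) borel (\<lambda>z. (norm (fst z))\<^sup>2 / snd z)
    = density (ratio_law (CARD('p) + d) n) (\<lambda>_. ennreal (integral\<^sup>L (multi_normal 0 1) q))" (is "?\<mu> = ?\<nu>")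
proof (rule measure_eqI)
  interpret cn: prob_space "chi_square n" by (rule prob_space_chi_square[OF n])
  interpret cN: prob_space "chi_square (CARD('p) + d)" by (rule prob_space_chi_square) simp
  interpret G: prob_space "multi_normal (0 :: real ^ 'p) 1" by (rule prob_space_multi_normal_standard)
  interpret P: pair_prob_space "multi_normal (0 :: real ^ 'p) 1" "chi_square n" ..
  interpret Q: pair_prob_space "chi_square (CARD('p) + d)" "chi_square n" ..
  define c where "c = ennreal (integral\<^sup>L (multi_normal 0 1) q)"
  have c: "(\<integral>\<^sup>+x. ennreal (q x) \<partial>multi_normal 0 1) = c"
    unfolding c_def by (rule nn_integral_eq_integral[OF int]) (use q0 in auto)
  fix A assume "A \<in> sets ?\<mu>"
  then have [measurable]: "A \<in> sets borel" by simp
  have "emeasure ?\<mu> A = (\<integral>\<^sup>+t. indicator A t \<partial>?\<mu>)" by simp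
  also have "\<dots> = (\<integral>\<^sup>+z. indicator A ((norm (fst z))\<^sup>2 / snd z) \<partial>density (base_law n) (\<lambda>z. ennreal (q (fst z))))"
    by (rule nn_integral_distr) auto
  also have "\<dots> = (\<integral>\<^sup>+z. ennreal (q (fst z)) * indicator A ((norm (fst z))\<^sup>2 / snd z) \<partial>base_law n)"
    by (rule nn_integral_density) auto
  also have "\<dots> = (\<integral>\<^sup>+s. (\<integral>\<^sup>+x. ennreal (q x) * indicator A ((norm x)\<^sup>2 / s) \<partial>multi_normal 0 1) \<partial>chi_square n)"
    unfolding base_law_def
    by (subst P.nn_integral_snd[symmetric]) (use measurable_base_law_fst measurable_base_law_ratio in \<open>auto simp: base_law_def\<close>)
  also have "\<dots> = (\<integral>\<^sup>+s. c * (\<integral>\<^sup>+t. indicator A (t / s) \<partial>chi_square (CARD('p) + d)) \<partial>chi_square n)"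
  proof (rule nn_integral_cong)
    fix s
    have "(\<integral>\<^sup>+x. indicator A ((norm x)\<^sup>2 / s) * ennreal (q x) \<partial>multi_normal 0 1)
      = (\<integral>\<^sup>+x. ennreal (q x) \<partial>multi_normal 0 1) * (\<integral>\<^sup>+t. indicator A (t / s) \<partial>chi_square (CARD('p) + d))"
      by (rule nn_integral_gauss_radial_homogeneous[OF qm q0 hom, where f="\<lambda>t. indicator A (t / s)"])
         (auto simp: c c_def)
    then show "(\<integral>\<^sup>+x. ennreal (q x) * indicator A ((norm x)\<^sup>2 / s) \<partial>multi_normal 0 1)
      = c * (\<integral>\<^sup>+t. indicator A (t / s) \<partial>chi_square (CARD('p) + d))"
      by (simp add: c mult.commute)
  qed
  also have "\<dots> = c * (\<integral>\<^sup>+s. (\<integral>\<^sup>+t. indicator A (t / s) \<partial>chi_square (CARD('p) + d)) \<partial>chi_square n)"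
    by (rule nn_integral_cmult) measurable
  also have "(\<integral>\<^sup>+s. (\<integral>\<^sup>+t. indicator A (t / s) \<partial>chi_square (CARD('p) + d)) \<partial>chi_square n)
      = (\<integral>\<^sup>+z. indicator A (fst z / snd z) \<partial>(chi_square (CARD('p) + d) \<Otimes>\<^sub>M chi_square n))"
    by (subst Q.nn_integral_snd[symmetric]) auto
  also have "\<dots> = (\<integral>\<^sup>+w. indicator A w \<partial>ratio_law (CARD('p) + d) n)"
    unfolding ratio_law_def by (subst nn_integral_distr) (auto simp: case_prod_unfold)
  also have "c * (\<integral>\<^sup>+w. indicator A w \<partial>ratio_law (CARD('p) + d) n) = emeasure ?\<nu> A"
    by (subst emeasure_density) (auto simp: c_def nn_integral_cmult_indicator)
  finally show "emeasure ?\<mu> A = emeasure ?\<nu> A" .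
qed simp

lemma
  fixes q :: "real ^ 'p::finite \<Rightarrow> real" and F :: "real \<Rightarrow> real"
  assumes n: "0 < n" and qm [measurable]: "q \<in> borel_measurable borel" and q0: "\<And>x. 0 \<le> q x"
    and hom: "\<And>c x. 0 < c \<Longrightarrow> q (c *\<^sub>R x) = c ^ d * q x"
    and int: "integrable (multi_normal 0 1) q"
    and Fm [measurable]: "F \<in> borel_measurable borel"
  shows integrable_homogeneous_nonneg:
      "integrable (base_law n) (\<lambda>z. q (fst z) * F ((norm (fst z))\<^sup>2 / snd z))
        \<longleftrightarrow> integrable (ratio_law (CARD('p) + d) n) (\<lambda>w. integral\<^sup>L (multi_normal 0 1) q * F w)" (is ?A)
    and integral_homogeneous_nonneg:
      "(\<integral>z. q (fst z) * F ((norm (fst z))\<^sup>2 / snd z) \<partial>base_law n)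
        = integral\<^sup>L (multi_normal 0 1) q * integral\<^sup>L (ratio_law (CARD('p) + d) n) F" (is ?B)
proof -
  let ?R = "ratio_law (CARD('p) + d) n"
  have D: "distr (density (base_law n) (\<lambda>z. ennreal (q (fst z)))) borel (\<lambda>z. (norm (fst z))\<^sup>2 / snd z)
    = density ?R (\<lambda>_. ennreal (integral\<^sup>L (multi_normal 0 1) q))"
    by (rule homogeneous_ratio_distr[OF n qm q0 hom int])
  have c: "0 \<le> integral\<^sup>L (multi_normal 0 1) q" using q0 by (intro integral_nonneg_AE) auto
  have [measurable]: "F \<in> borel_measurable (ratio_law (CARD('p) + d) n)"
    by (simp add: measurable_cong_sets[OF sets_ratio_law refl])
  have "integrable (base_law n) (\<lambda>z. q (fst z) * F ((norm (fst z))\<^sup>2 / snd z))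
    \<longleftrightarrow> integrable (density (base_law n) (\<lambda>z. ennreal (q (fst z)))) (\<lambda>z. F ((norm (fst z))\<^sup>2 / snd z))"
    using q0 by (subst integrable_density) auto
  also have "\<dots> \<longleftrightarrow> integrable (distr (density (base_law n) (\<lambda>z. ennreal (q (fst z)))) borel (\<lambda>z. (norm (fst z))\<^sup>2 / snd z)) F"
    by (subst integrable_distr_eq) auto
  also have "\<dots> \<longleftrightarrow> integrable ?R (\<lambda>w. integral\<^sup>L (multi_normal 0 1) q * F w)"
    using c by (subst D, subst integrable_density) auto
  finally show ?A .
  have "(\<integral>z. q (fst z) * F ((norm (fst z))\<^sup>2 / snd z) \<partial>base_law n)
    = (\<integral>z. F ((norm (fst z))\<^sup>2 / snd z) \<partial>density (base_law n) (\<lambda>z. ennreal (q (fst z))))"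
    using q0 by (subst integral_density) auto
  also have "\<dots> = integral\<^sup>L (distr (density (base_law n) (\<lambda>z. ennreal (q (fst z)))) borel (\<lambda>z. (norm (fst z))\<^sup>2 / snd z)) F"
    by (subst integral_distr) auto
  also have "\<dots> = integral\<^sup>L (multi_normal 0 1) q * integral\<^sup>L (ratio_law (CARD('p) + d) n) F"
    using c by (subst D, subst integral_density) auto
  finally show ?B .
qed

text \<open>Positive and negative part of q are homogeneous of the same degree. Signed weights are
  unavoidable: the odd powers of x . \<tau> occur in the series.\<close>

lemma integral_homogeneous:
  fixes q :: "real ^ 'p::finite \<Rightarrow> real" and F :: "real \<Rightarrow> real"
  assumes n: "0 < n" and qm [measurable]: "q \<in> borel_measurable borel"
    and hom: "\<And>c x. 0 < c \<Longrightarrow> q (c *\<^sub>R x) = c ^ d * q x"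
    and int: "integrable (multi_normal 0 1) q"
    and Fm [measurable]: "F \<in> borel_measurable borel"
    and Fi: "integrable (base_law n) (\<lambda>z. q (fst z) * F ((norm (fst z))\<^sup>2 / snd z))"
  shows "(\<integral>z. q (fst z) * F ((norm (fst z))\<^sup>2 / snd z) \<partial>base_law n)
        = integral\<^sup>L (multi_normal 0 1) q * integral\<^sup>L (ratio_law (CARD('p) + d) n) F"
proof -
  define q1 q2 where "q1 x = max (q x) 0" and "q2 x = max (- q x) 0" for x
  have q: "q x = q1 x - q2 x" for x by (auto simp: q1_def q2_def)
  have [measurable]: "q1 \<in> borel_measurable borel" "q2 \<in> borel_measurable borel"
    unfolding q1_def q2_def by measurable
  have i: "integrable (multi_normal 0 1) q1" "integrable (multi_normal 0 1) q2"
    unfolding q1_def q2_def using int by (auto intro!: integrable_max)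
  have h: "q1 (c *\<^sub>R x) = c ^ d * q1 x" "q2 (c *\<^sub>R x) = c ^ d * q2 x" if "0 < c" for c x
    using that by (auto simp: q1_def q2_def hom max_mult_distrib_left)
  have nn: "0 \<le> q1 x" "0 \<le> q2 x" for x by (auto simp: q1_def q2_def)
  have le: "\<bar>q1 x\<bar> \<le> \<bar>q x\<bar>" "\<bar>q2 x\<bar> \<le> \<bar>q x\<bar>" for x by (auto simp: q1_def q2_def)
  have i1: "integrable (base_law n) (\<lambda>z. q1 (fst z) * F ((norm (fst z))\<^sup>2 / snd z))"
    by (rule Bochner_Integration.integrable_bound[OF Fi]) (auto simp: abs_mult le intro!: mult_right_mono)
  have i2: "integrable (base_law n) (\<lambda>z. q2 (fst z) * F ((norm (fst z))\<^sup>2 / snd z))"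
    by (rule Bochner_Integration.integrable_bound[OF Fi]) (auto simp: abs_mult le intro!: mult_right_mono)
  have "(\<integral>z. q1 (fst z) * F ((norm (fst z))\<^sup>2 / snd z) \<partial>base_law n)
      = integral\<^sup>L (multi_normal 0 1) q1 * integral\<^sup>L (ratio_law (CARD('p) + d) n) F"
    by (rule integral_homogeneous_nonneg[OF n _ nn(1) h(1) i(1)]) auto
  moreover have "(\<integral>z. q2 (fst z) * F ((norm (fst z))\<^sup>2 / snd z) \<partial>base_law n)
      = integral\<^sup>L (multi_normal 0 1) q2 * integral\<^sup>L (ratio_law (CARD('p) + d) n) F"
    by (rule integral_homogeneous_nonneg[OF n _ nn(2) h(2) i(2)]) auto
  moreover have "(\<integral>z. q (fst z) * F ((norm (fst z))\<^sup>2 / snd z) \<partial>base_law n)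
      = (\<integral>z. q1 (fst z) * F ((norm (fst z))\<^sup>2 / snd z) \<partial>base_law n)
        - (\<integral>z. q2 (fst z) * F ((norm (fst z))\<^sup>2 / snd z) \<partial>base_law n)"
    using i1 i2 by (simp add: q left_diff_distrib)
  moreover have "integral\<^sup>L (multi_normal 0 1) q = integral\<^sup>L (multi_normal 0 1) q1 - integral\<^sup>L (multi_normal 0 1) q2"
    using Bochner_Integration.integral_diff[OF i] by (simp add: q[abs_def])
  ultimately show ?thesis by (simp add: left_diff_distrib)
qed

lemma integrable_dominated:
  fixes f g :: "'a \<Rightarrow> real"
  assumes "integrable M g" "f \<in> borel_measurable M" "\<And>x. x \<in> space M \<Longrightarrow> \<bar>f x\<bar> \<le> g x"
  shows "integrable M f"
  by (rule Bochner_Integration.integrable_bound[OF assms(1,2)])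
     (auto intro!: AE_I2 order_trans[OF assms(3) abs_ge_self])

lemma power_le_fact_exp: "\<bar>x\<bar> ^ k \<le> fact k * exp \<bar>x :: real\<bar>"
proof -
  have s: "(\<lambda>n. \<bar>x\<bar> ^ n /\<^sub>R fact n) sums exp \<bar>x\<bar>" by (rule exp_converges)
  have "(\<Sum>n\<in>{k}. \<bar>x\<bar> ^ n /\<^sub>R fact n) \<le> (\<Sum>n. \<bar>x\<bar> ^ n /\<^sub>R fact n)"
    by (rule sum_le_suminf) (use s in \<open>auto dest: sums_summable\<close>)
  then show ?thesis using sums_unique[OF s] by (simp add: field_simps)
qed

text \<open>All partial sums of the exponential series are dominated by the one with |y|, so a
  single moment assumption gives every term and the termwise integration.\<close>

lemma
  fixes g y :: "'a \<Rightarrow> real"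
  assumes [measurable]: "g \<in> borel_measurable M" "y \<in> borel_measurable M"
    and int: "integrable M (\<lambda>z. g z * exp \<bar>y z\<bar>)"
  shows integrable_mult_power: "integrable M (\<lambda>z. g z * y z ^ k)"
    and exp_moment_sums: "(\<lambda>k. (\<integral>z. g z * y z ^ k \<partial>M) / fact k) sums (\<integral>z. g z * exp (y z) \<partial>M)"
proof -
  have i: "integrable M (\<lambda>z. g z * y z ^ k)" for k
  proof (rule integrable_dominated[OF integrable_mult_right[OF integrable_abs[OF int], of "fact k"]])
    fix z
    have "\<bar>g z\<bar> * \<bar>y z\<bar> ^ k \<le> \<bar>g z\<bar> * (fact k * exp \<bar>y z\<bar>)"
      by (intro mult_left_mono power_le_fact_exp) auto
    then show "\<bar>g z * y z ^ k\<bar> \<le> fact k * \<bar>g z * exp \<bar>y z\<bar>\<bar>"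
      by (simp add: abs_mult power_abs mult_ac)
  qed simp
  then show "integrable M (\<lambda>z. g z * y z ^ k)" .
  define f where "f k z = g z * y z ^ k / fact k" for k z
  have fi: "integrable M (f k)" for k unfolding f_def using i[of k] by simp
  have fs: "(\<lambda>k. f k z) sums (g z * exp (y z))" for z
    using sums_mult[OF exp_converges[of "y z"], of "g z"] by (simp add: f_def divide_inverse mult_ac)
  have fa: "(\<lambda>k. norm (f k z)) sums (\<bar>g z\<bar> * exp \<bar>y z\<bar>)" for z
    using sums_mult[OF exp_converges[of "\<bar>y z\<bar>"], of "\<bar>g z\<bar>"]
    by (simp add: f_def divide_inverse mult_ac abs_mult power_abs)
  have "summable (\<lambda>k. \<integral>z. norm (f k z) \<partial>M)"
  proof (rule summableI_nonneg_bounded)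
    fix K
    have "(\<Sum>k<K. \<integral>z. norm (f k z) \<partial>M) = (\<integral>z. (\<Sum>k<K. norm (f k z)) \<partial>M)"
      using fi by (intro Bochner_Integration.integral_sum[symmetric]) auto
    also have "\<dots> \<le> (\<integral>z. norm (g z * exp \<bar>y z\<bar>) \<partial>M)"
    proof (rule integral_mono)
      fix z
      have "(\<Sum>k<K. norm (f k z)) \<le> (\<Sum>k. norm (f k z))"
        by (rule sum_le_suminf) (use sums_summable[OF fa] in auto)
      then show "(\<Sum>k<K. norm (f k z)) \<le> norm (g z * exp \<bar>y z\<bar>)"
        using sums_unique[OF fa, of z] by (simp add: abs_mult)
    qed (use fi int in auto)
    finally show "(\<Sum>k<K. \<integral>z. norm (f k z) \<partial>M) \<le> (\<integral>z. norm (g z * exp \<bar>y z\<bar>) \<partial>M)" .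
  qed simp
  then have "(\<lambda>k. integral\<^sup>L M (f k)) sums (\<integral>z. (\<Sum>k. f k z) \<partial>M)"
    using fi fa by (intro sums_integral) (auto intro!: AE_I2 dest: sums_summable)
  moreover have "(\<Sum>k. f k z) = g z * exp (y z)" for z
    using sums_unique[OF fs] by simp
  moreover have "integral\<^sup>L M (f k) = (\<integral>z. g z * y z ^ k \<partial>M) / fact k" for k
    by (simp add: f_def[abs_def])
  ultimately show "(\<lambda>k. (\<integral>z. g z * y z ^ k \<partial>M) / fact k) sums (\<integral>z. g z * exp (y z) \<partial>M)"
    by simp
qed

text \<open>Since \<open>q\<^sub>k(x) = r(x) (x \<bullet> \<tau>)\<^sup>k\<close> is homogeneous, each term of the exponential series sees
  \<open>|X|\<^sup>2\<close> as a central chi-square variable with \<open>k\<close> additional degrees of freedom; this is the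
  Poisson mixture representation of the noncentral law.\<close>
lemma noncentral_series:
  fixes r :: "real ^ 'p::finite \<Rightarrow> real" and F :: "real \<Rightarrow> real"
  assumes n: "0 < n" and rm [measurable]: "r \<in> borel_measurable borel"
    and hom: "\<And>c x. 0 < c \<Longrightarrow> r (c *\<^sub>R x) = c ^ d * r x"
    and mom: "integrable (multi_normal 0 1) (\<lambda>x. r x * exp \<bar>x \<bullet> \<tau>\<bar>)"
    and Fm [measurable]: "F \<in> borel_measurable borel"
    and dom: "integrable (base_law n) (\<lambda>z. F ((norm (fst z))\<^sup>2 / snd z) * r (fst z) * exp \<bar>fst z \<bullet> \<tau>\<bar>)"
  shows "(\<lambda>k. (\<integral>x. r x * (x \<bullet> \<tau>) ^ k \<partial>multi_normal 0 1) / fact k * integral\<^sup>L (ratio_law (CARD('p) + d + k) n) F)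
    sums (\<integral>z. F ((norm (fst z))\<^sup>2 / snd z) * r (fst z) * exp (fst z \<bullet> \<tau>) \<partial>base_law n)"
proof -
  have "(\<lambda>k. (\<integral>z. F ((norm (fst z))\<^sup>2 / snd z) * r (fst z) * (fst z \<bullet> \<tau>) ^ k \<partial>base_law n) / fact k)
    sums (\<integral>z. F ((norm (fst z))\<^sup>2 / snd z) * r (fst z) * exp (fst z \<bullet> \<tau>) \<partial>base_law n)"
    by (rule exp_moment_sums[OF _ _ dom]) measurable
  moreover have "(\<integral>z. F ((norm (fst z))\<^sup>2 / snd z) * r (fst z) * (fst z \<bullet> \<tau>) ^ k \<partial>base_law n)
      = (\<integral>x. r x * (x \<bullet> \<tau>) ^ k \<partial>multi_normal 0 1) * integral\<^sup>L (ratio_law (CARD('p) + d + k) n) F" for k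
  proof -
    have "(\<integral>z. (r (fst z) * (fst z \<bullet> \<tau>) ^ k) * F ((norm (fst z))\<^sup>2 / snd z) \<partial>base_law n)
      = (\<integral>x. r x * (x \<bullet> \<tau>) ^ k \<partial>multi_normal 0 1) * integral\<^sup>L (ratio_law (CARD('p) + (d + k)) n) F"
    proof (rule integral_homogeneous[OF n, where q="\<lambda>x. r x * (x \<bullet> \<tau>) ^ k"])
      show "integrable (multi_normal 0 1) (\<lambda>x. r x * (x \<bullet> \<tau>) ^ k)"
        by (rule integrable_mult_power[OF _ _ mom]) measurable
      have "integrable (base_law n) (\<lambda>z. F ((norm (fst z))\<^sup>2 / snd z) * r (fst z) * (fst z \<bullet> \<tau>) ^ k)"
        by (rule integrable_mult_power[OF _ _ dom]) measurable
      then show "integrable (base_law n) (\<lambda>z. (r (fst z) * (fst z \<bullet> \<tau>) ^ k) * F ((norm (fst z))\<^sup>2 / snd z))"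
        by (simp add: mult_ac)
    qed (auto simp: hom power_mult_distrib power_add)
    then show ?thesis by (simp add: mult_ac add.assoc)
  qed
  ultimately show ?thesis by simp
qed

section \<open>Gaussian moments\<close>

text \<open>Gaussian moments are read off by comparing two expansions, in an auxiliary parameter a,
  of the same generating function.\<close>

lemma power_series_unique:
  fixes c d :: "nat \<Rightarrow> real"
  assumes c: "\<And>a. (\<lambda>k. c k * a ^ k) sums f a" and d: "\<And>a. (\<lambda>k. d k * a ^ k) sums f a"
  shows "c k = d k"
proof (rule ccontr)
  assume ne: "c k \<noteq> d k"
  have s: "(\<lambda>k. (c k - d k) * a ^ k) sums 0" for a
    using sums_diff[OF c[of a] d[of a]] by (simp add: left_diff_distrib)
  have "c 0 - d 0 = 0" using s[of 0] by simp
  then have "0 < k" using ne by (cases k) auto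
  have sm: "(\<lambda>k. (c k - d k) * (x - 0) ^ k) sums 0" for x using s[of x] by simp
  have m: "c k - d k \<noteq> 0" using ne by simp
  show False
  proof (rule powser_0_nonzero[where f="\<lambda>_. 0", OF zero_less_one sm refl m \<open>0 < k\<close>])
    fix e :: real assume e: "0 < e" "\<And>z :: real. z \<in> cball 0 e - {0} \<Longrightarrow> (0 :: real) \<noteq> 0"
    have "e \<in> cball 0 e - {0}" using e(1) by simp
    from e(2)[OF this] show False by simp
  qed
qed

text \<open>The Taylor coefficients in a of exp(a^2 |\<tau>|^2 / 2). At k = 2j this is the Poisson
  weight with mean |\<tau>|^2 / 2, without its factor exp(-|\<tau>|^2 / 2).\<close>

definition gauss_coeff :: "real ^ 'p::finite \<Rightarrow> nat \<Rightarrow> real" where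
  "gauss_coeff \<tau> k = (if even k then ((norm \<tau>)\<^sup>2 / 2) ^ (k div 2) / fact (k div 2) else 0)"

lemma gauss_coeff_nonneg [simp]: "0 \<le> gauss_coeff \<tau> k"
  by (simp add: gauss_coeff_def)

lemma gauss_coeff_sums: "(\<lambda>k. gauss_coeff \<tau> k * a ^ k) sums exp (a\<^sup>2 * (norm \<tau>)\<^sup>2 / 2)"
proof -
  define N where "N = (norm \<tau>)\<^sup>2 / 2"
  have "gauss_coeff \<tau> (2 * j) * a ^ (2 * j) = (a\<^sup>2 * N) ^ j /\<^sub>R fact j" for j
    unfolding gauss_coeff_def N_def[symmetric] power_mult power_mult_distrib by (simp add: divide_inverse)
  then have "(\<lambda>j. gauss_coeff \<tau> (2 * j) * a ^ (2 * j)) sums exp (a\<^sup>2 * N)"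
    using exp_converges[of "a\<^sup>2 * N"] by presburger
  then have "(\<lambda>j. gauss_coeff \<tau> (2 * j) * a ^ (2 * j)) sums exp (a\<^sup>2 * (norm \<tau>)\<^sup>2 / 2)"
    by (simp add: N_def)
  moreover have "gauss_coeff \<tau> k * a ^ k = 0" if "k \<notin> range (\<lambda>j. 2 * j)" for k
    using that by (cases "even k") (auto simp: gauss_coeff_def elim!: evenE)
  moreover have "strict_mono (\<lambda>j::nat. 2 * j)" by (simp add: strict_mono_def)
  ultimately show ?thesis
    using sums_mono_reindex[of "\<lambda>j. 2 * j" "\<lambda>k. gauss_coeff \<tau> k * a ^ k"] by blast
qed

text \<open>The tilted density has total mass 1, because it is the density of the normal law with
  mean \<tau>.\<close>

lemma
  fixes \<tau> :: "real ^ 'p::finite"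
  shows integrable_gauss_exp: "integrable (multi_normal 0 1) (\<lambda>x. exp (x \<bullet> \<tau>))"
    and integral_gauss_exp: "(\<integral>x. exp (x \<bullet> \<tau>) \<partial>multi_normal 0 1) = exp ((norm \<tau>)\<^sup>2 / 2)"
proof -
  interpret T: prob_space "multi_normal \<tau> 1" by (rule prob_space_multi_normal) simp
  define c where "c = (norm \<tau>)\<^sup>2 / 2"
  have "(\<integral>\<^sup>+x. ennreal (exp (x \<bullet> \<tau> - c)) \<partial>multi_normal 0 1) = emeasure (multi_normal \<tau> 1) (space (multi_normal \<tau> 1))"
    unfolding multi_normal_tilt[of \<tau>] c_def by (subst emeasure_density) (auto simp: multi_normal_def)
  also have "\<dots> = 1" by (rule T.emeasure_space_1)
  finally have nn: "(\<integral>\<^sup>+x. ennreal (exp (x \<bullet> \<tau> - c)) \<partial>multi_normal 0 1) = ennreal 1" by simp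
  have i: "integrable (multi_normal 0 1) (\<lambda>x. exp (x \<bullet> \<tau> - c))"
    by (rule integrableI_nn_integral_finite[OF _ _ nn]) auto
  have v: "(\<integral>x. exp (x \<bullet> \<tau> - c) \<partial>multi_normal 0 1) = 1"
    using nn by (subst integral_eq_nn_integral) auto
  have e: "exp (x \<bullet> \<tau>) = exp c * exp (x \<bullet> \<tau> - c)" for x :: "real ^ 'p"
    by (simp add: exp_add[symmetric])
  show "integrable (multi_normal 0 1) (\<lambda>x. exp (x \<bullet> \<tau>))"
    unfolding e using i by simp
  show "(\<integral>x. exp (x \<bullet> \<tau>) \<partial>multi_normal 0 1) = exp ((norm \<tau>)\<^sup>2 / 2)"
    unfolding e using v by (simp add: c_def)
qed

lemma exp_abs_add_le: "exp (\<bar>s\<bar> + \<bar>t\<bar>) \<le> exp (s + t) + exp (s - t) + exp (- s + t) + exp (- s - t :: real)"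
  by (cases "0 \<le> s"; cases "0 \<le> t") (simp_all add: add_nonneg_nonneg)

lemma integrable_gauss_power_exp:
  fixes v \<tau> :: "real ^ 'p::finite"
  shows "integrable (multi_normal 0 1) (\<lambda>x. (x \<bullet> v) ^ i * exp \<bar>x \<bullet> \<tau>\<bar>)"
proof (rule integrable_dominated)
  show "integrable (multi_normal 0 1) (\<lambda>x. fact i * (exp (x \<bullet> (v + \<tau>)) + exp (x \<bullet> (v - \<tau>)) + exp (x \<bullet> (- v + \<tau>)) + exp (x \<bullet> (- v - \<tau>))))"
    by (intro integrable_mult_right Bochner_Integration.integrable_add integrable_gauss_exp)
  fix x :: "real ^ 'p"
  have "\<bar>x \<bullet> v\<bar> ^ i * exp \<bar>x \<bullet> \<tau>\<bar> \<le> fact i * exp \<bar>x \<bullet> v\<bar> * exp \<bar>x \<bullet> \<tau>\<bar>"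
    by (intro mult_right_mono power_le_fact_exp) auto
  also have "\<dots> = fact i * exp (\<bar>x \<bullet> v\<bar> + \<bar>x \<bullet> \<tau>\<bar>)" by (simp add: exp_add)
  also have "\<dots> \<le> fact i * (exp (x \<bullet> (v + \<tau>)) + exp (x \<bullet> (v - \<tau>)) + exp (x \<bullet> (- v + \<tau>)) + exp (x \<bullet> (- v - \<tau>)))"
    using exp_abs_add_le[of "x \<bullet> v" "x \<bullet> \<tau>"] by (intro mult_left_mono) (simp_all add: inner_add_right inner_diff_right)
  finally show "\<bar>(x \<bullet> v) ^ i * exp \<bar>x \<bullet> \<tau>\<bar>\<bar>
      \<le> fact i * (exp (x \<bullet> (v + \<tau>)) + exp (x \<bullet> (v - \<tau>)) + exp (x \<bullet> (- v + \<tau>)) + exp (x \<bullet> (- v - \<tau>)))"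
    by (simp add: abs_mult power_abs)
qed (simp add: measurable_cong_sets[OF sets_multi_normal refl])

text \<open>The Cameron-Martin formula for a standard normal vector.\<close>

lemma integral_gauss_tilt:
  fixes \<tau> :: "real ^ 'p::finite" and f :: "real ^ 'p \<Rightarrow> real"
  assumes [measurable]: "f \<in> borel_measurable borel"
  shows "(\<integral>x. f x * exp (x \<bullet> \<tau>) \<partial>multi_normal 0 1) = exp ((norm \<tau>)\<^sup>2 / 2) * (\<integral>x. f (\<tau> + x) \<partial>multi_normal 0 1)"
proof -
  have "(\<integral>x. f (\<tau> + x) \<partial>multi_normal 0 1) = (\<integral>x. f x \<partial>multi_normal \<tau> 1)"
    using multi_normal_eq_distr[of 1 \<tau>] by (simp add: integral_distr)
  also have "\<dots> = (\<integral>x. exp (x \<bullet> \<tau> - (norm \<tau>)\<^sup>2 / 2) * f x \<partial>multi_normal 0 1)"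
    unfolding multi_normal_tilt[of \<tau>] by (subst integral_density) auto
  also have "\<dots> = (\<integral>x. exp (- ((norm \<tau>)\<^sup>2 / 2)) * (f x * exp (x \<bullet> \<tau>)) \<partial>multi_normal 0 1)"
  proof (intro Bochner_Integration.integral_cong refl)
    fix x
    have "exp (x \<bullet> \<tau> - (norm \<tau>)\<^sup>2 / 2) = exp (- ((norm \<tau>)\<^sup>2 / 2)) * exp (x \<bullet> \<tau>)"
      unfolding exp_add[symmetric] by simp
    then show "exp (x \<bullet> \<tau> - (norm \<tau>)\<^sup>2 / 2) * f x = exp (- ((norm \<tau>)\<^sup>2 / 2)) * (f x * exp (x \<bullet> \<tau>))"
      by simp
  qed
  also have "\<dots> = exp (- ((norm \<tau>)\<^sup>2 / 2)) * (\<integral>x. f x * exp (x \<bullet> \<tau>) \<partial>multi_normal 0 1)"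
    by (rule integral_mult_right_zero)
  finally have "(\<integral>x. f (\<tau> + x) \<partial>multi_normal 0 1)
      = exp (- ((norm \<tau>)\<^sup>2 / 2)) * (\<integral>x. f x * exp (x \<bullet> \<tau>) \<partial>multi_normal 0 1)" .
  then have "exp ((norm \<tau>)\<^sup>2 / 2) * (\<integral>x. f (\<tau> + x) \<partial>multi_normal 0 1)
      = exp ((norm \<tau>)\<^sup>2 / 2) * exp (- ((norm \<tau>)\<^sup>2 / 2)) * (\<integral>x. f x * exp (x \<bullet> \<tau>) \<partial>multi_normal 0 1)"
    by (simp only: mult.assoc)
  also have "exp ((norm \<tau>)\<^sup>2 / 2) * exp (- ((norm \<tau>)\<^sup>2 / 2)) = 1"
    by (simp add: exp_add[symmetric])
  finally show ?thesis by simp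
qed

lemma gauss_exp_moment_sums:
  fixes v \<tau> :: "real ^ 'p::finite"
  shows "(\<lambda>k. (\<integral>x. (x \<bullet> v) ^ i * (x \<bullet> \<tau>) ^ k \<partial>multi_normal 0 1) / fact k * a ^ k)
    sums (\<integral>x. (x \<bullet> v) ^ i * exp (x \<bullet> (a *\<^sub>R \<tau>)) \<partial>multi_normal 0 1)"
proof -
  have "(\<lambda>k. (\<integral>x. (x \<bullet> v) ^ i * (x \<bullet> (a *\<^sub>R \<tau>)) ^ k \<partial>multi_normal 0 1) / fact k)
    sums (\<integral>x. (x \<bullet> v) ^ i * exp (x \<bullet> (a *\<^sub>R \<tau>)) \<partial>multi_normal 0 1)"
    by (rule exp_moment_sums[OF _ _ integrable_gauss_power_exp]) (simp_all add: measurable_cong_sets[OF sets_multi_normal refl])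
  moreover have "(\<integral>x. (x \<bullet> v) ^ i * (x \<bullet> (a *\<^sub>R \<tau>)) ^ k \<partial>multi_normal 0 1)
    = (\<integral>x. a ^ k * ((x \<bullet> v) ^ i * (x \<bullet> \<tau>) ^ k) \<partial>multi_normal 0 1)" for k
    by (simp add: power_mult_distrib mult_ac)
  ultimately show ?thesis by (simp add: mult_ac)
qed

lemma gauss_moment_0:
  fixes \<tau> :: "real ^ 'p::finite"
  shows "(\<integral>x. (x \<bullet> \<tau>) ^ k \<partial>multi_normal 0 1) / fact k = gauss_coeff \<tau> k"
proof (rule power_series_unique)
  show "(\<lambda>k. (\<integral>x. (x \<bullet> \<tau>) ^ k \<partial>multi_normal 0 1) / fact k * a ^ k) sums exp (a\<^sup>2 * (norm \<tau>)\<^sup>2 / 2)" for a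
    using gauss_exp_moment_sums[of 0 0 \<tau> a] integral_gauss_exp[of "a *\<^sub>R \<tau>"]
    by (simp add: power_mult_distrib)
qed (rule gauss_coeff_sums)

lemma integrable_gauss_power:
  fixes v :: "real ^ 'p::finite"
  shows "integrable (multi_normal 0 1) (\<lambda>x. (x \<bullet> v) ^ i)"
  using integrable_gauss_power_exp[of v i 0] by simp

lemma gauss_mean: "(\<integral>x. x \<bullet> v \<partial>multi_normal 0 1) = 0" for v :: "real ^ 'p::finite"
  using gauss_moment_0[of v 1] by (simp add: gauss_coeff_def)

lemma gauss_variance: "(\<integral>x. (x \<bullet> v)\<^sup>2 \<partial>multi_normal 0 1) = (norm v)\<^sup>2" for v :: "real ^ 'p::finite"
  using gauss_moment_0[of v 2] by (simp add: gauss_coeff_def)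

lemma sums_shift_power:
  fixes c :: "nat \<Rightarrow> real"
  assumes "(\<lambda>k. c k * a ^ k) sums S"
  shows "(\<lambda>k. (if k = 0 then 0 else c (k - 1)) * a ^ k) sums (a * S)"
proof -
  have "(\<lambda>k. (if Suc k = 0 then 0 else c (Suc k - 1)) * a ^ Suc k) sums (a * S)"
    using sums_mult[OF assms, of a] by (simp add: mult_ac)
  from sums_Suc[OF this] show ?thesis by simp
qed

text \<open>The shift x -> a \<tau> + x evaluates the generating function as exp(a^2 |\<tau>|^2 / 2)
  a (v . \<tau>); the factor a moves the coefficients by one place.\<close>

lemma gauss_moment_1:
  fixes v \<tau> :: "real ^ 'p::finite"
  shows "(\<integral>x. (x \<bullet> v) * (x \<bullet> \<tau>) ^ k \<partial>multi_normal 0 1) / fact k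
    = (v \<bullet> \<tau>) * (if k = 0 then 0 else gauss_coeff \<tau> (k - 1))"
proof (rule power_series_unique[where c="\<lambda>k. (\<integral>x. (x \<bullet> v) * (x \<bullet> \<tau>) ^ k \<partial>multi_normal 0 1) / fact k"
      and d="\<lambda>k. (v \<bullet> \<tau>) * (if k = 0 then 0 else gauss_coeff \<tau> (k - 1))"])
  interpret prob_space "multi_normal (0 :: real ^ 'p) 1" by (rule prob_space_multi_normal_standard)
  fix a :: real
  have "(\<integral>x. (a *\<^sub>R \<tau> + x) \<bullet> v \<partial>multi_normal 0 1) = (\<integral>x. a * (v \<bullet> \<tau>) + x \<bullet> v \<partial>multi_normal 0 1)"
    by (simp only: inner_add_left inner_scaleR_left inner_commute[of v \<tau>])
  also have "\<dots> = a * (v \<bullet> \<tau>)"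
    using integrable_gauss_power[of v 1] prob_space by (simp add: gauss_mean)
  finally show "(\<lambda>k. (\<integral>x. (x \<bullet> v) * (x \<bullet> \<tau>) ^ k \<partial>multi_normal 0 1) / fact k * a ^ k)
      sums (exp (a\<^sup>2 * (norm \<tau>)\<^sup>2 / 2) * (a * (v \<bullet> \<tau>)))"
    using gauss_exp_moment_sums[of v 1 \<tau> a] integral_gauss_tilt[of "\<lambda>x. x \<bullet> v" "a *\<^sub>R \<tau>"]
    by (simp add: power_mult_distrib)
next
  fix a :: real
  show "(\<lambda>k. (v \<bullet> \<tau>) * (if k = 0 then 0 else gauss_coeff \<tau> (k - 1)) * a ^ k)
      sums (exp (a\<^sup>2 * (norm \<tau>)\<^sup>2 / 2) * (a * (v \<bullet> \<tau>)))"
    using sums_mult[OF sums_shift_power[OF gauss_coeff_sums[of \<tau> a]], of "v \<bullet> \<tau>"] by (simp add: mult_ac)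
qed

text \<open>Here the generating function is exp(a^2 |\<tau>|^2 / 2) ((a (v . \<tau>))^2 + |v|^2).
  The two summands are the origin of the |v|^2 terms and the (v . \<tau>)^2 terms in the quadratic
  form, the latter moved by two places.\<close>

lemma gauss_moment_2:
  fixes v \<tau> :: "real ^ 'p::finite"
  shows "(\<integral>x. (x \<bullet> v)\<^sup>2 * (x \<bullet> \<tau>) ^ k \<partial>multi_normal 0 1) / fact k
    = (norm v)\<^sup>2 * gauss_coeff \<tau> k + (v \<bullet> \<tau>)\<^sup>2 * (if k < 2 then 0 else gauss_coeff \<tau> (k - 2))"
proof (rule power_series_unique[where c="\<lambda>k. (\<integral>x. (x \<bullet> v)\<^sup>2 * (x \<bullet> \<tau>) ^ k \<partial>multi_normal 0 1) / fact k"
      and d="\<lambda>k. (norm v)\<^sup>2 * gauss_coeff \<tau> k + (v \<bullet> \<tau>)\<^sup>2 * (if k < 2 then 0 else gauss_coeff \<tau> (k - 2))"])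
  interpret prob_space "multi_normal (0 :: real ^ 'p) 1" by (rule prob_space_multi_normal_standard)
  fix a :: real
  have "(\<integral>x. ((a *\<^sub>R \<tau> + x) \<bullet> v)\<^sup>2 \<partial>multi_normal 0 1)
    = (\<integral>x. (a * (v \<bullet> \<tau>))\<^sup>2 + (2 * a * (v \<bullet> \<tau>) * (x \<bullet> v) + (x \<bullet> v)\<^sup>2) \<partial>multi_normal 0 1)"
    unfolding inner_add_left inner_scaleR_left inner_commute[of v \<tau>]
    by (intro Bochner_Integration.integral_cong refl) (simp add: power2_sum algebra_simps)
  also have "\<dots> = (a * (v \<bullet> \<tau>))\<^sup>2 + (norm v)\<^sup>2"
    using integrable_gauss_power[of v 1] integrable_gauss_power[of v 2] prob_space
    by (simp add: gauss_mean gauss_variance)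
  finally show "(\<lambda>k. (\<integral>x. (x \<bullet> v)\<^sup>2 * (x \<bullet> \<tau>) ^ k \<partial>multi_normal 0 1) / fact k * a ^ k)
      sums (exp (a\<^sup>2 * (norm \<tau>)\<^sup>2 / 2) * ((a * (v \<bullet> \<tau>))\<^sup>2 + (norm v)\<^sup>2))"
    using gauss_exp_moment_sums[of v 2 \<tau> a] integral_gauss_tilt[of "\<lambda>x. (x \<bullet> v)\<^sup>2" "a *\<^sub>R \<tau>"]
    by (simp add: power_mult_distrib)
next
  fix a :: real
  define E where "E = exp (a\<^sup>2 * (norm \<tau>)\<^sup>2 / 2)"
  have s0: "(\<lambda>k. gauss_coeff \<tau> k * a ^ k) sums E" unfolding E_def by (rule gauss_coeff_sums)
  have "(if k = 0 then 0 else (\<lambda>k. if k = 0 then 0 else gauss_coeff \<tau> (k - 1)) (k - 1))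
      = (if k < 2 then 0 else gauss_coeff \<tau> (k - 2))" for k :: nat
    by (cases k rule: nat.exhaust; cases "k - 1") (auto simp: numeral_2_eq_2)
  then have s2: "(\<lambda>k. (if k < 2 then 0 else gauss_coeff \<tau> (k - 2)) * a ^ k) sums (a * (a * E))"
    using sums_shift_power[OF sums_shift_power[OF s0]] by simp
  have "(\<lambda>k. (norm v)\<^sup>2 * (gauss_coeff \<tau> k * a ^ k) + (v \<bullet> \<tau>)\<^sup>2 * ((if k < 2 then 0 else gauss_coeff \<tau> (k - 2)) * a ^ k))
      sums ((norm v)\<^sup>2 * E + (v \<bullet> \<tau>)\<^sup>2 * (a * (a * E)))"
    by (intro sums_add sums_mult s0 s2)
  moreover have "(norm v)\<^sup>2 * E + (v \<bullet> \<tau>)\<^sup>2 * (a * (a * E)) = E * ((a * (v \<bullet> \<tau>))\<^sup>2 + (norm v)\<^sup>2)"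
    by (simp add: algebra_simps power2_eq_square)
  ultimately show "(\<lambda>k. ((norm v)\<^sup>2 * gauss_coeff \<tau> k + (v \<bullet> \<tau>)\<^sup>2 * (if k < 2 then 0 else gauss_coeff \<tau> (k - 2))) * a ^ k)
      sums (exp (a\<^sup>2 * (norm \<tau>)\<^sup>2 / 2) * ((a * (v \<bullet> \<tau>))\<^sup>2 + (norm v)\<^sup>2))"
    by (simp only: E_def distrib_right mult.assoc)
qed

section \<open>Bounding the quadratic form of the risk reduction\<close>

lemma exp_abs_le: "exp \<bar>t\<bar> \<le> exp t + exp (- t :: real)"
  by (cases "0 \<le> t") (auto simp: abs_if add_increasing add_increasing2)

lemma integrable_base_law_fst:
  fixes f :: "real ^ 'p::finite \<Rightarrow> real"
  assumes n: "0 < n" and int: "integrable (multi_normal 0 1) f"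
  shows "integrable (base_law n) (\<lambda>z. f (fst z))"
proof -
  interpret cn: prob_space "chi_square n" by (rule prob_space_chi_square[OF n])
  interpret G: prob_space "multi_normal (0 :: real ^ 'p) 1" by (rule prob_space_multi_normal_standard)
  have "distr (base_law n) (multi_normal (0 :: real ^ 'p) 1) fst = multi_normal 0 1"
    unfolding base_law_def by (rule cn.distr_pair_fst)
  then have "integrable (distr (base_law n) (multi_normal (0 :: real ^ 'p) 1) fst) f"
    using int by simp
  then show ?thesis
    by (rule integrable_distr[rotated]) (simp add: base_law_def)
qed

lemma norm_power2_eq_sum: "(norm x)\<^sup>2 = (\<Sum>i\<in>UNIV. (x \<bullet> axis i 1)\<^sup>2)" for x :: "real ^ 'p::finite"
  unfolding power2_norm_eq_inner[of x] inner_vec_def[of x x] by (simp add: inner_axis power2_eq_square)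

lemma inner_power2_le: "(x \<bullet> v)\<^sup>2 \<le> (norm v)\<^sup>2 * (norm x)\<^sup>2"
  using Cauchy_Schwarz_ineq[of x v] by (simp add: power2_norm_eq_inner mult.commute)

lemma two_abs_le: "2 * \<bar>t\<bar> \<le> 1 + t\<^sup>2" for t :: real
proof -
  have "0 \<le> (\<bar>t\<bar> - 1)\<^sup>2" by simp
  then show ?thesis by (simp add: power2_eq_square algebra_simps)
qed

text \<open>The square of one coordinate is a weight of degree 2 and mean 1 below the squared norm;
  degree 2 accounts for CARD('p) + 2.\<close>

lemma integrable_ratio_law_square:
  fixes \<psi> :: "real \<Rightarrow> real"
  assumes n: "0 < n" and \<psi>m [measurable]: "\<psi> \<in> borel_measurable borel"
    and fin: "integrable (base_law n) (\<lambda>z :: (real ^ 'p::finite) \<times> real. (\<psi> ((norm (fst z))\<^sup>2 / snd z))\<^sup>2 * (norm (fst z))\<^sup>2)"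
  shows "integrable (ratio_law (CARD('p) + 2) n) (\<lambda>w. (\<psi> w)\<^sup>2)"
proof -
  fix i :: 'p
  define u where "u = (axis i 1 :: real ^ 'p)"
  have nu: "norm u = 1" by (simp add: u_def)
  have "integrable (base_law n) (\<lambda>z. (fst z \<bullet> u)\<^sup>2 * (\<psi> ((norm (fst z))\<^sup>2 / snd z))\<^sup>2)"
  proof (rule integrable_dominated[OF fin])
    fix z :: "(real ^ 'p) \<times> real"
    have "(fst z \<bullet> u)\<^sup>2 * (\<psi> ((norm (fst z))\<^sup>2 / snd z))\<^sup>2 \<le> (norm (fst z))\<^sup>2 * (\<psi> ((norm (fst z))\<^sup>2 / snd z))\<^sup>2"
      using inner_power2_le[of "fst z" u] nu by (intro mult_right_mono) auto
    then show "\<bar>(fst z \<bullet> u)\<^sup>2 * (\<psi> ((norm (fst z))\<^sup>2 / snd z))\<^sup>2\<bar> \<le> (\<psi> ((norm (fst z))\<^sup>2 / snd z))\<^sup>2 * (norm (fst z))\<^sup>2"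
      by (simp add: mult.commute)
  qed measurable
  then have "integrable (ratio_law (CARD('p) + 2) n) (\<lambda>w. (\<integral>x. (x \<bullet> u)\<^sup>2 \<partial>multi_normal 0 1) * (\<psi> w)\<^sup>2)"
    by (subst (asm) integrable_homogeneous_nonneg[OF n, where q="\<lambda>x. (x \<bullet> u)\<^sup>2" and F="\<lambda>w. (\<psi> w)\<^sup>2" and d=2])
       (auto simp: power_mult_distrib integrable_gauss_power)
  then show ?thesis by (simp add: gauss_variance nu)
qed

text \<open>With e_k the Gaussian coefficients, (x . v)^2 contributes |v|^2 e_k, to be paired with
  \<open>B\<close>, and (v . \<tau>)^2 e_(k-2). The cross term contributes -(v . \<tau>)^2 e_(k-2)
  times the mean of 2 \<psi> with two fewer degrees of freedom, so the (v . \<tau>)^2 terms together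
  are nonpositive by monotonicity in the degrees of freedom.\<close>

lemma noncentral_quadratic_form_le:
  fixes \<psi> :: "real \<Rightarrow> real" and \<tau> v :: "real ^ 'p::finite"
  assumes n: "0 < n" and \<psi>m [measurable]: "\<psi> \<in> borel_measurable borel"
    and fin: "\<And>\<tau> :: real ^ 'p. integrable (base_law n)
      (\<lambda>z. (\<psi> ((norm (fst z))\<^sup>2 / snd z))\<^sup>2 * (norm (fst z))\<^sup>2 * exp (fst z \<bullet> \<tau>))"
    and B: "\<And>j. integral\<^sup>L (ratio_law (CARD('p) + 2 * j + 2) n) (\<lambda>w. 2 * \<psi> w - (\<psi> w)\<^sup>2) \<le> B"
    and anti: "antimono_on {0<..} (\<lambda>w. w powr (real n / 2) * (LINT t:{w<..}|lborel. t powr (- (real n / 2)) * (\<psi> t / t)))"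
  defines "W \<equiv> \<lambda>z :: (real ^ 'p) \<times> real. (norm (fst z))\<^sup>2 / snd z"
  shows "integrable (base_law n) (\<lambda>z. (2 * \<psi> (W z) * ((fst z \<bullet> v) * (fst z \<bullet> v - \<tau> \<bullet> v)) - (\<psi> (W z))\<^sup>2 * (fst z \<bullet> v)\<^sup>2) * exp (fst z \<bullet> \<tau>))" (is ?I)
    and "(\<integral>z. (2 * \<psi> (W z) * ((fst z \<bullet> v) * (fst z \<bullet> v - \<tau> \<bullet> v)) - (\<psi> (W z))\<^sup>2 * (fst z \<bullet> v)\<^sup>2) * exp (fst z \<bullet> \<tau>) \<partial>base_law n)
      \<le> (norm v)\<^sup>2 * B * exp ((norm \<tau>)\<^sup>2 / 2)" (is ?L)
proof -
  interpret base: prob_space "base_law n :: ((real ^ 'p) \<times> real) measure" by (rule prob_space_base_law[OF n])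
  have [measurable]: "W \<in> borel_measurable (base_law n)" unfolding W_def by measurable
  have fin: "integrable (base_law n) (\<lambda>z. (\<psi> (W z))\<^sup>2 * (norm (fst z))\<^sup>2 * exp (fst z \<bullet> \<tau>))" for \<tau> :: "real ^ 'p"
    unfolding W_def by (rule fin)
  define F where "F w = 2 * \<psi> w - (\<psi> w)\<^sup>2" for w
  have [measurable]: "F \<in> borel_measurable borel" unfolding F_def by measurable
  define E where "E N f = integral\<^sup>L (ratio_law N n) f" for N and f :: "real \<Rightarrow> real"
  let ?p = "CARD('p)"

  have i0: "integrable (base_law n) (\<lambda>z :: (real ^ 'p) \<times> real. exp \<bar>fst z \<bullet> \<tau>\<bar>)"
    using integrable_base_law_fst[OF n integrable_gauss_power_exp[of 0 0 \<tau>]] by simp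
  have i1: "integrable (base_law n) (\<lambda>z :: (real ^ 'p) \<times> real. (norm (fst z))\<^sup>2 * exp \<bar>fst z \<bullet> \<tau>\<bar>)"
  proof -
    have "integrable (multi_normal 0 1) (\<lambda>x :: real ^ 'p. \<Sum>i\<in>UNIV. (x \<bullet> axis i 1)\<^sup>2 * exp \<bar>x \<bullet> \<tau>\<bar>)"
      by (intro Bochner_Integration.integrable_sum integrable_gauss_power_exp)
    from integrable_base_law_fst[OF n this] show ?thesis
      by (simp add: norm_power2_eq_sum sum_distrib_right)
  qed
  have i2: "integrable (base_law n) (\<lambda>z. (\<psi> (W z))\<^sup>2 * (norm (fst z))\<^sup>2 * exp \<bar>fst z \<bullet> \<tau>\<bar>)"
  proof (rule integrable_dominated[OF Bochner_Integration.integrable_add[OF fin[of \<tau>] fin[of "- \<tau>"]]])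
    fix z :: "(real ^ 'p) \<times> real"
    have "(\<psi> (W z))\<^sup>2 * (norm (fst z))\<^sup>2 * exp \<bar>fst z \<bullet> \<tau>\<bar>
        \<le> (\<psi> (W z))\<^sup>2 * (norm (fst z))\<^sup>2 * (exp (fst z \<bullet> \<tau>) + exp (- (fst z \<bullet> \<tau>)))"
      by (intro mult_left_mono exp_abs_le) simp
    then show "\<bar>(\<psi> (W z))\<^sup>2 * (norm (fst z))\<^sup>2 * exp \<bar>fst z \<bullet> \<tau>\<bar>\<bar>
        \<le> (\<psi> (W z))\<^sup>2 * (norm (fst z))\<^sup>2 * exp (fst z \<bullet> \<tau>) + (\<psi> (W z))\<^sup>2 * (norm (fst z))\<^sup>2 * exp (fst z \<bullet> - \<tau>)"
      by (simp add: distrib_left)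
  qed measurable
  \<comment> \<open>Exponential moments are given only for the square of \<open>\<psi>\<close> times
    the squared norm; what is linear in \<open>\<psi>\<close> is absorbed by 2 |t| <= 1 + t^2, here
    and in \<open>dom2\<close>.\<close>
  have dom1: "integrable (base_law n) (\<lambda>z. F (W z) * (fst z \<bullet> v)\<^sup>2 * exp \<bar>fst z \<bullet> \<tau>\<bar>)"
  proof (rule integrable_dominated)
    show "integrable (base_law n) (\<lambda>z. (norm v)\<^sup>2 * ((norm (fst z))\<^sup>2 * exp \<bar>fst z \<bullet> \<tau>\<bar> + 2 * ((\<psi> (W z))\<^sup>2 * (norm (fst z))\<^sup>2 * exp \<bar>fst z \<bullet> \<tau>\<bar>)))"
      by (intro integrable_mult_right Bochner_Integration.integrable_add i1 i2)
    fix z :: "(real ^ 'p) \<times> real"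
    have "\<bar>F (W z)\<bar> \<le> 1 + 2 * (\<psi> (W z))\<^sup>2"
      unfolding F_def abs_le_iff
      using two_abs_le[of "\<psi> (W z)"] zero_le_power2[of "\<psi> (W z)"] abs_ge_self[of "\<psi> (W z)"] abs_ge_minus_self[of "\<psi> (W z)"]
      by (intro conjI; linarith)
    then have "\<bar>F (W z)\<bar> * (fst z \<bullet> v)\<^sup>2 \<le> (1 + 2 * (\<psi> (W z))\<^sup>2) * ((norm v)\<^sup>2 * (norm (fst z))\<^sup>2)"
      by (intro mult_mono inner_power2_le) auto
    then have "\<bar>F (W z)\<bar> * (fst z \<bullet> v)\<^sup>2 * exp \<bar>fst z \<bullet> \<tau>\<bar> \<le> (1 + 2 * (\<psi> (W z))\<^sup>2) * ((norm v)\<^sup>2 * (norm (fst z))\<^sup>2) * exp \<bar>fst z \<bullet> \<tau>\<bar>"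
      by (intro mult_right_mono) auto
    then show "\<bar>F (W z) * (fst z \<bullet> v)\<^sup>2 * exp \<bar>fst z \<bullet> \<tau>\<bar>\<bar>
        \<le> (norm v)\<^sup>2 * ((norm (fst z))\<^sup>2 * exp \<bar>fst z \<bullet> \<tau>\<bar> + 2 * ((\<psi> (W z))\<^sup>2 * (norm (fst z))\<^sup>2 * exp \<bar>fst z \<bullet> \<tau>\<bar>))"
      by (simp add: abs_mult algebra_simps)
  qed measurable
  have dom2: "integrable (base_law n) (\<lambda>z. 2 * \<psi> (W z) * (fst z \<bullet> v) * exp \<bar>fst z \<bullet> \<tau>\<bar>)"
  proof (rule integrable_dominated)
    show "integrable (base_law n) (\<lambda>z. exp \<bar>fst z \<bullet> \<tau>\<bar> + (norm v)\<^sup>2 * ((\<psi> (W z))\<^sup>2 * (norm (fst z))\<^sup>2 * exp \<bar>fst z \<bullet> \<tau>\<bar>))"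
      by (intro integrable_mult_right Bochner_Integration.integrable_add i0 i2)
    fix z :: "(real ^ 'p) \<times> real"
    have "2 * \<bar>\<psi> (W z) * (fst z \<bullet> v)\<bar> \<le> 1 + (\<psi> (W z))\<^sup>2 * (fst z \<bullet> v)\<^sup>2"
      using two_abs_le[of "\<psi> (W z) * (fst z \<bullet> v)"] by (simp add: power_mult_distrib)
    also have "\<dots> \<le> 1 + (\<psi> (W z))\<^sup>2 * ((norm v)\<^sup>2 * (norm (fst z))\<^sup>2)"
      by (intro add_left_mono mult_left_mono inner_power2_le) simp
    finally have "2 * \<bar>\<psi> (W z) * (fst z \<bullet> v)\<bar> * exp \<bar>fst z \<bullet> \<tau>\<bar> \<le> (1 + (\<psi> (W z))\<^sup>2 * ((norm v)\<^sup>2 * (norm (fst z))\<^sup>2)) * exp \<bar>fst z \<bullet> \<tau>\<bar>"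
      by (intro mult_right_mono) auto
    then show "\<bar>2 * \<psi> (W z) * (fst z \<bullet> v) * exp \<bar>fst z \<bullet> \<tau>\<bar>\<bar>
        \<le> exp \<bar>fst z \<bullet> \<tau>\<bar> + (norm v)\<^sup>2 * ((\<psi> (W z))\<^sup>2 * (norm (fst z))\<^sup>2 * exp \<bar>fst z \<bullet> \<tau>\<bar>)"
      by (simp add: abs_mult algebra_simps)
  qed measurable

  have r2: "integrable (ratio_law (?p + 2) n) (\<lambda>w. (\<psi> w)\<^sup>2)"
    using fin[of 0] by (intro integrable_ratio_law_square[OF n \<psi>m]) (simp add: W_def)
  interpret R2: prob_space "ratio_law (?p + 2) n" by (rule prob_space_ratio_law) (use n in auto)
  have r1: "integrable (ratio_law (?p + 2) n) \<psi>"
    by (rule R2.square_integrable_imp_integrable[OF _ r2]) (simp add: measurable_cong_sets[OF sets_ratio_law refl])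
  have r: "integrable (ratio_law N n) \<psi>" "integrable (ratio_law N n) (\<lambda>w. (\<psi> w)\<^sup>2)" if "?p + 2 \<le> N" for N
    using ratio_law_integrable_mono[OF _ that n _ r1] ratio_law_integrable_mono[OF _ that n _ r2] by simp_all
  \<comment> \<open>The square is dropped first, so only the mean of \<open>\<psi>\<close> itself
    has to be monotone.\<close>
  have Emono: "E (N + 2) F \<le> E N (\<lambda>w. 2 * \<psi> w)" if N: "?p + 2 \<le> N" for N
  proof -
    have N2: "?p + 2 \<le> N + 2" using N by simp
    have "E (N + 2) F = integral\<^sup>L (ratio_law (N + 2) n) (\<lambda>w. 2 * \<psi> w) - integral\<^sup>L (ratio_law (N + 2) n) (\<lambda>w. (\<psi> w)\<^sup>2)"
      unfolding E_def F_def using r[OF N2] by (subst Bochner_Integration.integral_diff) auto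
    also have "\<dots> \<le> 2 * integral\<^sup>L (ratio_law (N + 2) n) \<psi>"
      by (simp add: integral_nonneg_AE)
    also have "\<dots> \<le> 2 * integral\<^sup>L (ratio_law N n) \<psi>"
      using integral_ratio_law_antimono(2)[OF _ n \<psi>m r(1)[OF N] anti] N by simp
    finally show ?thesis by (simp add: E_def)
  qed

  define e where "e = gauss_coeff \<tau>"
  have e0: "0 \<le> e k" for k by (simp add: e_def)
  define \<Psi> where "\<Psi> k = E (?p + 2 + k) F" for k
  define u where "u k = e k * E (?p + 2 + k) (\<lambda>w. 2 * \<psi> w)" for k
  define I1 where "I1 = (\<integral>z. F (W z) * (fst z \<bullet> v)\<^sup>2 * exp (fst z \<bullet> \<tau>) \<partial>base_law n)"
  define I2 where "I2 = (\<integral>z. 2 * \<psi> (W z) * (fst z \<bullet> v) * exp (fst z \<bullet> \<tau>) \<partial>base_law n)"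
  define a where "a = v \<bullet> \<tau>"
  have S1: "(\<lambda>k. ((norm v)\<^sup>2 * e k + a\<^sup>2 * (if k < 2 then 0 else e (k - 2))) * \<Psi> k) sums I1"
    using noncentral_series[OF n, of "\<lambda>x. (x \<bullet> v)\<^sup>2" 2 \<tau> F] dom1
    unfolding gauss_moment_2 I1_def \<Psi>_def E_def e_def a_def W_def
    by (simp add: power_mult_distrib integrable_gauss_power_exp)
  have "(\<lambda>k. (a * (if k = 0 then 0 else e (k - 1))) * E (?p + 1 + k) (\<lambda>w. 2 * \<psi> w)) sums I2"
    using noncentral_series[OF n, of "\<lambda>x. x \<bullet> v" 1 \<tau> "\<lambda>w. 2 * \<psi> w"] dom2 integrable_gauss_power_exp[of v 1 \<tau>]
    unfolding gauss_moment_1 I2_def E_def e_def a_def W_def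
    by simp
  \<comment> \<open>The linear factor x . v has degree 1 and its moments vanish at k = 0. Reindexing
    by one place turns the degrees of freedom p + 1 + k into p + 2 + k.\<close>
  moreover define f where "f k = (a * (if k = 0 then 0 else e (k - 1))) * E (?p + 1 + k) (\<lambda>w. 2 * \<psi> w)" for k
  ultimately have "f sums (I2 + f 0)" by (simp add: f_def[abs_def])
  then have "(\<lambda>k. f (Suc k)) sums I2" by (subst sums_Suc_iff)
  then have "(\<lambda>k. a * u k) sums I2" by (simp add: f_def u_def mult_ac)
  then have "(\<lambda>k. a * (a * u k)) sums (a * I2)" by (rule sums_mult)
  then have S2: "(\<lambda>k. a\<^sup>2 * u k * 1 ^ k) sums (a * I2)" by (simp add: power2_eq_square mult_ac)
  \<comment> \<open>The shift lemma at the point 1 delays the series by two terms, so that it faces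
    the e_(k-2) terms of \<open>S1\<close> index by index.\<close>
  have "(\<lambda>k. (if k = 0 then 0 else (if k - 1 = 0 then 0 else a\<^sup>2 * u (k - 1 - 1))) * 1 ^ k) sums (1 * (1 * (a * I2)))"
    by (rule sums_shift_power, rule sums_shift_power, rule S2)
  moreover have "(\<lambda>k. (if k = 0 then 0 else (if k - 1 = 0 then 0 else a\<^sup>2 * u (k - 1 - 1))) * 1 ^ k)
      = (\<lambda>k. if k < 2 then 0 else a\<^sup>2 * u (k - 2))"
    by (rule ext) (auto simp: numeral_2_eq_2)
  ultimately have S3: "(\<lambda>k. if k < 2 then 0 else a\<^sup>2 * u (k - 2)) sums (a * I2)" by simp
  have S4: "(\<lambda>k. (norm v)\<^sup>2 * B * e k + (if k < 2 then 0 else a\<^sup>2 * u (k - 2))) sums ((norm v)\<^sup>2 * B * exp ((norm \<tau>)\<^sup>2 / 2) + a * I2)"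
    using gauss_coeff_sums[of \<tau> 1] by (intro sums_add sums_mult S3) (simp add: e_def)
  have "I1 \<le> (norm v)\<^sup>2 * B * exp ((norm \<tau>)\<^sup>2 / 2) + a * I2"
  proof (rule sums_le[OF _ S1 S4])
    fix k
    \<comment> \<open>Odd coefficients vanish, so \<open>B\<close> is needed only for p + 2j + 2
      degrees of freedom, the only case its hypothesis covers.\<close>
    have "e k * \<Psi> k \<le> e k * B"
    proof (cases "even k")
      case True
      then obtain j where "k = 2 * j" by (elim evenE)
      then have "\<Psi> k \<le> B" using B[of j] by (simp add: \<Psi>_def E_def F_def[abs_def] add_ac)
      then show ?thesis using e0 by (intro mult_left_mono)
    qed (simp add: e_def gauss_coeff_def)
    then have 1: "(norm v)\<^sup>2 * (e k * \<Psi> k) \<le> (norm v)\<^sup>2 * (e k * B)" by (rule mult_left_mono) simp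
    have 2: "a\<^sup>2 * (e (k - 2) * \<Psi> k) \<le> a\<^sup>2 * u (k - 2)" if "\<not> k < 2"
    proof -
      have "\<Psi> k \<le> E (?p + 2 + (k - 2)) (\<lambda>w. 2 * \<psi> w)"
      proof -
        have "?p + 2 + k = ?p + k + 2" "?p + 2 + (k - 2) = ?p + k" "?p + 2 \<le> ?p + k" using that by auto
        then show ?thesis using Emono[of "?p + k"] unfolding \<Psi>_def by metis
      qed
      then show ?thesis unfolding u_def using e0 by (intro mult_left_mono) auto
    qed
    show "((norm v)\<^sup>2 * e k + a\<^sup>2 * (if k < 2 then 0 else e (k - 2))) * \<Psi> k
        \<le> (norm v)\<^sup>2 * B * e k + (if k < 2 then 0 else a\<^sup>2 * u (k - 2))"
      using 1 2 by (cases "k < 2") (simp_all add: algebra_simps)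
  qed
  moreover have "integrable (base_law n) (\<lambda>z. F (W z) * (fst z \<bullet> v)\<^sup>2 * exp (fst z \<bullet> \<tau>))"
    by (rule Bochner_Integration.integrable_bound[OF dom1]) (auto simp: abs_mult intro!: mult_left_mono)
  moreover have "integrable (base_law n) (\<lambda>z. 2 * \<psi> (W z) * (fst z \<bullet> v) * exp (fst z \<bullet> \<tau>))"
    by (rule Bochner_Integration.integrable_bound[OF dom2]) (auto simp: abs_mult intro!: mult_left_mono)
  moreover have eq: "(2 * \<psi> (W z) * ((fst z \<bullet> v) * (fst z \<bullet> v - \<tau> \<bullet> v)) - (\<psi> (W z))\<^sup>2 * (fst z \<bullet> v)\<^sup>2) * exp (fst z \<bullet> \<tau>)
    = F (W z) * (fst z \<bullet> v)\<^sup>2 * exp (fst z \<bullet> \<tau>) - a * (2 * \<psi> (W z) * (fst z \<bullet> v) * exp (fst z \<bullet> \<tau>))" for z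
    by (simp add: F_def a_def inner_commute algebra_simps power2_eq_square)
  ultimately show ?I ?L
    unfolding eq by (simp_all add: I1_def I2_def)
qed

section \<open>Scaling and translating the sample\<close>

lemma multi_normal_scale:
  fixes \<theta> :: "real ^ 'p::finite"
  assumes s: "0 < \<sigma>"
  shows "multi_normal \<theta> (\<sigma>\<^sup>2) = distr (multi_normal ((1 / \<sigma>) *\<^sub>R \<theta>) 1) borel (\<lambda>x. \<sigma> *\<^sub>R x)"
proof -
  have "distr (multi_normal ((1 / \<sigma>) *\<^sub>R \<theta>) 1) borel (\<lambda>x. \<sigma> *\<^sub>R x)
    = distr (distr (multi_normal 0 1) borel (\<lambda>x. (1 / \<sigma>) *\<^sub>R \<theta> + 1 *\<^sub>R x)) borel (\<lambda>x. \<sigma> *\<^sub>R x)"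
    using multi_normal_eq_distr[of 1 "(1 / \<sigma>) *\<^sub>R \<theta>"] by simp
  also have "\<dots> = distr (multi_normal 0 1) borel ((\<lambda>x. \<sigma> *\<^sub>R x) \<circ> (\<lambda>x. (1 / \<sigma>) *\<^sub>R \<theta> + 1 *\<^sub>R x))"
    by (rule distr_distr) auto
  also have "(\<lambda>x. \<sigma> *\<^sub>R x) \<circ> (\<lambda>x. (1 / \<sigma>) *\<^sub>R \<theta> + 1 *\<^sub>R x) = (\<lambda>x. \<theta> + \<sigma> *\<^sub>R x)"
    using s by (auto simp: fun_eq_iff scaleR_add_right)
  finally show ?thesis using multi_normal_eq_distr[OF s, of \<theta>] by simp
qed

lemma measurable_chi_square_scale:
  assumes "0 < c"
  shows "(\<lambda>v. c * v) \<in> chi_square n \<rightarrow>\<^sub>M restrict_space borel {0<..}"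
  by (rule measurable_restrict_space2) (use assms in auto)

lemma sets_scaled_chi_square [simp, measurable_cong]: "sets (scaled_chi_square v n) = sets (restrict_space borel {0<..})"
  and space_scaled_chi_square [simp]: "space (scaled_chi_square v n) = {0<..}"
  by (simp_all add: scaled_chi_square_def space_restrict_space)

lemma prob_space_scaled_chi_square:
  assumes "0 < v" "0 < n"
  shows "prob_space (scaled_chi_square v n)"
proof -
  interpret prob_space "chi_square n" by (rule prob_space_chi_square[OF assms(2)])
  show ?thesis unfolding scaled_chi_square_def
    by (rule prob_space_distr) (rule measurable_chi_square_scale[OF assms(1)])
qed

lemma measurable_sample_law_fst [measurable]: "fst \<in> borel_measurable (sample_law n \<theta> v)"
  unfolding sample_law_def by measurable

lemma measurable_sample_law_snd [measurable]: "snd \<in> borel_measurable (sample_law n \<theta> v)"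
proof -
  have "(\<lambda>x. x) \<in> borel_measurable (scaled_chi_square v n)"
    by (subst measurable_cong_sets[OF sets_scaled_chi_square refl]) (rule measurable_restrict_space1, simp)
  then have "(\<lambda>z. snd z) \<in> borel_measurable (multi_normal \<theta> v \<Otimes>\<^sub>M scaled_chi_square v n)"
    by (rule measurable_compose[OF measurable_snd])
  then show ?thesis by (simp add: sample_law_def)
qed

lemma space_sample_law [simp]: "space (sample_law n \<theta> v) = UNIV \<times> {0<..}"
  by (simp add: sample_law_def space_pair_measure)

lemma prob_space_sample_law:
  fixes \<theta> :: "real ^ 'p::finite"
  assumes "0 < v" "0 < n"
  shows "prob_space (sample_law n \<theta> v)"
proof -
  interpret S: prob_space "scaled_chi_square v n" by (rule prob_space_scaled_chi_square[OF assms])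
  interpret M: prob_space "multi_normal \<theta> v" by (rule prob_space_multi_normal[OF assms(1)])
  interpret P: pair_prob_space "multi_normal \<theta> v" "scaled_chi_square v n" ..
  show ?thesis unfolding sample_law_def by (rule P.prob_space_axioms)
qed

text \<open>W is invariant under scaling X by \<sigma> and S by its square, and the tilt carries the
  mean \<tau> = \<theta> / \<sigma>. Every expectation thus becomes one under the parameter-free
  \<open>base_law\<close> with weight exp(x . \<tau>).\<close>

lemma sample_law_eq_distr:
  fixes \<theta> :: "real ^ 'p::finite"
  assumes s: "0 < \<sigma>" and n: "0 < n"
  defines "\<tau> \<equiv> (1 / \<sigma>) *\<^sub>R \<theta>"
  shows "sample_law n \<theta> (\<sigma>\<^sup>2) = distr (density (base_law n) (\<lambda>z. ennreal (exp (fst z \<bullet> \<tau> - (norm \<tau>)\<^sup>2 / 2))))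
      (sample_law n \<theta> (\<sigma>\<^sup>2)) (\<lambda>z. (\<sigma> *\<^sub>R fst z, \<sigma>\<^sup>2 * snd z))"
    and measurable_sample_law_scale: "(\<lambda>z :: (real ^ 'p) \<times> real. (\<sigma> *\<^sub>R fst z, \<sigma>\<^sup>2 * snd z)) \<in> base_law n \<rightarrow>\<^sub>M sample_law n \<theta> (\<sigma>\<^sup>2)"
proof -
  interpret c: prob_space "chi_square n" by (rule prob_space_chi_square[OF n])
  have s2: "0 < \<sigma>\<^sup>2" using s by simp
  have sc: "sigma_finite_measure (distr (chi_square n) (restrict_space borel {0<..}) (\<lambda>v. \<sigma>\<^sup>2 * v))"
    using prob_space_scaled_chi_square[OF s2 n] unfolding scaled_chi_square_def
    by (intro finite_measure.axioms prob_space.axioms)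
  have sets: "sets (sample_law n \<theta> (\<sigma>\<^sup>2)) = sets (borel \<Otimes>\<^sub>M restrict_space borel {0<..})"
    unfolding sample_law_def by (rule sets_pair_measure_cong) auto
  have tilt: "density (base_law n) (\<lambda>z. ennreal (exp (fst z \<bullet> \<tau> - (norm \<tau>)\<^sup>2 / 2))) = multi_normal \<tau> 1 \<Otimes>\<^sub>M chi_square n"
  proof -
    have d1: "density (chi_square n) (\<lambda>_. 1) = chi_square n" by (rule density_1)
    have "multi_normal \<tau> 1 \<Otimes>\<^sub>M density (chi_square n) (\<lambda>_. 1)
      = density (multi_normal 0 1 \<Otimes>\<^sub>M chi_square n) (\<lambda>(x, y). ennreal (exp (x \<bullet> \<tau> - (norm \<tau>)\<^sup>2 / 2)) * 1)"
      unfolding multi_normal_tilt[of \<tau>]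
      by (rule pair_measure_density) (auto simp: d1 c.sigma_finite_measure_axioms)
    then show ?thesis by (simp add: d1 base_law_def case_prod_unfold)
  qed
  have "sample_law n \<theta> (\<sigma>\<^sup>2) = distr (multi_normal \<tau> 1) borel (\<lambda>x. \<sigma> *\<^sub>R x) \<Otimes>\<^sub>M distr (chi_square n) (restrict_space borel {0<..}) (\<lambda>v. \<sigma>\<^sup>2 * v)"
    unfolding sample_law_def scaled_chi_square_def \<tau>_def by (simp only: multi_normal_scale[OF s])
  also have "\<dots> = distr (multi_normal \<tau> 1 \<Otimes>\<^sub>M chi_square n) (borel \<Otimes>\<^sub>M restrict_space borel {0<..}) (\<lambda>(x, y). (\<sigma> *\<^sub>R x, \<sigma>\<^sup>2 * y))"
    by (rule pair_measure_distr[OF _ measurable_chi_square_scale[OF s2] sc]) measurable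
  also have "\<dots> = distr (density (base_law n) (\<lambda>z. ennreal (exp (fst z \<bullet> \<tau> - (norm \<tau>)\<^sup>2 / 2))))
      (sample_law n \<theta> (\<sigma>\<^sup>2)) (\<lambda>z. (\<sigma> *\<^sub>R fst z, \<sigma>\<^sup>2 * snd z))"
    unfolding tilt[symmetric] by (rule distr_cong) (auto simp: sets)
  finally show "sample_law n \<theta> (\<sigma>\<^sup>2) = distr (density (base_law n) (\<lambda>z. ennreal (exp (fst z \<bullet> \<tau> - (norm \<tau>)\<^sup>2 / 2))))
      (sample_law n \<theta> (\<sigma>\<^sup>2)) (\<lambda>z. (\<sigma> *\<^sub>R fst z, \<sigma>\<^sup>2 * snd z))" .
  have "(\<lambda>z :: (real ^ 'p) \<times> real. (\<sigma> *\<^sub>R fst z, \<sigma>\<^sup>2 * snd z)) \<in> base_law n \<rightarrow>\<^sub>M borel \<Otimes>\<^sub>M restrict_space borel {0<..}"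
  proof (rule measurable_Pair)
    show "(\<lambda>z :: (real ^ 'p) \<times> real. \<sigma> *\<^sub>R fst z) \<in> borel_measurable (base_law n)" by measurable
    show "(\<lambda>z :: (real ^ 'p) \<times> real. \<sigma>\<^sup>2 * snd z) \<in> base_law n \<rightarrow>\<^sub>M restrict_space borel {0<..}"
      unfolding base_law_def
      by (rule measurable_compose[OF measurable_snd measurable_chi_square_scale[OF s2]])
  qed
  then show "(\<lambda>z :: (real ^ 'p) \<times> real. (\<sigma> *\<^sub>R fst z, \<sigma>\<^sup>2 * snd z)) \<in> base_law n \<rightarrow>\<^sub>M sample_law n \<theta> (\<sigma>\<^sup>2)"
    by (subst measurable_cong_sets[OF refl sets])
qed

lemma
  fixes \<theta> :: "real ^ 'p::finite" and f :: "(real ^ 'p) \<times> real \<Rightarrow> real"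
  assumes s: "0 < \<sigma>" and n: "0 < n" and f: "f \<in> borel_measurable (sample_law n \<theta> (\<sigma>\<^sup>2))"
  defines "\<tau> \<equiv> (1 / \<sigma>) *\<^sub>R \<theta>"
  shows integrable_sample_law_iff: "integrable (sample_law n \<theta> (\<sigma>\<^sup>2)) f
      \<longleftrightarrow> integrable (base_law n) (\<lambda>z. f (\<sigma> *\<^sub>R fst z, \<sigma>\<^sup>2 * snd z) * exp (fst z \<bullet> \<tau>))" (is ?A)
    and integral_sample_law: "integral\<^sup>L (sample_law n \<theta> (\<sigma>\<^sup>2)) f
      = exp (- ((norm \<tau>)\<^sup>2 / 2)) * (\<integral>z. f (\<sigma> *\<^sub>R fst z, \<sigma>\<^sup>2 * snd z) * exp (fst z \<bullet> \<tau>) \<partial>base_law n)" (is ?B)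
proof -
  let ?T = "\<lambda>z :: (real ^ 'p) \<times> real. (\<sigma> *\<^sub>R fst z, \<sigma>\<^sup>2 * snd z)"
  let ?e = "\<lambda>z :: (real ^ 'p) \<times> real. exp (fst z \<bullet> \<tau> - (norm \<tau>)\<^sup>2 / 2)"
  note eq = sample_law_eq_distr[OF s n, of \<theta>, folded \<tau>_def]
  have T: "?T \<in> base_law n \<rightarrow>\<^sub>M sample_law n \<theta> (\<sigma>\<^sup>2)" by (rule measurable_sample_law_scale[OF s n])
  have T': "?T \<in> density (base_law n) (\<lambda>z. ennreal (?e z)) \<rightarrow>\<^sub>M sample_law n \<theta> (\<sigma>\<^sup>2)" using T by simp
  have fT: "(\<lambda>z. f (?T z)) \<in> borel_measurable (base_law n)" by (rule measurable_compose[OF T f])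
  have e: "?e z * c = exp (- ((norm \<tau>)\<^sup>2 / 2)) * (c * exp (fst z \<bullet> \<tau>))" for z c
  proof -
    have "?e z = exp (- ((norm \<tau>)\<^sup>2 / 2)) * exp (fst z \<bullet> \<tau>)" unfolding exp_add[symmetric] by simp
    then show ?thesis by simp
  qed
  have "integrable (sample_law n \<theta> (\<sigma>\<^sup>2)) f \<longleftrightarrow> integrable (distr (density (base_law n) (\<lambda>z. ennreal (?e z))) (sample_law n \<theta> (\<sigma>\<^sup>2)) ?T) f"
    using eq by simp
  also have "\<dots> \<longleftrightarrow> integrable (density (base_law n) (\<lambda>z. ennreal (?e z))) (\<lambda>z. f (?T z))"
    by (rule integrable_distr_eq[OF T' f])
  also have "\<dots> \<longleftrightarrow> integrable (base_law n) (\<lambda>z. ?e z *\<^sub>R f (?T z))"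
    by (rule integrable_density[OF fT]) auto
  finally show ?A by (simp add: e)
  have "integral\<^sup>L (sample_law n \<theta> (\<sigma>\<^sup>2)) f = integral\<^sup>L (distr (density (base_law n) (\<lambda>z. ennreal (?e z))) (sample_law n \<theta> (\<sigma>\<^sup>2)) ?T) f"
    using eq by simp
  also have "\<dots> = integral\<^sup>L (density (base_law n) (\<lambda>z. ennreal (?e z))) (\<lambda>z. f (?T z))"
    by (rule integral_distr[OF T' f])
  also have "\<dots> = (\<integral>z. ?e z *\<^sub>R f (?T z) \<partial>base_law n)"
    by (rule integral_density[OF fT]) auto
  finally show ?B by (simp add: e)
qed

lemma
  fixes \<theta> v :: "real ^ 'p::finite"
  assumes s: "0 < \<sigma>" and n: "0 < n"
  shows integrable_sample_law_inner: "integrable (sample_law n \<theta> (\<sigma>\<^sup>2)) (\<lambda>z. ((fst z - \<theta>) \<bullet> v)\<^sup>2)"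
    and integral_sample_law_inner: "(\<integral>z. ((fst z - \<theta>) \<bullet> v)\<^sup>2 \<partial>sample_law n \<theta> (\<sigma>\<^sup>2)) = \<sigma>\<^sup>2 * (norm v)\<^sup>2"
proof -
  have s2: "0 < \<sigma>\<^sup>2" using s by simp
  interpret S: prob_space "scaled_chi_square (\<sigma>\<^sup>2) n" by (rule prob_space_scaled_chi_square[OF s2 n])
  have D: "distr (sample_law n \<theta> (\<sigma>\<^sup>2)) (multi_normal \<theta> (\<sigma>\<^sup>2)) fst = multi_normal \<theta> (\<sigma>\<^sup>2)"
    unfolding sample_law_def by (rule S.distr_pair_fst)
  have fm: "fst \<in> sample_law n \<theta> (\<sigma>\<^sup>2) \<rightarrow>\<^sub>M multi_normal \<theta> (\<sigma>\<^sup>2)" by (simp add: sample_law_def)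
  have gm: "(\<lambda>x. ((x - \<theta>) \<bullet> v)\<^sup>2) \<in> borel_measurable (multi_normal \<theta> (\<sigma>\<^sup>2))" by measurable
  have "integrable (multi_normal \<theta> (\<sigma>\<^sup>2)) (\<lambda>x. ((x - \<theta>) \<bullet> v)\<^sup>2)"
    unfolding multi_normal_eq_distr[OF s, of \<theta>]
    by (subst integrable_distr_eq) (auto simp: power_mult_distrib integrable_gauss_power)
  then have "integrable (distr (sample_law n \<theta> (\<sigma>\<^sup>2)) (multi_normal \<theta> (\<sigma>\<^sup>2)) fst) (\<lambda>x. ((x - \<theta>) \<bullet> v)\<^sup>2)"
    by (simp add: D)
  then show "integrable (sample_law n \<theta> (\<sigma>\<^sup>2)) (\<lambda>z. ((fst z - \<theta>) \<bullet> v)\<^sup>2)"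
    by (rule integrable_distr[OF fm])
  have "(\<integral>z. ((fst z - \<theta>) \<bullet> v)\<^sup>2 \<partial>sample_law n \<theta> (\<sigma>\<^sup>2)) = (\<integral>x. ((x - \<theta>) \<bullet> v)\<^sup>2 \<partial>distr (sample_law n \<theta> (\<sigma>\<^sup>2)) (multi_normal \<theta> (\<sigma>\<^sup>2)) fst)"
    by (rule integral_distr[OF fm gm, symmetric])
  also have "\<dots> = (\<integral>x. ((x - \<theta>) \<bullet> v)\<^sup>2 \<partial>multi_normal \<theta> (\<sigma>\<^sup>2))" by (simp only: D)
  also have "\<dots> = (\<integral>x. \<sigma>\<^sup>2 * (x \<bullet> v)\<^sup>2 \<partial>multi_normal 0 1)"
    unfolding multi_normal_eq_distr[OF s, of \<theta>] by (subst integral_distr) (auto simp: power_mult_distrib)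
  also have "\<dots> = \<sigma>\<^sup>2 * (norm v)\<^sup>2" by (simp add: gauss_variance)
  finally show "(\<integral>z. ((fst z - \<theta>) \<bullet> v)\<^sup>2 \<partial>sample_law n \<theta> (\<sigma>\<^sup>2)) = \<sigma>\<^sup>2 * (norm v)\<^sup>2" .
qed

lemma
  fixes \<theta> :: "real ^ 'p::finite"
  assumes s: "0 < \<sigma>" and n: "0 < n"
  shows integrable_sample_law_norm: "integrable (sample_law n \<theta> (\<sigma>\<^sup>2)) (\<lambda>z. (norm (fst z - \<theta>))\<^sup>2)"
    and integral_sample_law_norm: "(\<integral>z. (norm (fst z - \<theta>))\<^sup>2 \<partial>sample_law n \<theta> (\<sigma>\<^sup>2)) = real CARD('p) * \<sigma>\<^sup>2"
  unfolding norm_power2_eq_sum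
  by (auto simp: integrable_sample_law_inner[OF s n] integral_sample_law_inner[OF s n] Bochner_Integration.integral_sum)

section \<open>The risk reduction matrix\<close>

lemma outer_mult_vec: "outer y *v v = (y \<bullet> v) *\<^sub>R y"
  by (simp add: outer_def matrix_vector_mult_def inner_vec_def vec_eq_iff sum_distrib_left mult_ac)

lemma trace_outer: "trace (outer y) = (norm y)\<^sup>2"
  unfolding power2_norm_eq_inner by (simp add: trace_def outer_def inner_vec_def)

lemma norm_outer_le: "norm (outer y) \<le> real CARD('p) * (norm y)\<^sup>2" for y :: "real ^ 'p::finite"
proof -
  have "outer y $ i = y $ i *\<^sub>R y" for i by (simp add: outer_def vec_eq_iff)
  then have "norm (outer y) \<le> (\<Sum>i\<in>UNIV. \<bar>y $ i\<bar> * norm y)"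
    unfolding norm_vec_def[of "outer y"] by (intro order_trans[OF L2_set_le_sum]) auto
  also have "\<dots> \<le> (\<Sum>i\<in>(UNIV :: 'p set). norm y * norm y)"
    by (intro sum_mono mult_right_mono component_le_norm_cart) auto
  finally show ?thesis by (simp add: power2_eq_square)
qed

lemma borel_measurable_outer [measurable]: "outer \<in> borel_measurable (borel :: (real ^ 'p::finite) measure)"
proof (rule borel_measurable_continuous_onI)
  show "continuous_on UNIV (outer :: real ^ 'p \<Rightarrow> _)"
    unfolding outer_def by (intro continuous_on_vec_lambda continuous_intros)
qed

text \<open>Quadratic form, trace and entries are bounded linear functionals of the matrix, so they
  pass under the integral once the outer product is integrable; its norm is at most a multiple of
  the squared norm of Y.\<close>

lemma
  fixes Y :: "'a \<Rightarrow> real ^ 'p::finite"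
  assumes [measurable]: "Y \<in> borel_measurable M" and int: "integrable M (\<lambda>z. (norm (Y z))\<^sup>2)"
  shows integral_outer_quadratic: "v \<bullet> ((\<integral>z. outer (Y z) \<partial>M) *v v) = (\<integral>z. (Y z \<bullet> v)\<^sup>2 \<partial>M)"
    and integral_outer_trace: "trace (\<integral>z. outer (Y z) \<partial>M) = (\<integral>z. (norm (Y z))\<^sup>2 \<partial>M)"
    and integral_outer_symmetric: "(\<integral>z. outer (Y z) \<partial>M) $ i $ j = (\<integral>z. outer (Y z) \<partial>M) $ j $ i"
proof -
  have i: "integrable M (\<lambda>z. outer (Y z))"
  proof (rule Bochner_Integration.integrable_bound)
    show "integrable M (\<lambda>z. real CARD('p) * (norm (Y z))\<^sup>2)" using int by simp
  qed (auto simp: norm_outer_le)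
  have lin1: "bounded_linear (\<lambda>A :: real ^ 'p ^ 'p. v \<bullet> (A *v v))"
    by (rule linear_conv_bounded_linear[THEN iffD1], rule linearI)
       (simp_all add: matrix_vector_mult_add_rdistrib inner_add_right scaleR_matrix_vector_assoc[symmetric])
  have lin2: "bounded_linear (trace :: real ^ 'p ^ 'p \<Rightarrow> real)"
    by (rule linear_conv_bounded_linear[THEN iffD1], rule linearI) (simp_all add: trace_def sum.distrib sum_distrib_left)
  have lin3: "bounded_linear (\<lambda>A :: real ^ 'p ^ 'p. A $ i $ j)" for i j
    by (rule linear_conv_bounded_linear[THEN iffD1], rule linearI) simp_all
  show "v \<bullet> ((\<integral>z. outer (Y z) \<partial>M) *v v) = (\<integral>z. (Y z \<bullet> v)\<^sup>2 \<partial>M)"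
    unfolding integral_bounded_linear[OF lin1 i, symmetric]
    by (simp add: outer_mult_vec inner_commute power2_eq_square)
  show "trace (\<integral>z. outer (Y z) \<partial>M) = (\<integral>z. (norm (Y z))\<^sup>2 \<partial>M)"
    unfolding integral_bounded_linear[OF lin2 i, symmetric] by (simp add: trace_outer)
  show "(\<integral>z. outer (Y z) \<partial>M) $ i $ j = (\<integral>z. outer (Y z) \<partial>M) $ j $ i"
    unfolding integral_bounded_linear[OF lin3 i, symmetric] by (simp add: outer_def mult.commute)
qed

text \<open>Cutting \<open>\<psi>\<close> off at 0 makes it Borel on the whole line; the value there
  is harmless because at x = 0 both sides vanish.\<close>

lemma shrinkage_eq:
  fixes \<phi> :: "real \<Rightarrow> real" and x :: "real ^ 'p::finite"
  assumes "0 < s"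
  defines "\<psi> \<equiv> \<lambda>w. if 0 < w then \<phi> w / w else 0"
  shows "shrinkage \<phi> x s = (1 - \<psi> ((norm x)\<^sup>2 / s)) *\<^sub>R x"
proof (cases "x = 0")
  case False
  then have "0 < (norm x)\<^sup>2 / s" using assms(1) by simp
  then show ?thesis by (simp add: shrinkage_def W_stat_def \<psi>_def)
qed (simp add: shrinkage_def)

lemma sum_square_bound: "(norm (a + b))\<^sup>2 \<le> 2 * (norm a)\<^sup>2 + 2 * (norm b)\<^sup>2" for a b :: "'a::real_inner"
proof -
  have "0 \<le> (norm (a - b))\<^sup>2" by simp
  then show ?thesis
    by (simp add: power2_norm_eq_inner inner_add_left inner_add_right inner_diff_left inner_diff_right inner_commute)
qed

context
  fixes n :: nat and \<phi> :: "real \<Rightarrow> real" and \<psi> :: "real \<Rightarrow> real"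
  assumes n: "0 < n" and cont: "continuous_on {0<..} \<phi>"
    and imp: "improves_on n squared_error (shrinkage \<phi>) (\<lambda>(x :: real ^ 'p::finite) s. x)"
  defines "\<psi> \<equiv> \<lambda>w. if 0 < w then \<phi> w / w else 0"
begin

lemma borel_measurable_shrink_factor [measurable]: "\<psi> \<in> borel_measurable borel"
proof -
  have [measurable]: "(\<lambda>w. if 0 < w then \<phi> w else 0) \<in> borel_measurable borel"
    by (rule borel_measurable_positive_part[OF cont])
  have "\<psi> = (\<lambda>w. (if 0 < w then \<phi> w else 0) / w)" by (auto simp: \<psi>_def fun_eq_iff)
  then show ?thesis by simp
qed

lemma shrinkage_sample_law:
  assumes "z \<in> space (sample_law n \<theta> v)"
  shows "shrinkage \<phi> (fst z) (snd z) = (1 - \<psi> ((norm (fst z))\<^sup>2 / snd z)) *\<^sub>R fst z"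
  unfolding \<psi>_def by (rule shrinkage_eq) (use assms in auto)

lemma borel_measurable_shrinkage [measurable]:
  "(\<lambda>z. shrinkage \<phi> (fst z) (snd z)) \<in> borel_measurable (sample_law n (\<theta> :: real ^ 'p) v)"
  by (subst measurable_cong[OF shrinkage_sample_law]) (assumption, measurable)

text \<open>The risk of X is p \<sigma>^2, finite; improvement in extended reals thus yields
  integrability as well as the bound.\<close>

lemma
  fixes \<theta> :: "real ^ 'p"
  assumes s: "0 < \<sigma>"
  shows integrable_shrinkage_loss: "integrable (sample_law n \<theta> (\<sigma>\<^sup>2)) (\<lambda>z. (norm (shrinkage \<phi> (fst z) (snd z) - \<theta>))\<^sup>2)"
    and integral_shrinkage_loss_le: "(\<integral>z. (norm (shrinkage \<phi> (fst z) (snd z) - \<theta>))\<^sup>2 \<partial>sample_law n \<theta> (\<sigma>\<^sup>2)) \<le> real CARD('p) * \<sigma>\<^sup>2"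
proof -
  have s2: "0 < \<sigma>\<^sup>2" using s by simp
  have "risk n squared_error (\<lambda>x s. x) \<theta> (\<sigma>\<^sup>2) = (\<integral>\<^sup>+z. ennreal ((norm (fst z - \<theta>))\<^sup>2) \<partial>sample_law n \<theta> (\<sigma>\<^sup>2))"
    by (simp add: risk_def squared_error_def case_prod_unfold)
  also have "\<dots> = ennreal (real CARD('p) * \<sigma>\<^sup>2)"
    using nn_integral_eq_integral[OF integrable_sample_law_norm[OF s n, of \<theta>]] integral_sample_law_norm[OF s n, of \<theta>] by simp
  finally have "risk n squared_error (shrinkage \<phi>) \<theta> (\<sigma>\<^sup>2) \<le> ennreal (real CARD('p) * \<sigma>\<^sup>2)"
    using imp s2 unfolding improves_on_def by metis
  then have le: "(\<integral>\<^sup>+z. ennreal ((norm (shrinkage \<phi> (fst z) (snd z) - \<theta>))\<^sup>2) \<partial>sample_law n \<theta> (\<sigma>\<^sup>2)) \<le> ennreal (real CARD('p) * \<sigma>\<^sup>2)"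
    by (simp add: risk_def squared_error_def case_prod_unfold)
  show i: "integrable (sample_law n \<theta> (\<sigma>\<^sup>2)) (\<lambda>z. (norm (shrinkage \<phi> (fst z) (snd z) - \<theta>))\<^sup>2)"
  proof (rule integrableI_nonneg)
    show "(\<integral>\<^sup>+z. ennreal ((norm (shrinkage \<phi> (fst z) (snd z) - \<theta>))\<^sup>2) \<partial>sample_law n \<theta> (\<sigma>\<^sup>2)) < \<infinity>"
      using order_le_less_trans[OF le ennreal_less_top] by simp
  qed auto
  show "(\<integral>z. (norm (shrinkage \<phi> (fst z) (snd z) - \<theta>))\<^sup>2 \<partial>sample_law n \<theta> (\<sigma>\<^sup>2)) \<le> real CARD('p) * \<sigma>\<^sup>2"
    using le nn_integral_eq_integral[OF i] by (simp add: ennreal_le_iff)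
qed

text \<open>\<open>\<psi>(W) X\<close> is the difference of X - \<tau> and the estimation error,
  both square integrable under mean \<tau>. As \<tau> is arbitrary, untilting gives exponential
  moments in all directions.\<close>

lemma integrable_shrink_square:
  fixes \<tau> :: "real ^ 'p"
  shows "integrable (base_law n) (\<lambda>z. (\<psi> ((norm (fst z))\<^sup>2 / snd z))\<^sup>2 * (norm (fst z))\<^sup>2 * exp (fst z \<bullet> \<tau>))"
proof -
  define f where "f z = (\<psi> ((norm (fst z))\<^sup>2 / snd z))\<^sup>2 * (norm (fst z))\<^sup>2" for z :: "(real ^ 'p) \<times> real"
  have fm: "f \<in> borel_measurable (sample_law n \<tau> (1\<^sup>2))" unfolding f_def[abs_def] by measurable
  have "integrable (sample_law n \<tau> (1\<^sup>2)) f"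
  proof (rule integrable_dominated[OF _ fm])
    show "integrable (sample_law n \<tau> (1\<^sup>2)) (\<lambda>z. 2 * (norm (fst z - \<tau>))\<^sup>2 + 2 * (norm (shrinkage \<phi> (fst z) (snd z) - \<tau>))\<^sup>2)"
      by (intro Bochner_Integration.integrable_add integrable_mult_right integrable_sample_law_norm integrable_shrinkage_loss n) auto
    fix z assume "z \<in> space (sample_law n \<tau> (1\<^sup>2))"
    then have "shrinkage \<phi> (fst z) (snd z) = (1 - \<psi> ((norm (fst z))\<^sup>2 / snd z)) *\<^sub>R fst z"
      by (rule shrinkage_sample_law)
    then have "\<psi> ((norm (fst z))\<^sup>2 / snd z) *\<^sub>R fst z = (fst z - \<tau>) + - (shrinkage \<phi> (fst z) (snd z) - \<tau>)"
      by (simp add: scaleR_left_diff_distrib)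
    then have "f z = (norm ((fst z - \<tau>) + - (shrinkage \<phi> (fst z) (snd z) - \<tau>)))\<^sup>2"
      by (metis (no_types) f_def norm_scaleR power2_abs power_mult_distrib)
    also have "\<dots> \<le> 2 * (norm (fst z - \<tau>))\<^sup>2 + 2 * (norm (- (shrinkage \<phi> (fst z) (snd z) - \<tau>)))\<^sup>2"
      by (rule sum_square_bound)
    finally show "\<bar>f z\<bar> \<le> 2 * (norm (fst z - \<tau>))\<^sup>2 + 2 * (norm (shrinkage \<phi> (fst z) (snd z) - \<tau>))\<^sup>2"
      unfolding norm_minus_cancel by (simp add: f_def)
  qed
  then show ?thesis
    using integrable_sample_law_iff[OF zero_less_one n fm] by (simp add: f_def)
qed

lemma
  fixes \<theta> :: "real ^ 'p"
  assumes s: "0 < \<sigma>"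
  defines "M \<equiv> risk_reduction_matrix n (shrinkage \<phi>) \<theta> (\<sigma>\<^sup>2)"
  shows trace_risk_reduction_nonneg: "0 \<le> trace M"
    and risk_reduction_symmetric: "M $ i $ j = M $ j $ i"
    and risk_reduction_quadratic: "v \<bullet> (M *v v)
      = \<sigma>\<^sup>2 * (norm v)\<^sup>2 - (\<integral>z. ((shrinkage \<phi> (fst z) (snd z) - \<theta>) \<bullet> v)\<^sup>2 \<partial>sample_law n \<theta> (\<sigma>\<^sup>2))"
proof -
  have M: "M = \<sigma>\<^sup>2 *\<^sub>R mat 1 - (\<integral>z. outer (shrinkage \<phi> (fst z) (snd z) - \<theta>) \<partial>sample_law n \<theta> (\<sigma>\<^sup>2))"
    by (simp add: M_def risk_reduction_matrix_def mse_matrix_def case_prod_unfold)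
  have m: "(\<lambda>z. shrinkage \<phi> (fst z) (snd z) - \<theta>) \<in> borel_measurable (sample_law n \<theta> (\<sigma>\<^sup>2))" by measurable
  note i = integrable_shrinkage_loss[OF s, of \<theta>]
  have tr: "trace (\<sigma>\<^sup>2 *\<^sub>R mat 1 :: real ^ 'p ^ 'p) = real CARD('p) * \<sigma>\<^sup>2"
    by (simp add: trace_def mat_def)
  show "0 \<le> trace M"
    unfolding M trace_sub integral_outer_trace[OF m i] tr using integral_shrinkage_loss_le[OF s, of \<theta>] by simp
  show "M $ i $ j = M $ j $ i"
    unfolding M using integral_outer_symmetric[OF m i, of i j] by (simp add: mat_def)
  show "v \<bullet> (M *v v) = \<sigma>\<^sup>2 * (norm v)\<^sup>2 - (\<integral>z. ((shrinkage \<phi> (fst z) (snd z) - \<theta>) \<bullet> v)\<^sup>2 \<partial>sample_law n \<theta> (\<sigma>\<^sup>2))"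
    unfolding M matrix_vector_mult_diff_rdistrib inner_diff_right integral_outer_quadratic[OF m i]
    by (simp add: scaleR_matrix_vector_assoc[symmetric] power2_norm_eq_inner)
qed

lemma risk_reduction_quadratic_le:
  fixes \<theta> v :: "real ^ 'p"
  assumes s: "0 < \<sigma>"
    and B: "\<And>j. integral\<^sup>L (ratio_law (CARD('p) + 2 * j + 2) n) (\<lambda>w. 2 * \<psi> w - (\<psi> w)\<^sup>2) \<le> B"
    and anti: "antimono_on {0<..} (\<lambda>w. w powr (real n / 2) * (LINT t:{w<..}|lborel. t powr (- (real n / 2)) * (\<psi> t / t)))"
  shows "v \<bullet> (risk_reduction_matrix n (shrinkage \<phi>) \<theta> (\<sigma>\<^sup>2) *v v) \<le> \<sigma>\<^sup>2 * B * (norm v)\<^sup>2"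
proof -
  define \<tau> where "\<tau> = (1 / \<sigma>) *\<^sub>R \<theta>"
  define c where "c = (norm \<tau>)\<^sup>2 / 2"
  define W where "W z = (norm (fst z))\<^sup>2 / snd z" for z :: "(real ^ 'p) \<times> real"
  \<comment> \<open>The gain in the direction v after scaling to \<sigma> = 1: the squared error of
    X minus that of the shrinkage estimator, as a difference of two squares.\<close>
  define Q where "Q z = 2 * \<psi> (W z) * ((fst z \<bullet> v) * (fst z \<bullet> v - \<tau> \<bullet> v)) - (\<psi> (W z))\<^sup>2 * (fst z \<bullet> v)\<^sup>2" for z
  have \<theta>: "\<theta> = \<sigma> *\<^sub>R \<tau>" using s by (simp add: \<tau>_def)
  have core: "integrable (base_law n) (\<lambda>z. Q z * exp (fst z \<bullet> \<tau>))"
    "(\<integral>z. Q z * exp (fst z \<bullet> \<tau>) \<partial>base_law n) \<le> (norm v)\<^sup>2 * B * exp c"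
    unfolding Q_def W_def c_def
    by (rule noncentral_quadratic_form_le[OF n borel_measurable_shrink_factor integrable_shrink_square B anti])+
  define R where "R z = ((fst z - \<tau>) \<bullet> v)\<^sup>2" for z :: "(real ^ 'p) \<times> real"
  have Rm1: "(\<lambda>z. ((fst z - \<theta>) \<bullet> v)\<^sup>2) \<in> borel_measurable (sample_law n \<theta> (\<sigma>\<^sup>2))" by measurable
  have Rsc: "((\<sigma> *\<^sub>R fst z - \<theta>) \<bullet> v)\<^sup>2 = \<sigma>\<^sup>2 * R z" for z :: "(real ^ 'p) \<times> real"
    unfolding \<theta> R_def scaleR_diff_right[symmetric] by (simp add: power_mult_distrib)
  have iR: "integrable (base_law n) (\<lambda>z. R z * exp (fst z \<bullet> \<tau>))"
    using integrable_sample_law_iff[OF s n Rm1, folded \<tau>_def] integrable_sample_law_inner[OF s n, of \<theta> v] s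
    by (simp add: Rsc mult.assoc)
  have R: "exp (- c) * (\<integral>z. R z * exp (fst z \<bullet> \<tau>) \<partial>base_law n) = (norm v)\<^sup>2"
    using integral_sample_law[OF s n Rm1, folded \<tau>_def] integral_sample_law_inner[OF s n, of \<theta> v] s
    by (simp add: Rsc mult.assoc c_def)
  have m: "(\<lambda>z. ((shrinkage \<phi> (fst z) (snd z) - \<theta>) \<bullet> v)\<^sup>2) \<in> borel_measurable (sample_law n \<theta> (\<sigma>\<^sup>2))" by measurable
  have sc: "((shrinkage \<phi> (\<sigma> *\<^sub>R fst z) (\<sigma>\<^sup>2 * snd z) - \<theta>) \<bullet> v)\<^sup>2 = \<sigma>\<^sup>2 * (R z - Q z)"
    if "z \<in> space (base_law n)" for z :: "(real ^ 'p) \<times> real"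
  proof -
    have sz: "0 < snd z" using that by (auto simp: base_law_def space_pair_measure)
    have W: "(norm (\<sigma> *\<^sub>R fst z))\<^sup>2 / (\<sigma>\<^sup>2 * snd z) = W z" using s by (simp add: W_def power_mult_distrib)
    have "shrinkage \<phi> (\<sigma> *\<^sub>R fst z) (\<sigma>\<^sup>2 * snd z) = (1 - \<psi> (W z)) *\<^sub>R (\<sigma> *\<^sub>R fst z)"
      using shrinkage_eq[of "\<sigma>\<^sup>2 * snd z" \<phi> "\<sigma> *\<^sub>R fst z"] s sz unfolding W by (simp add: \<psi>_def)
    then have "(shrinkage \<phi> (\<sigma> *\<^sub>R fst z) (\<sigma>\<^sup>2 * snd z) - \<theta>) \<bullet> v = ((1 - \<psi> (W z)) *\<^sub>R (\<sigma> *\<^sub>R fst z) - \<sigma> *\<^sub>R \<tau>) \<bullet> v"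
      by (simp only: \<theta>)
    also have "\<dots> = \<sigma> * ((fst z - \<tau>) \<bullet> v - \<psi> (W z) * (fst z \<bullet> v))"
      by (simp add: inner_diff_left algebra_simps)
    finally have d: "(shrinkage \<phi> (\<sigma> *\<^sub>R fst z) (\<sigma>\<^sup>2 * snd z) - \<theta>) \<bullet> v = \<sigma> * ((fst z - \<tau>) \<bullet> v - \<psi> (W z) * (fst z \<bullet> v))"
      .
    show ?thesis
      unfolding d R_def Q_def by (simp add: power_mult_distrib inner_diff_left power2_eq_square algebra_simps)
  qed
  have "(\<integral>z. ((shrinkage \<phi> (fst z) (snd z) - \<theta>) \<bullet> v)\<^sup>2 \<partial>sample_law n \<theta> (\<sigma>\<^sup>2))
    = exp (- c) * (\<integral>z. \<sigma>\<^sup>2 * (R z - Q z) * exp (fst z \<bullet> \<tau>) \<partial>base_law n)"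
    unfolding integral_sample_law[OF s n m, folded \<tau>_def] c_def[symmetric] fst_conv snd_conv
    by (intro arg_cong[where f="\<lambda>x. exp (- c) * x"] Bochner_Integration.integral_cong refl) (simp add: sc)
  also have "(\<integral>z. \<sigma>\<^sup>2 * (R z - Q z) * exp (fst z \<bullet> \<tau>) \<partial>base_law n)
    = \<sigma>\<^sup>2 * ((\<integral>z. R z * exp (fst z \<bullet> \<tau>) \<partial>base_law n) - (\<integral>z. Q z * exp (fst z \<bullet> \<tau>) \<partial>base_law n))"
    using iR core(1) by (simp add: mult.assoc left_diff_distrib)
  finally have "(\<integral>z. ((shrinkage \<phi> (fst z) (snd z) - \<theta>) \<bullet> v)\<^sup>2 \<partial>sample_law n \<theta> (\<sigma>\<^sup>2))
    = \<sigma>\<^sup>2 * ((norm v)\<^sup>2 - exp (- c) * (\<integral>z. Q z * exp (fst z \<bullet> \<tau>) \<partial>base_law n))"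
    using R by (simp add: algebra_simps)
  then have eq: "v \<bullet> (risk_reduction_matrix n (shrinkage \<phi>) \<theta> (\<sigma>\<^sup>2) *v v)
      = \<sigma>\<^sup>2 * (exp (- c) * (\<integral>z. Q z * exp (fst z \<bullet> \<tau>) \<partial>base_law n))"
    unfolding risk_reduction_quadratic[OF s] by (simp add: algebra_simps)
  have "exp (- c) * (\<integral>z. Q z * exp (fst z \<bullet> \<tau>) \<partial>base_law n) \<le> exp (- c) * ((norm v)\<^sup>2 * B * exp c)"
    using core(2) by (intro mult_left_mono) auto
  also have "\<dots> = B * (norm v)\<^sup>2" by (simp add: exp_minus)
  finally show ?thesis
    unfolding eq mult.assoc by (intro mult_left_mono) auto
qed

end

section \<open>Traces\<close>

lemma
  fixes A B C :: "real ^ 'p::finite ^ 'p"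
  shows matrix_mult_add_left: "(A + B) ** C = A ** C + B ** C"
    and matrix_mult_diff_left: "(A - B) ** C = A ** C - B ** C"
    and matrix_mult_diff_right: "A ** (B - C) = A ** B - A ** C"
  by (simp_all add: matrix_matrix_mult_def vec_eq_iff sum.distrib sum_subtractf algebra_simps)

lemma trace_scaleR: "trace (c *\<^sub>R A) = c * trace A" for A :: "real ^ 'p::finite ^ 'p"
  by (simp add: trace_def sum_distrib_left)

lemma trace_scaleR_mult: "trace ((c *\<^sub>R A) ** B) = c * trace (A ** B)" for A B :: "real ^ 'p::finite ^ 'p"
  by (simp add: scalar_matrix_assoc[symmetric] trace_scaleR)

lemma trace_square_nonneg:
  fixes D :: "real ^ 'p::finite ^ 'p"
  assumes "\<And>i j. D $ i $ j = D $ j $ i"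
  shows "0 \<le> trace (D ** D)"
proof -
  have "trace (D ** D) = (\<Sum>i\<in>UNIV. \<Sum>j\<in>UNIV. D $ i $ j * D $ j $ i)"
    by (simp add: trace_def matrix_matrix_mult_def)
  also have "\<dots> = (\<Sum>i\<in>UNIV. \<Sum>j\<in>UNIV. (D $ i $ j)\<^sup>2)"
  proof (intro sum.cong refl)
    fix i j show "D $ i $ j * D $ j $ i = (D $ i $ j)\<^sup>2"
      using assms[of j i] by (simp add: power2_eq_square)
  qed
  finally show ?thesis by (simp add: sum_nonneg)
qed

lemma proj_mult_trace: "x \<noteq> 0 \<Longrightarrow> trace (proj x ** M) = x \<bullet> (M *v x) / (norm x)\<^sup>2" for x :: "real ^ 'p::finite"
proof -
  have "trace (outer x ** M) = (\<Sum>i\<in>UNIV. \<Sum>j\<in>UNIV. x $ i * x $ j * M $ j $ i)"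
    by (simp add: trace_def matrix_matrix_mult_def outer_def)
  also have "\<dots> = (\<Sum>j\<in>UNIV. \<Sum>i\<in>UNIV. x $ i * x $ j * M $ j $ i)" by (rule sum.swap)
  also have "\<dots> = x \<bullet> (M *v x)"
    by (simp add: inner_vec_def matrix_vector_mult_def sum_distrib_left mult_ac)
  finally show ?thesis by (simp add: proj_def trace_scaleR_mult)
qed

lemma proj_mult_vec: "proj x *v y = ((x \<bullet> y) / (norm x)\<^sup>2) *\<^sub>R x"
  by (simp add: proj_def scaleR_matrix_vector_assoc[symmetric] outer_mult_vec)

lemma trace_spectral_mult:
  fixes M :: "real ^ 'p::finite ^ 'p"
  assumes x: "x \<noteq> 0"
  shows "trace ((a *\<^sub>R (mat 1 - proj x) + b *\<^sub>R proj x) ** M)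
    = a * (trace M - x \<bullet> (M *v x) / (norm x)\<^sup>2) + b * (x \<bullet> (M *v x) / (norm x)\<^sup>2)"
  by (simp add: matrix_mult_add_left matrix_mult_diff_left trace_add trace_scaleR_mult trace_sub proj_mult_trace[OF x])

lemma trace_spectral_square:
  fixes x :: "real ^ 'p::finite" and a b :: real
  assumes x: "x \<noteq> 0"
  defines "A \<equiv> a *\<^sub>R (mat 1 - proj x) + b *\<^sub>R proj x"
  shows "trace (A ** A) = (real CARD('p) - 1) * a\<^sup>2 + b\<^sup>2"
proof -
  have nx: "(norm x)\<^sup>2 \<noteq> 0" using x by simp
  have trP: "trace (proj x) = 1" using nx by (simp add: proj_def trace_scaleR trace_outer)
  have tr1: "trace (mat 1 :: real ^ 'p ^ 'p) = real CARD('p)" by (simp add: trace_def mat_def)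
  have trA: "trace A = a * (real CARD('p) - 1) + b"
    by (simp add: A_def trace_add trace_scaleR trace_sub trP tr1)
  have "A *v x = b *\<^sub>R x"
    using nx by (simp add: A_def matrix_vector_mult_add_rdistrib matrix_vector_mult_diff_rdistrib
        scaleR_matrix_vector_assoc[symmetric] proj_mult_vec power2_norm_eq_inner)
  then have "x \<bullet> (A *v x) / (norm x)\<^sup>2 = b" using nx by (simp add: power2_norm_eq_inner)
  then show ?thesis
    using trace_spectral_mult[OF x, of a b A] unfolding A_def[symmetric] trA
    by (simp add: algebra_simps power2_eq_square)
qed

lemma proj_symmetric: "proj x $ i $ j = proj x $ j $ i"
  by (simp add: proj_def outer_def mult.commute)

lemma trace_spectral_diff_square:
  fixes M :: "real ^ 'p::finite ^ 'p" and x :: "real ^ 'p" and a b :: real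
  assumes x: "x \<noteq> 0"
  defines "A \<equiv> a *\<^sub>R (mat 1 - proj x) + b *\<^sub>R proj x" and "t \<equiv> x \<bullet> (M *v x) / (norm x)\<^sup>2"
  shows "trace ((A - M) ** (A - M))
    = (real CARD('p) - 1) * a\<^sup>2 + b\<^sup>2 - 2 * (a * (trace M - t) + b * t) + trace (M ** M)"
proof -
  have "trace ((A - M) ** (A - M)) = trace (A ** A) - trace (A ** M) - trace (M ** A) + trace (M ** M)"
    by (simp add: matrix_mult_diff_left matrix_mult_diff_right trace_sub)
  also have "trace (M ** A) = trace (A ** M)" by (rule trace_mul_sym)
  finally show ?thesis
    using trace_spectral_square[OF x, of a b] trace_spectral_mult[OF x, of a b M]
    by (simp add: A_def t_def)
qed

text \<open>The left side is \<open>\<Sum>\<^sub>i Q e\<^sub>i \<bullet> M Q e\<^sub>i\<close> for the projection \<open>Q = I - x x\<^sup>T / |x|\<^sup>2\<close>.\<close>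
lemma trace_complement_le:
  fixes M :: "real ^ 'p::finite ^ 'p"
  assumes x: "x \<noteq> 0" and le: "\<And>v. v \<bullet> (M *v v) \<le> m * (norm v)\<^sup>2"
  shows "trace M - x \<bullet> (M *v x) / (norm x)\<^sup>2 \<le> (real CARD('p) - 1) * m"
proof -
  define N where "N = (norm x)\<^sup>2"
  have N: "N \<noteq> 0" using x by (simp add: N_def)
  define q where "q i = axis i 1 - (x $ i / N) *\<^sub>R x" for i
  have inn: "x \<bullet> x = N" by (simp add: N_def power2_norm_eq_inner)
  have sx: "(\<Sum>i\<in>UNIV. x $ i * x $ i) = N" unfolding inn[symmetric] by (simp add: inner_vec_def)
  have qn: "(norm (q i))\<^sup>2 = 1 - x $ i * x $ i / N" for i
  proof -
    have "(norm (q i))\<^sup>2 = q i \<bullet> q i" by (simp add: power2_norm_eq_inner)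
    also have "\<dots> = 1 - 2 * (x $ i / N) * (x $ i) + (x $ i / N) * (x $ i / N) * N"
      by (simp add: q_def inner_diff_left inner_diff_right inner_axis inner_commute[of "axis i 1"] inn algebra_simps inner_axis_axis)
    also have "\<dots> = 1 - x $ i * x $ i / N" using N by (simp add: field_simps)
    finally show ?thesis .
  qed
  have qM: "q i \<bullet> (M *v q i) = M $ i $ i - (x $ i / N) * (M *v x) $ i - (x $ i / N) * (x \<bullet> (M *v axis i 1))
      + (x $ i * x $ i) / N * (x \<bullet> (M *v x) / N)" for i
  proof -
    have "axis i 1 \<bullet> (M *v axis i 1) = M $ i $ i"
      by (simp add: inner_commute[of "axis i 1"] inner_axis matrix_vector_mul_component inner_axis)
    then show ?thesis
      by (simp add: q_def matrix_vector_mult_diff_distrib matrix_vector_mult_scaleR inner_diff_left inner_diff_right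
          inner_commute[of "axis i 1"] inner_axis algebra_simps)
  qed
  have s1: "(\<Sum>i\<in>UNIV. x $ i * (M *v x) $ i) = x \<bullet> (M *v x)" by (simp add: inner_vec_def)
  have s2: "(\<Sum>i\<in>UNIV. x $ i * (x \<bullet> (M *v axis i 1))) = x \<bullet> (M *v x)"
  proof -
    have "x = (\<Sum>i\<in>UNIV. x $ i *\<^sub>R axis i 1)"
      by (simp add: vec_eq_iff axis_def if_distrib[where f="\<lambda>y. _ * y"] cong: if_cong)
    then have "M *v x = (\<Sum>i\<in>UNIV. x $ i *\<^sub>R (M *v axis i 1))"
      by (metis (no_types, lifting) matrix_vector_mult_scaleR sum.cong matrix_vector_mul_linear linear_sum)
    then show ?thesis by (simp add: inner_sum_right)
  qed
  have "(\<Sum>i\<in>UNIV. q i \<bullet> (M *v q i)) \<le> (\<Sum>i\<in>UNIV. m * (norm (q i))\<^sup>2)"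
    by (rule sum_mono) (rule le)
  also have "\<dots> = m * (real CARD('p) - 1)"
    unfolding sum_distrib_left[symmetric] qn using N sx
    by (simp add: sum_subtractf sum_divide_distrib[symmetric])
  also have "(\<Sum>i\<in>UNIV. q i \<bullet> (M *v q i)) = trace M - x \<bullet> (M *v x) / N"
  proof -
    have "(\<Sum>i\<in>UNIV. q i \<bullet> (M *v q i)) = trace M - (\<Sum>i\<in>UNIV. x $ i * (M *v x) $ i) / N
        - (\<Sum>i\<in>UNIV. x $ i * (x \<bullet> (M *v axis i 1))) / N + (\<Sum>i\<in>UNIV. x $ i * x $ i) / N * (x \<bullet> (M *v x) / N)"
      unfolding qM by (simp add: trace_def sum.distrib sum_subtractf sum_divide_distrib sum_distrib_right)
    then show ?thesis unfolding s1 s2 sx using N by simp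
  qed
  finally show ?thesis by (simp add: N_def mult.commute)
qed

section \<open>A covariance inequality for the chi-square distribution\<close>

text \<open>Size biasing a chi-square variable adds two degrees of freedom; the moments k and k (k +
  2) follow by iteration.\<close>

lemma chi_square_density_times:
  assumes k: "0 < k" and x: "0 < x"
  shows "x * chi_square_density k x = real k * chi_square_density (k + 2) x"
proof -
  define m where "m = real k / 2"
  have m: "0 < m" "real k = 2 * m" using k by (auto simp: m_def)
  have G: "Gamma (m + 1) = m * Gamma m" using m by (intro Gamma_plus1) (auto elim!: nonpos_Ints_cases)
  have e: "real (k + 2) / 2 = m + 1" by (simp add: m_def)
  have p: "x powr m = x * x powr (m - 1)" using x by (simp add: powr_mult_base)
  have "Gamma m \<noteq> 0" using Gamma_real_pos[OF m(1)] by simp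
  then show ?thesis
    unfolding chi_square_density_def m_def[symmetric] e using m
    by (simp add: G p powr_add)
qed

lemma nn_integral_chi_square_times:
  assumes k: "0 < k" and [measurable]: "f \<in> borel_measurable borel"
  shows "(\<integral>\<^sup>+x. ennreal x * f x \<partial>chi_square k) = ennreal (real k) * (\<integral>\<^sup>+x. f x \<partial>chi_square (k + 2))"
proof -
  have "(\<integral>\<^sup>+x. ennreal x * f x \<partial>chi_square k)
    = (\<integral>\<^sup>+x. ennreal (real k) * (ennreal (chi_square_density (k + 2) x) * f x * indicator {0<..} x) \<partial>lborel)"
  proof (subst nn_integral_chi_square, measurable, rule nn_integral_cong)
    fix x :: real
    show "ennreal (chi_square_density k x) * (ennreal x * f x) * indicator {0<..} x
      = ennreal (real k) * (ennreal (chi_square_density (k + 2) x) * f x * indicator {0<..} x)"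
    proof (cases "0 < x")
      case True
      have "ennreal (chi_square_density k x) * ennreal x = ennreal (real k) * ennreal (chi_square_density (k + 2) x)"
        using chi_square_density_times[OF k True] k True by (simp add: ennreal_mult[symmetric] mult.commute)
      then show ?thesis using True by (simp add: mult.assoc[symmetric])
    qed simp
  qed
  then show ?thesis by (subst nn_integral_chi_square) (simp_all add: nn_integral_cmult)
qed

lemma
  assumes "0 < k"
  shows chi_square_first_moment: "(\<integral>\<^sup>+x. ennreal x \<partial>chi_square k) = ennreal (real k)"
    and chi_square_second_moment: "(\<integral>\<^sup>+x. ennreal (x\<^sup>2) \<partial>chi_square k) = ennreal (real k * (real k + 2))"
proof -
  have 1: "(\<integral>\<^sup>+x. ennreal x \<partial>chi_square j) = ennreal (real j)" if "0 < j" for j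
  proof -
    interpret prob_space "chi_square (j + 2)" by (rule prob_space_chi_square) simp
    show ?thesis using nn_integral_chi_square_times[OF that, of "\<lambda>_. 1"] emeasure_space_1 by simp
  qed
  show "(\<integral>\<^sup>+x. ennreal x \<partial>chi_square k) = ennreal (real k)" by (rule 1[OF assms])
  have "(\<integral>\<^sup>+x. ennreal (x\<^sup>2) \<partial>chi_square k) = (\<integral>\<^sup>+x. ennreal x * ennreal x \<partial>chi_square k)"
    by (intro nn_integral_cong) (simp add: ennreal_mult[symmetric] power2_eq_square)
  also have "\<dots> = ennreal (real k) * ennreal (real (k + 2))"
    using nn_integral_chi_square_times[OF assms, of ennreal] 1[of "k + 2"] by simp
  also have "\<dots> = ennreal (real k * real (k + 2))" by (rule ennreal_mult[symmetric]) auto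
  finally show "(\<integral>\<^sup>+x. ennreal (x\<^sup>2) \<partial>chi_square k) = ennreal (real k * (real k + 2))"
    by simp
qed

text \<open>\<open>s\<^sup>2 - (n + 2) s\<close> has mean \<open>0\<close> and changes sign once, from negative to positive.\<close>
lemma chi_square_covariance:
  assumes n: "0 < n" and [measurable]: "h \<in> borel_measurable borel"
    and h0: "\<And>s. 0 \<le> h s" and mono: "mono_on {0<..} h"
  shows "(\<integral>\<^sup>+s. ennreal ((real n + 2) * s * h s) \<partial>chi_square n) \<le> (\<integral>\<^sup>+s. ennreal (s\<^sup>2 * h s) \<partial>chi_square n)"
proof -
  define c where "c = real n + 2"
  have c: "0 < c" by (simp add: c_def)
  \<comment> \<open>The pointwise inequality s (s - c) (h s - h c) >= 0, rearranged so that only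
    nonnegative terms appear. The two terms with the constant \<open>h c\<close> have the same
    finite mean and cancel afterwards.\<close>
  have le: "(\<integral>\<^sup>+s. ennreal (c * s * h s) + ennreal (h c) * ennreal (s\<^sup>2) \<partial>chi_square n)
      \<le> (\<integral>\<^sup>+s. ennreal (s\<^sup>2 * h s) + ennreal (c * h c) * ennreal s \<partial>chi_square n)"
  proof (rule nn_integral_mono)
    fix s assume "s \<in> space (chi_square n)"
    then have s: "0 < s" by simp
    have "0 \<le> (s - c) * (h s - h c)"
    proof (cases "s \<le> c")
      case True
      then have "h s \<le> h c" using s c by (intro mono_onD[OF mono]) auto
      then show ?thesis using True by (intro mult_nonpos_nonpos) auto
    next
      case False
      then have "h c \<le> h s" using s c by (intro mono_onD[OF mono]) auto
      then show ?thesis using False by simp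
    qed
    then have "0 \<le> s * ((s - c) * (h s - h c))" using s by simp
    then have "c * s * h s + h c * s\<^sup>2 \<le> s\<^sup>2 * h s + c * h c * s"
      by (simp add: algebra_simps power2_eq_square)
    then show "ennreal (c * s * h s) + ennreal (h c) * ennreal (s\<^sup>2) \<le> ennreal (s\<^sup>2 * h s) + ennreal (c * h c) * ennreal s"
      using s c h0[of s] h0[of c] by (simp add: ennreal_mult[symmetric] ennreal_plus[symmetric] ennreal_leI del: ennreal_plus)
  qed
  have "(\<integral>\<^sup>+s. ennreal (c * s * h s) \<partial>chi_square n) + ennreal (h c * (real n * c))
      \<le> (\<integral>\<^sup>+s. ennreal (s\<^sup>2 * h s) \<partial>chi_square n) + ennreal (c * h c * real n)"
    using le h0[of c] c
    by (subst (asm) (1 2) nn_integral_add, simp_all add: nn_integral_cmult chi_square_first_moment[OF n] chi_square_second_moment[OF n] c_def[symmetric])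
       (simp add: ennreal_mult[symmetric])
  then have "ennreal (h c * (real n * c)) + (\<integral>\<^sup>+s. ennreal (c * s * h s) \<partial>chi_square n)
      \<le> ennreal (h c * (real n * c)) + (\<integral>\<^sup>+s. ennreal (s\<^sup>2 * h s) \<partial>chi_square n)"
    by (simp add: add.commute mult_ac)
  then show ?thesis by (simp add: ennreal_add_left_cancel_le c_def)
qed

lemma nn_integral_sample_law:
  fixes \<theta> :: "real ^ 'p::finite"
  assumes v: "0 < v" and n: "0 < n" and f: "f \<in> borel_measurable (sample_law n \<theta> v)"
  shows "(\<integral>\<^sup>+z. f z \<partial>sample_law n \<theta> v) = (\<integral>\<^sup>+x. (\<integral>\<^sup>+s. f (x, v * s) \<partial>chi_square n) \<partial>multi_normal \<theta> v)"
proof -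
  interpret S: prob_space "scaled_chi_square v n" by (rule prob_space_scaled_chi_square[OF v n])
  have "(\<integral>\<^sup>+z. f z \<partial>sample_law n \<theta> v) = (\<integral>\<^sup>+x. (\<integral>\<^sup>+s. f (x, s) \<partial>scaled_chi_square v n) \<partial>multi_normal \<theta> v)"
    unfolding sample_law_def by (rule S.nn_integral_fst[symmetric]) (use f in \<open>simp add: sample_law_def\<close>)
  also have "\<dots> = (\<integral>\<^sup>+x. (\<integral>\<^sup>+s. f (x, v * s) \<partial>chi_square n) \<partial>multi_normal \<theta> v)"
  proof (rule nn_integral_cong)
    fix x :: "real ^ 'p"
    have "(\<lambda>s. f (x, s)) \<in> borel_measurable (scaled_chi_square v n)"
      using f unfolding sample_law_def by (rule measurable_Pair2) simp
    then have "(\<lambda>s. f (x, s)) \<in> borel_measurable (restrict_space borel {0<..})"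
      by (simp add: measurable_cong_sets[OF sets_scaled_chi_square refl])
    then show "(\<integral>\<^sup>+s. f (x, s) \<partial>scaled_chi_square v n) = (\<integral>\<^sup>+s. f (x, v * s) \<partial>chi_square n)"
      unfolding scaled_chi_square_def
      by (intro nn_integral_distr measurable_chi_square_scale v) simp
  qed
  finally show ?thesis .
qed

lemma sample_law_second_moment:
  fixes \<theta> :: "real ^ 'p::finite"
  assumes v: "0 < v" and n: "0 < n"
  shows "(\<integral>\<^sup>+z. ennreal ((snd z)\<^sup>2) \<partial>sample_law n \<theta> v) < \<infinity>"
proof -
  interpret M: prob_space "multi_normal \<theta> v" by (rule prob_space_multi_normal[OF v])
  have "(\<integral>\<^sup>+z. ennreal ((snd z)\<^sup>2) \<partial>sample_law n \<theta> v)
    = (\<integral>\<^sup>+x. (\<integral>\<^sup>+s. ennreal ((v * s)\<^sup>2) \<partial>chi_square n) \<partial>multi_normal \<theta> v)"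
    by (subst nn_integral_sample_law[OF v n]) auto
  also have "(\<integral>\<^sup>+s. ennreal ((v * s)\<^sup>2) \<partial>chi_square n) = ennreal (v\<^sup>2) * ennreal (real n * (real n + 2))"
    unfolding power_mult_distrib chi_square_second_moment[OF n, symmetric]
    by (subst ennreal_mult) (auto intro!: nn_integral_cmult)
  also have "(\<integral>\<^sup>+x. ennreal (v\<^sup>2) * ennreal (real n * (real n + 2)) \<partial>multi_normal \<theta> v) < \<infinity>"
    using M.emeasure_space_1 by (simp add: ennreal_mult[symmetric])
  finally show ?thesis .
qed

lemma sample_law_covariance:
  fixes \<theta> :: "real ^ 'p::finite"
  assumes v: "0 < v" and n: "0 < n" and km [measurable]: "k \<in> borel_measurable borel"
    and k0: "\<And>w. 0 \<le> k w" and anti: "antimono_on {0<..} k"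
  shows "(\<integral>\<^sup>+z. ennreal ((real n + 2) * v * snd z * k ((norm (fst z))\<^sup>2 / snd z)) \<partial>sample_law n \<theta> v)
    \<le> (\<integral>\<^sup>+z. ennreal ((snd z)\<^sup>2 * k ((norm (fst z))\<^sup>2 / snd z)) \<partial>sample_law n \<theta> v)"
proof -
  have "(\<integral>\<^sup>+s. ennreal ((real n + 2) * v * (v * s) * k ((norm x)\<^sup>2 / (v * s))) \<partial>chi_square n)
    \<le> (\<integral>\<^sup>+s. ennreal ((v * s)\<^sup>2 * k ((norm x)\<^sup>2 / (v * s))) \<partial>chi_square n)" for x :: "real ^ 'p"
  proof -
    define h where "h s = k ((norm x)\<^sup>2 / (v * s))" for s
    have [measurable]: "h \<in> borel_measurable borel" unfolding h_def by measurable
    have h0: "0 \<le> h s" for s by (simp add: h_def k0)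
    have mono: "mono_on {0<..} h"
    proof (rule mono_onI)
      fix r s :: real assume rs: "r \<in> {0<..}" "s \<in> {0<..}" "r \<le> s"
      show "h r \<le> h s"
      proof (cases "x = 0")
        case False
        then have "(norm x)\<^sup>2 / (v * s) \<le> (norm x)\<^sup>2 / (v * r)" "0 < (norm x)\<^sup>2 / (v * s)"
          using rs v by (auto intro!: divide_left_mono mult_left_mono divide_pos_pos mult_pos_pos)
        then show ?thesis unfolding h_def by (intro monotone_onD[OF anti]) auto
      qed (simp add: h_def)
    qed
    have "(\<integral>\<^sup>+s. ennreal ((real n + 2) * v * (v * s) * h s) \<partial>chi_square n)
        = ennreal (v\<^sup>2) * (\<integral>\<^sup>+s. ennreal ((real n + 2) * s * h s) \<partial>chi_square n)"
      using v by (subst nn_integral_cmult[symmetric])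
        (auto intro!: nn_integral_cong simp: ennreal_mult'[symmetric] power2_eq_square mult_ac)
    also have "\<dots> \<le> ennreal (v\<^sup>2) * (\<integral>\<^sup>+s. ennreal (s\<^sup>2 * h s) \<partial>chi_square n)"
      by (intro mult_left_mono chi_square_covariance[OF n _ h0 mono]) auto
    also have "\<dots> = (\<integral>\<^sup>+s. ennreal ((v * s)\<^sup>2 * h s) \<partial>chi_square n)"
      by (subst nn_integral_cmult[symmetric])
        (auto intro!: nn_integral_cong simp: ennreal_mult'[symmetric] power_mult_distrib mult_ac)
    finally show ?thesis by (simp add: h_def)
  qed
  note le = this
  have 1: "(\<integral>\<^sup>+z. ennreal ((real n + 2) * v * snd z * k ((norm (fst z))\<^sup>2 / snd z)) \<partial>sample_law n \<theta> v)
    = (\<integral>\<^sup>+x. (\<integral>\<^sup>+s. ennreal ((real n + 2) * v * (v * s) * k ((norm x)\<^sup>2 / (v * s))) \<partial>chi_square n) \<partial>multi_normal \<theta> v)"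
    by (subst nn_integral_sample_law[OF v n]) auto
  have 2: "(\<integral>\<^sup>+z. ennreal ((snd z)\<^sup>2 * k ((norm (fst z))\<^sup>2 / snd z)) \<partial>sample_law n \<theta> v)
    = (\<integral>\<^sup>+x. (\<integral>\<^sup>+s. ennreal ((v * s)\<^sup>2 * k ((norm x)\<^sup>2 / (v * s))) \<partial>chi_square n) \<partial>multi_normal \<theta> v)"
    by (subst nn_integral_sample_law[OF v n]) auto
  show ?thesis unfolding 1 2 by (rule nn_integral_mono) (rule le)
qed

lemma AE_sample_law_nonzero:
  fixes \<theta> :: "real ^ 'p::finite"
  assumes v: "0 < v" and n: "0 < n"
  shows "AE z in sample_law n \<theta> v. fst z \<noteq> 0"
proof -
  interpret S: prob_space "scaled_chi_square v n" by (rule prob_space_scaled_chi_square[OF v n])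
  have D: "distr (sample_law n \<theta> v) (multi_normal \<theta> v) fst = multi_normal \<theta> v"
    unfolding sample_law_def by (rule S.distr_pair_fst)
  have fm: "fst \<in> sample_law n \<theta> v \<rightarrow>\<^sub>M multi_normal \<theta> v" by (simp add: sample_law_def)
  have "AE x in multi_normal \<theta> v. x \<noteq> 0"
    unfolding multi_normal_def
    by (subst AE_density) (auto intro: eventually_mono[OF AE_lborel_singleton[of 0]])
  then have "AE x in distr (sample_law n \<theta> v) (multi_normal \<theta> v) fst. x \<noteq> 0" by (simp only: D)
  then show ?thesis by (rule AE_distrD[OF fm])
qed

section \<open>Comparison of the losses\<close>

lemma borel_measurable_mono_on_positive:
  fixes f :: "real \<Rightarrow> real"
  assumes "mono_on {0<..} f"
  shows "(\<lambda>w. if 0 < w then f w else 0) \<in> borel_measurable borel"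
proof -
  have "f \<in> borel_measurable (restrict_space borel {0<..})" by (rule borel_measurable_mono_on_fnc[OF assms])
  then have "(\<lambda>w. indicator {0<..} w *\<^sub>R f w) \<in> borel_measurable borel"
    by (subst (asm) borel_measurable_restrict_space_iff) auto
  moreover have "(\<lambda>w. indicator {0<..} w *\<^sub>R f w) = (\<lambda>w. if 0 < w then f w else 0)"
    by (auto simp: fun_eq_iff indicator_def)
  ultimately show ?thesis by simp
qed

lemma mono_on_le_limit:
  fixes f :: "real \<Rightarrow> real"
  assumes mono: "mono_on {0<..} f" and lim: "(f \<longlongrightarrow> l) at_top" and w: "0 < w"
  shows "f w \<le> l"
proof (rule tendsto_lowerbound[OF lim])
  show "\<forall>\<^sub>F x in at_top. f w \<le> f x"
    using eventually_ge_at_top[of w] by eventually_elim (use w in \<open>auto intro: mono_onD[OF mono]\<close>)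
qed simp

text \<open>The two factors \<open>a\<^sub>0\<^sup>2 - a\<^sup>2\<close> and \<open>b\<^sub>0\<^sup>2 - b\<^sup>2\<close> of the loss difference contain
  \<open>G (1 + X)\<close> and \<open>G (1 + Y) - 2 g\<close>, each at least \<open>2 \<kappa>\<close> unless \<open>X = 1\<close>, \<open>Y = 1\<close>.\<close>
lemma loss_difference_bound:
  fixes s G X Y g \<kappa> c r t u T :: real
  assumes s: "0 < s" and G: "0 < G" and X: "X \<le> 1" and Y: "Y \<le> 1" and r: "0 \<le> r"
    and X': "X < 1 \<Longrightarrow> \<kappa> \<le> G * X" and Y': "Y < 1 \<Longrightarrow> g + \<kappa> \<le> G * Y"
    and u: "u \<le> r * (c * \<kappa>)" and t: "t \<le> c * \<kappa>"
  defines "L \<equiv> \<lambda>X Y. r * (s * (G * X))\<^sup>2 + (s * (G * Y - g))\<^sup>2 - 2 * (s * (G * X) * u + s * (G * Y - g) * t) + T"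
  shows "L X Y + 2 * \<kappa> * (s\<^sup>2 * (G * (r * (1 - X) + (1 - Y)))) \<le> L 1 1 + 2 * \<kappa> * (c * s * (G * (r * (1 - X) + (1 - Y))))"
proof -
  \<comment> \<open>In the application r = p - 1, t is the Rayleigh quotient of M at x, u = trace M
    - t, and c = (n + 2) \<sigma>^2. \<open>A\<close> and \<open>B\<close> are the drops of the two
    eigenvalues of the estimator; where X = 1 or Y = 1 the drop is 0 and nothing is to be
    shown.\<close>
  define A where "A = s * G * (1 - X)"
  define B where "B = s * G * (1 - Y)"
  have A0: "0 \<le> A" and B0: "0 \<le> B" using s G X Y by (auto simp: A_def B_def)
  have 1: "A * (r * (2 * s * \<kappa>) - 2 * (r * (c * \<kappa>))) \<le> A * (r * (s * (G * (1 + X))) - 2 * u)"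
  proof (cases "X < 1")
    case True
    then have "\<kappa> \<le> G * X" "G * X \<le> G" using X' G by (auto simp: mult_le_cancel_left1)
    then have "2 * \<kappa> \<le> G * (1 + X)" by (simp add: distrib_left)
    then have "s * (2 * \<kappa>) \<le> s * (G * (1 + X))" by (rule mult_left_mono) (use s in simp)
    then have "r * (s * (2 * \<kappa>)) \<le> r * (s * (G * (1 + X)))" by (rule mult_left_mono) (use r in simp)
    then have "r * (2 * s * \<kappa>) - 2 * (r * (c * \<kappa>)) \<le> r * (s * (G * (1 + X))) - 2 * u"
      using u by (simp add: mult_ac)
    then show ?thesis using A0 by (rule mult_left_mono)
  qed (use X in \<open>simp add: A_def\<close>)
  have 2: "B * (2 * s * \<kappa> - 2 * (c * \<kappa>)) \<le> B * (s * (G * (1 + Y) - 2 * g) - 2 * t)"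
  proof (cases "Y < 1")
    case True
    then have "g + \<kappa> \<le> G * Y" "G * Y \<le> G" using Y' G by (auto simp: mult_le_cancel_left1)
    then have "2 * \<kappa> \<le> G * (1 + Y) - 2 * g" by (simp add: distrib_left)
    then have "s * (2 * \<kappa>) \<le> s * (G * (1 + Y) - 2 * g)" by (rule mult_left_mono) (use s in simp)
    then have "2 * s * \<kappa> - 2 * (c * \<kappa>) \<le> s * (G * (1 + Y) - 2 * g) - 2 * t"
      using t by (simp add: mult_ac)
    then show ?thesis using B0 by (rule mult_left_mono)
  qed (use Y in \<open>simp add: B_def\<close>)
  have "L 1 1 - L X Y = A * (r * (s * (G * (1 + X))) - 2 * u) + B * (s * (G * (1 + Y) - 2 * g) - 2 * t)"
    by (simp add: L_def A_def B_def algebra_simps power2_eq_square)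
  moreover have "2 * \<kappa> * (s\<^sup>2 * (G * (r * (1 - X) + (1 - Y)))) - 2 * \<kappa> * (c * s * (G * (r * (1 - X) + (1 - Y))))
     = A * (r * (2 * s * \<kappa>) - 2 * (r * (c * \<kappa>))) + B * (2 * s * \<kappa> - 2 * (c * \<kappa>))"
    by (simp add: A_def B_def algebra_simps power2_eq_square)
  ultimately show ?thesis using 1 2 by linarith
qed

lemma trace_le_quadratic:
  fixes M :: "real ^ 'p::finite ^ 'p"
  assumes "\<And>v. v \<bullet> (M *v v) \<le> m * (norm v)\<^sup>2"
  shows "trace M \<le> real CARD('p) * m"
proof -
  have "M $ i $ i \<le> m" for i
    using assms[of "axis i 1"] by (simp add: inner_commute[of "axis i 1"] inner_axis matrix_vector_mul_component)
  then have "trace M \<le> (\<Sum>i\<in>(UNIV :: 'p set). m)" unfolding trace_def by (intro sum_mono) auto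
  then show ?thesis by simp
qed

text \<open>\<open>risk\<close> passes the loss through \<open>ennreal\<close>, which would cut
  negative values to 0; for a symmetric estimate the loss is a squared Frobenius norm, so nothing is
  lost.\<close>

lemma matrix_loss_nonneg:
  assumes n: "0 < n" and cont: "continuous_on {0<..} \<phi>"
    and imp: "improves_on n squared_error (shrinkage \<phi>) (\<lambda>(x :: real ^ 'p::finite) s. x)"
    and v: "0 < v" and A: "\<And>i j. A $ i $ j = A $ j $ i"
  shows "0 \<le> matrix_loss n (shrinkage \<phi>) (\<theta> :: real ^ 'p) v A"
proof -
  have e: "v = (sqrt v)\<^sup>2" and s: "0 < sqrt v" using v by auto
  have "risk_reduction_matrix n (shrinkage \<phi>) \<theta> v $ i $ j = risk_reduction_matrix n (shrinkage \<phi>) \<theta> v $ j $ i" for i j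
    using risk_reduction_symmetric[OF n cont imp s, of \<theta> i j] e by simp
  then show ?thesis
    unfolding matrix_loss_def Let_def by (intro trace_square_nonneg) (simp add: A)
qed

lemma M_hat_symmetric: "M_hat n \<phi> \<xi> \<eta> x s $ i $ j = M_hat n \<phi> \<xi> \<eta> x s $ j $ i"
  using proj_symmetric[of x i j] by (simp add: M_hat_def Let_def mat_def)

lemma M_hat_eq: "M_hat n \<phi> \<xi> \<eta> x s
   = (s * (g1 n \<phi> (W_stat x s) * \<xi> (W_stat x s))) *\<^sub>R (mat 1 - proj x)
     + (s * (g1 n \<phi> (W_stat x s) * \<eta> (W_stat x s) - g3 n \<phi> (W_stat x s))) *\<^sub>R proj x"
  by (simp add: M_hat_def Let_def scaleR_add_right)

theorem theorem7:
  fixes n :: nat and \<phi> \<xi> \<eta> :: "real \<Rightarrow> real"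
  assumes p_ge_3: "CARD('p::finite) \<ge> 3"
    and n_ge_1: "n \<ge> 1"
    and phi_lac: "locally_abs_continuous \<phi>"
    and phi'_finite: "AE w in lborel. 0 < w \<longrightarrow> \<phi> differentiable (at w)"
    and phi_improves:
      "improves_on n squared_error (shrinkage \<phi>) (\<lambda>(x :: real ^ 'p) s. x)"
    and g1_exists: "\<And>w. 0 < w \<Longrightarrow> set_integrable lborel {w<..} (g_integrand n (h1 \<phi>))"
    and g2_exists: "\<And>w. 0 < w \<Longrightarrow> set_integrable lborel {w<..} (g_integrand n (h2 \<phi>))"
    and g1_pos: "\<And>w. 0 < w \<Longrightarrow> 0 < g1 n \<phi> w"
    and beta2_exists:
      "\<And>j. integrable (chi_square (CARD('p) + 2 * j) \<Otimes>\<^sub>M chi_square n)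
             (beta2_integrand (CARD('p)) n \<phi> j)"
    and g1_nonincreasing: "antimono_on {0<..} (g1 n \<phi>)"
    and g3_g1_nondecreasing: "mono_on {0<..} (\<lambda>w. g3 n \<phi> w / g1 n \<phi> w)"
    and xi_nondecreasing: "mono_on {0<..} \<xi>"
    and eta_nondecreasing: "mono_on {0<..} \<eta>"
    and xi_lim: "(\<xi> \<longlongrightarrow> 1) at_top"
    and eta_lim: "(\<eta> \<longlongrightarrow> 1) at_top"
    and xi_ge: "\<And>w. 0 < w \<Longrightarrow> xi2 (CARD('p)) n \<phi> w \<le> ereal (\<xi> w)"
    and eta_ge: "\<And>w. 0 < w \<Longrightarrow> eta2 (CARD('p)) n \<phi> w \<le> ereal (\<eta> w)"
  shows "improves_on n
           (matrix_loss n (shrinkage \<phi> :: real ^ 'p \<Rightarrow> real \<Rightarrow> real ^ 'p))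
           (M_hat n \<phi> \<xi> \<eta>) (M_hat0 n \<phi>)"
proof -
  have n: "0 < n" using n_ge_1 by simp
  note cont = locally_abs_continuous_imp_continuous_on[OF phi_lac]
  let ?P = "CARD('p)"
  have P3: "3 \<le> real ?P" using p_ge_3 by simp

  \<comment> \<open>Mixture components and their bounds by the beta terms\<close>
  define \<psi> where "\<psi> w = (if 0 < w then \<phi> w / w else 0)" for w
  have \<psi>_eq: "\<psi> = (\<lambda>w. if 0 < w then \<phi> w / w else 0)" by (simp add: \<psi>_def fun_eq_iff)
  have \<psi>m: "\<psi> \<in> borel_measurable borel"
    unfolding \<psi>_eq by (rule borel_measurable_shrink_factor[OF n cont phi_improves])
  have g1_eq: "g1 n \<phi> w = w powr (real n / 2) * (LINT t:{w<..}|lborel. t powr (- (real n / 2)) * (\<psi> t / t))" if w: "0 < w" for w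
  proof -
    have "(LINT t:{w<..}|lborel. g_integrand n (h1 \<phi>) t) = (LINT t:{w<..}|lborel. t powr (- (real n / 2)) * (\<psi> t / t))"
      using w by (intro set_lebesgue_integral_cong) (auto simp: g_integrand_def h1_def \<psi>_def)
    then show ?thesis by (simp add: g1_def g_transform_def)
  qed
  have anti: "antimono_on {0<..} (\<lambda>w. w powr (real n / 2) * (LINT t:{w<..}|lborel. t powr (- (real n / 2)) * (\<psi> t / t)))"
  proof (rule monotone_onI)
    fix x y :: real assume xy: "x \<in> {0<..}" "y \<in> {0<..}" "x \<le> y"
    then show "y powr (real n / 2) * (LINT t:{y<..}|lborel. t powr (- (real n / 2)) * (\<psi> t / t))
        \<le> x powr (real n / 2) * (LINT t:{x<..}|lborel. t powr (- (real n / 2)) * (\<psi> t / t))"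
      using monotone_onD[OF g1_nonincreasing xy] g1_eq[of x] g1_eq[of y] by simp
  qed
  have sq: "integrable (ratio_law (?P + 2 * j + 2) n) (\<lambda>w. (\<psi> w)\<^sup>2)" for j
  proof (rule ratio_law_integrable_mono[of "?P + 2"])
    show "integrable (ratio_law (?P + 2) n) (\<lambda>w. (\<psi> w)\<^sup>2)"
    proof (rule integrable_ratio_law_square[OF n \<psi>m, where 'p='p])
      show "integrable (base_law n) (\<lambda>z :: (real ^ 'p) \<times> real. (\<psi> ((norm (fst z))\<^sup>2 / snd z))\<^sup>2 * (norm (fst z))\<^sup>2)"
        using integrable_shrink_square[OF n cont phi_improves, of 0] unfolding \<psi>_eq by simp
    qed
    show "(\<lambda>w. (\<psi> w)\<^sup>2) \<in> borel_measurable borel" using \<psi>m by measurable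
  qed (use n in auto)
  have beta: "integral\<^sup>L (ratio_law (?P + 2 * j + 2) n) (\<lambda>w. 2 * \<psi> w - (\<psi> w)\<^sup>2) \<le> beta2_term ?P n \<phi> j" for j
  proof -
    have N: "3 \<le> ?P + 2 * j" using p_ge_3 by simp
    have i: "integrable (chi_square (?P + 2 * j) \<Otimes>\<^sub>M chi_square n)
        (\<lambda>(u, v). 2 * \<phi> (u / v) / (u / v) - b_fun n \<phi> (u / v) / real (?P + 2 * j))"
      using beta2_exists[of j] by (simp add: beta2_integrand_def)
    show ?thesis
      using beta2_integral_lower_bound[OF N n phi_lac phi'_finite sq[of j, unfolded \<psi>_eq] i]
      unfolding \<psi>_eq by (simp add: beta2_term_def beta2_integrand_def)
  qed
  have beta_le: "ereal (beta2_term ?P n \<phi> j) \<le> beta2 ?P n \<phi>" for j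
    unfolding beta2_def by (rule SUP_upper) simp
  have xi_le: "\<xi> w \<le> 1" and eta_le: "\<eta> w \<le> 1" if "0 < w" for w
    using mono_on_le_limit[OF xi_nondecreasing xi_lim that] mono_on_le_limit[OF eta_nondecreasing eta_lim that] by auto
  have W_pos: "0 < W_stat x s" if "x \<noteq> 0" "0 < s" for x :: "real ^ 'p" and s
    using that by (simp add: W_stat_def)

  show ?thesis
    unfolding improves_on_def
  proof (intro allI impI)
    fix \<theta> :: "real ^ 'p" and v :: real assume v: "0 < v"
    define L where "L = matrix_loss n (shrinkage \<phi> :: real ^ 'p \<Rightarrow> real \<Rightarrow> real ^ 'p) \<theta> v"
    have risk_eq: "risk n (matrix_loss n (shrinkage \<phi>)) T \<theta> v = (\<integral>\<^sup>+z. ennreal (L (T (fst z) (snd z))) \<partial>sample_law n \<theta> v)"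
      for T :: "real ^ 'p \<Rightarrow> real \<Rightarrow> real ^ 'p ^ 'p"
      by (simp add: risk_def L_def case_prod_unfold)
    have AE_pos: "AE z in sample_law n \<theta> v. fst z \<noteq> 0 \<and> 0 < snd z"
      using AE_sample_law_nonzero[OF v n, of \<theta>] AE_space by eventually_elim auto
    show "risk n (matrix_loss n (shrinkage \<phi>)) (M_hat n \<phi> \<xi> \<eta>) \<theta> v \<le> risk n (matrix_loss n (shrinkage \<phi>)) (M_hat0 n \<phi>) \<theta> v"
    proof (cases "beta2 ?P n \<phi> = \<infinity>")
      case True
      \<comment> \<open>An infinite supremum makes both lower bounds equal to 1, and a nondecreasing
        function with limit 1 is at most 1. So the two estimators agree almost everywhere.\<close>
      have one: "\<xi> w = 1 \<and> \<eta> w = 1" if w: "0 < w" for w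
      proof -
        have inf: "ereal (1 / g1 n \<phi> w) * \<infinity> = \<infinity>" using g1_pos[OF w] by simp
        have "\<infinity> / ereal (real n + 2) = \<infinity>" by (simp add: ereal_divide_eq)
        then have "xi2 ?P n \<phi> w = 1" "eta2 ?P n \<phi> w = 1"
          using inf by (simp_all add: xi2_def eta2_def True)
        then show ?thesis
          using xi_ge[OF w] eta_ge[OF w] xi_le[OF w] eta_le[OF w] by (simp add: one_ereal_def)
      qed
      have "M_hat n \<phi> \<xi> \<eta> x s = M_hat0 n \<phi> x s" if "x \<noteq> 0" "0 < s" for x :: "real ^ 'p" and s
        using one[OF W_pos[OF that]] by (simp add: M_hat0_def M_hat_eq)
      then have "AE z in sample_law n \<theta> v. ennreal (L (M_hat n \<phi> \<xi> \<eta> (fst z) (snd z))) = ennreal (L (M_hat0 n \<phi> (fst z) (snd z)))"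
        by (intro eventually_mono[OF AE_pos]) simp
      then show ?thesis unfolding risk_eq by (intro eq_refl nn_integral_cong_AE)
    next
      case False
      have "beta2 ?P n \<phi> \<noteq> - \<infinity>" using beta_le[of 0] by auto
      then obtain b where b: "beta2 ?P n \<phi> = ereal b" using False by (cases "beta2 ?P n \<phi>") auto
      define \<kappa> where "\<kappa> = b / (real n + 2)"
      define c where "c = (real n + 2) * v"
      define M where "M = risk_reduction_matrix n (shrinkage \<phi>) \<theta> v"
      have s: "0 < sqrt v" using v by auto
      have c\<kappa>: "c * \<kappa> = v * b" by (simp add: c_def \<kappa>_def)
      have le: "x \<bullet> (M *v x) \<le> c * \<kappa> * (norm x)\<^sup>2" for x
      proof -
        have "integral\<^sup>L (ratio_law (?P + 2 * j + 2) n) (\<lambda>w. 2 * \<psi> w - (\<psi> w)\<^sup>2) \<le> b" for j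
          using beta[of j] beta_le[of j] b by simp
        from risk_reduction_quadratic_le[OF n cont phi_improves s this[unfolded \<psi>_eq] anti[unfolded \<psi>_eq], of x \<theta>]
        show ?thesis unfolding c\<kappa> M_def using v by simp
      qed
      have Msym: "M $ i $ j = M $ j $ i" for i j
        using risk_reduction_symmetric[OF n cont phi_improves s, of \<theta> i j] v by (simp add: M_def)
      have "0 \<le> trace M"
        using trace_risk_reduction_nonneg[OF n cont phi_improves s, of \<theta>] v by (simp add: M_def)
      also have "\<dots> \<le> real ?P * (c * \<kappa>)" by (rule trace_le_quadratic[OF le])
      finally have "0 \<le> c * \<kappa>" using P3 by (simp add: zero_le_mult_iff)
      moreover have "0 < c" using v by (simp add: c_def)
      ultimately have \<kappa>0: "0 \<le> \<kappa>" by (simp add: zero_le_mult_iff)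
      have div: "ereal b / ereal (real n + 2) = ereal \<kappa>" by (simp add: \<kappa>_def)
      \<comment> \<open>Where \<open>\<xi>\<close> is below 1, the minimum in \<open>xi2\<close>
        must be its second branch; likewise for \<open>\<eta>\<close> below.\<close>
      have xi': "\<kappa> \<le> g1 n \<phi> w * \<xi> w" if w: "0 < w" "\<xi> w < 1" for w
      proof -
        have "min 1 (ereal (1 / g1 n \<phi> w * \<kappa>)) \<le> ereal (\<xi> w)"
          using xi_ge[OF w(1)] unfolding xi2_def b div by simp
        then have "\<kappa> / g1 n \<phi> w \<le> \<xi> w"
          using w(2) by (auto simp: min_def one_ereal_def split: if_splits)
        then show ?thesis using g1_pos[OF w(1)] by (simp add: divide_le_eq mult.commute)
      qed
      have eta': "g3 n \<phi> w + \<kappa> \<le> g1 n \<phi> w * \<eta> w" if w: "0 < w" "\<eta> w < 1" for w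
      proof -
        have "min 1 (ereal (1 / g1 n \<phi> w * (g3 n \<phi> w + \<kappa>))) \<le> ereal (\<eta> w)"
          using eta_ge[OF w(1)] unfolding eta2_def b div by simp
        then have "(g3 n \<phi> w + \<kappa>) / g1 n \<phi> w \<le> \<eta> w"
          using w(2) by (auto simp: min_def one_ereal_def split: if_splits)
        then show ?thesis using g1_pos[OF w(1)] by (simp add: divide_le_eq mult.commute)
      qed
      let ?r = "real ?P - 1"
      define T where "T = trace (M ** M)"
      \<comment> \<open>Copies set to 0 off the half-line, so that they are Borel on all reals; W is
        positive almost surely.\<close>
      define G where "G w = (if 0 < w then g1 n \<phi> w else 0)" for w
      define g where "g w = (if 0 < w then g3 n \<phi> w else 0)" for w
      define X where "X w = (if 0 < w then \<xi> w else 0)" for w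
      define Y where "Y w = (if 0 < w then \<eta> w else 0)" for w
      define W where "W z = (norm (fst z))\<^sup>2 / snd z" for z :: "(real ^ 'p) \<times> real"
      define t where "t z = fst z \<bullet> (M *v fst z) / (norm (fst z))\<^sup>2" for z :: "(real ^ 'p) \<times> real"
      \<comment> \<open>The expanded loss of a matrix with eigenvalue
        \<open>snd z * (G (W z) * p)\<close> across x and
        \<open>snd z * (G (W z) * q - g (W z))\<close> along x; \<open>t\<close> is the Rayleigh
        quotient of \<open>M\<close> at x.\<close>
      define F where "F p q z = ?r * (snd z * (G (W z) * p))\<^sup>2 + (snd z * (G (W z) * q - g (W z)))\<^sup>2
          - 2 * (snd z * (G (W z) * p) * (trace M - t z) + snd z * (G (W z) * q - g (W z)) * t z) + T"
        for p q :: real and z :: "(real ^ 'p) \<times> real"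
      define k where "k w = G w * (?r * (1 - X w) + (1 - Y w))" for w

      \<comment> \<open>Measurability, obtained from monotonicity\<close>
      have [measurable]: "X \<in> borel_measurable borel" "Y \<in> borel_measurable borel"
        unfolding X_def Y_def
        by (rule borel_measurable_mono_on_positive[OF xi_nondecreasing] borel_measurable_mono_on_positive[OF eta_nondecreasing])+
      have Gm [measurable]: "G \<in> borel_measurable borel"
      proof -
        have "mono_on {0<..} (\<lambda>w. - g1 n \<phi> w)"
          by (rule mono_onI) (use monotone_onD[OF g1_nonincreasing] in auto)
        from borel_measurable_uminus[OF borel_measurable_mono_on_positive[OF this]]
        show ?thesis by (rule measurable_cong[THEN iffD1, rotated]) (simp add: G_def)
      qed
      have [measurable]: "g \<in> borel_measurable borel"
      proof -
        \<comment> \<open>g3 is the product of the monotone quotient g3/g1 and the monotone g1,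
          hence Borel.\<close>
        have "(\<lambda>w. (if 0 < w then g3 n \<phi> w / g1 n \<phi> w else 0) * G w) \<in> borel_measurable borel"
          by (rule borel_measurable_times[OF borel_measurable_mono_on_positive[OF g3_g1_nondecreasing] Gm])
        moreover have "(\<lambda>w. (if 0 < w then g3 n \<phi> w / g1 n \<phi> w else 0) * G w) = g"
        proof
          fix w show "(if 0 < w then g3 n \<phi> w / g1 n \<phi> w else 0) * G w = g w"
            using g1_pos[of w] by (auto simp: G_def g_def)
        qed
        ultimately show ?thesis by simp
      qed
      have [measurable]: "k \<in> borel_measurable borel" unfolding k_def by measurable
      have [measurable]: "W \<in> borel_measurable (sample_law n \<theta> v)" unfolding W_def by measurable
      have [measurable]: "(\<lambda>x. M *v x) \<in> borel_measurable borel"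
        by (rule borel_measurable_continuous_onI[OF linear_continuous_on[OF matrix_vector_mul_bounded_linear]])
      have [measurable]: "t \<in> borel_measurable (sample_law n \<theta> v)" unfolding t_def by measurable
      have [measurable]: "(\<lambda>z. F (X (W z)) (Y (W z)) z) \<in> borel_measurable (sample_law n \<theta> v)"
        "(\<lambda>z. F 1 1 z) \<in> borel_measurable (sample_law n \<theta> v)"
        unfolding F_def by measurable

      \<comment> \<open>Sign and monotonicity of the weight \<open>k\<close>\<close>
      have G0: "0 \<le> G w" for w using g1_pos[of w] by (simp add: G_def less_imp_le)
      have X1: "X w \<le> 1" and Y1: "Y w \<le> 1" for w using xi_le[of w] eta_le[of w] by (auto simp: X_def Y_def)
      have r0: "0 \<le> ?r" "1 \<le> ?r" using P3 by auto
      have k0: "0 \<le> k w" for w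
        unfolding k_def using G0[of w] X1[of w] Y1[of w] r0 by (intro mult_nonneg_nonneg add_nonneg_nonneg) auto
      have k_anti: "antimono_on {0<..} k"
      proof (rule monotone_onI)
        fix x y :: real assume xy: "x \<in> {0<..}" "y \<in> {0<..}" "x \<le> y"
        have "G y \<le> G x" using monotone_onD[OF g1_nonincreasing xy] xy by (simp add: G_def)
        moreover have "X x \<le> X y" "Y x \<le> Y y"
          using mono_onD[OF xi_nondecreasing xy] mono_onD[OF eta_nondecreasing xy] xy by (auto simp: X_def Y_def)
        then have "?r * (1 - X y) + (1 - Y y) \<le> ?r * (1 - X x) + (1 - Y x)"
          using r0 by (intro add_mono mult_left_mono) auto
        ultimately show "k y \<le> k x"
          unfolding k_def using G0 X1[of y] Y1[of y] r0
          by (intro mult_mono add_nonneg_nonneg mult_nonneg_nonneg) auto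
      qed

      \<comment> \<open>Risk comparison up to the covariance term\<close>
      have loss: "L (M_hat n \<phi> \<xi>' \<eta>' (fst z) (snd z)) = F (\<xi>' (W z)) (\<eta>' (W z)) z"
        if z: "fst z \<noteq> 0 \<and> 0 < snd z" for z :: "(real ^ 'p) \<times> real" and \<xi>' \<eta>'
      proof -
        have "0 < W z" using z by (simp add: W_def)
        then show ?thesis
          using trace_spectral_diff_square[of "fst z"] z
          unfolding L_def matrix_loss_def Let_def M_def[symmetric] M_hat_eq
          by (simp add: F_def G_def g_def t_def T_def W_stat_def W_def[symmetric])
      qed
      have XY: "X (W z) = \<xi> (W z)" "Y (W z) = \<eta> (W z)" "G (W z) = g1 n \<phi> (W z)" "g (W z) = g3 n \<phi> (W z)" "0 < W z"
        if "fst z \<noteq> 0 \<and> 0 < snd z" for z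
        using that by (auto simp: X_def Y_def G_def g_def W_def)
      have loss_nn: "0 \<le> L (M_hat n \<phi> \<xi>' \<eta>' x s)" for \<xi>' \<eta>' x s
        unfolding L_def by (rule matrix_loss_nonneg[OF n cont phi_improves v M_hat_symmetric])
      define R1 where "R1 = (\<integral>\<^sup>+z. ennreal (F (X (W z)) (Y (W z)) z) \<partial>sample_law n \<theta> v)"
      define R0 where "R0 = (\<integral>\<^sup>+z. ennreal (F 1 1 z) \<partial>sample_law n \<theta> v)"
      have risk1: "risk n (matrix_loss n (shrinkage \<phi>)) (M_hat n \<phi> \<xi> \<eta>) \<theta> v = R1"
        unfolding risk_eq R1_def
        by (intro nn_integral_cong_AE eventually_mono[OF AE_pos]) (simp add: loss XY)
      have risk0: "risk n (matrix_loss n (shrinkage \<phi>)) (M_hat0 n \<phi>) \<theta> v = R0"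
        unfolding risk_eq R0_def M_hat0_def
        by (intro nn_integral_cong_AE eventually_mono[OF AE_pos]) (simp add: loss)
      define I2 where "I2 = (\<integral>\<^sup>+z. ennreal ((snd z)\<^sup>2 * k (W z)) \<partial>sample_law n \<theta> v)"
      define I1 where "I1 = (\<integral>\<^sup>+z. ennreal (c * snd z * k (W z)) \<partial>sample_law n \<theta> v)"
      have "I1 \<le> I2"
        unfolding I1_def I2_def c_def W_def by (rule sample_law_covariance[OF v n _ k0 k_anti]) measurable
      \<comment> \<open>The loss comparison in additive form, as subtraction in extended reals would
        not be faithful.\<close>
      have "R1 + ennreal (2 * \<kappa>) * I2 = (\<integral>\<^sup>+z. ennreal (F (X (W z)) (Y (W z)) z) + ennreal (2 * \<kappa>) * ennreal ((snd z)\<^sup>2 * k (W z)) \<partial>sample_law n \<theta> v)"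
        unfolding R1_def I2_def by (simp add: nn_integral_add nn_integral_cmult)
      also have "\<dots> \<le> (\<integral>\<^sup>+z. ennreal (F 1 1 z) + ennreal (2 * \<kappa>) * ennreal (c * snd z * k (W z)) \<partial>sample_law n \<theta> v)"
      proof (rule nn_integral_mono_AE, rule eventually_mono[OF AE_pos])
        fix z :: "(real ^ 'p) \<times> real" assume z: "fst z \<noteq> 0 \<and> 0 < snd z"
        have tz: "t z \<le> c * \<kappa>"
          using le[of "fst z"] z by (simp add: t_def divide_le_eq)
        have uz: "trace M - t z \<le> ?r * (c * \<kappa>)"
          unfolding t_def by (rule trace_complement_le[OF _ le]) (use z in simp)
        have "F (X (W z)) (Y (W z)) z + 2 * \<kappa> * ((snd z)\<^sup>2 * k (W z)) \<le> F 1 1 z + 2 * \<kappa> * (c * snd z * k (W z))"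
          unfolding F_def k_def
          by (rule loss_difference_bound) (use z XY[OF z] xi_le eta_le xi' eta' g1_pos r0 tz uz in auto)
        moreover have "0 \<le> F (X (W z)) (Y (W z)) z" "0 \<le> F 1 1 z"
          using loss_nn[of \<xi> \<eta> "fst z" "snd z"] loss_nn[of "\<lambda>_. 1" "\<lambda>_. 1" "fst z" "snd z"] by (simp_all add: loss[OF z] XY[OF z])
        moreover have "0 \<le> c * snd z * k (W z)" using \<open>0 < c\<close> z k0 by simp
        ultimately show "ennreal (F (X (W z)) (Y (W z)) z) + ennreal (2 * \<kappa>) * ennreal ((snd z)\<^sup>2 * k (W z))
            \<le> ennreal (F 1 1 z) + ennreal (2 * \<kappa>) * ennreal (c * snd z * k (W z))"
          using \<kappa>0 k0[of "W z"]
          by (simp add: ennreal_mult[symmetric] ennreal_plus[symmetric] ennreal_leI del: ennreal_plus)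
      qed
      also have "\<dots> = R0 + ennreal (2 * \<kappa>) * I1"
        unfolding R0_def I1_def by (simp add: nn_integral_add nn_integral_cmult)
      also have "\<dots> \<le> R0 + ennreal (2 * \<kappa>) * I2"
        using \<open>I1 \<le> I2\<close> by (intro add_left_mono mult_left_mono) auto
      finally have main: "R1 + ennreal (2 * \<kappa>) * I2 \<le> R0 + ennreal (2 * \<kappa>) * I2" .
      \<comment> \<open>Cancelling requires \<open>I2\<close> to be finite. This is derived from
        finiteness of \<open>R0\<close>; if \<open>R0\<close> is infinite there is nothing to
        prove.\<close>
      have "R1 \<le> R0"
      proof (cases "R0 = \<infinity>")
        case False
        have "I2 \<le> (\<integral>\<^sup>+z. ennreal (real ?P) * ennreal ((snd z)\<^sup>2) + (2 * ennreal (F 1 1 z) + ennreal (2 * \<bar>T\<bar>)) \<partial>sample_law n \<theta> v)"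
          unfolding I2_def
        proof (rule nn_integral_mono_AE, rule eventually_mono[OF AE_pos])
          fix z :: "(real ^ 'p) \<times> real" assume z: "fst z \<noteq> 0 \<and> 0 < snd z"
          define s where "s = snd z"
          define a where "a = s * G (W z)"
          define d where "d = s * (G (W z) - g (W z))"
          have s0: "0 < s" using z by (simp add: s_def)
          have a0: "0 \<le> a" using s0 G0 by (simp add: a_def)
          have F1: "F 1 1 z = ?r * a\<^sup>2 + d\<^sup>2 - 2 * (a * (trace M - t z) + d * t z) + T"
            by (simp add: F_def a_def d_def s_def)
          \<comment> \<open>For the unbiased estimate A, the identity |A - 2M|^2 = 2 |A - M|^2 + 2
            |M|^2 - |A|^2 in the Frobenius norm bounds |A|^2 by twice the loss plus twice
            \<open>T\<close>.\<close>
          have "0 \<le> ?r * a\<^sup>2 + d\<^sup>2 - 2 * (a * (2 * (trace M - t z)) + d * (2 * t z)) + 4 * T"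
          proof -
            define A where "A = a *\<^sub>R (mat 1 - proj (fst z)) + d *\<^sub>R proj (fst z)"
            have "0 \<le> trace ((A - 2 *\<^sub>R M) ** (A - 2 *\<^sub>R M))"
              by (rule trace_square_nonneg) (use Msym proj_symmetric[of "fst z"] in \<open>simp add: A_def mat_def\<close>)
            also have "\<dots> = ?r * a\<^sup>2 + d\<^sup>2 - 2 * (a * (2 * (trace M - t z)) + d * (2 * t z)) + 4 * T"
              using trace_spectral_diff_square[of "fst z" a d "2 *\<^sub>R M"] z
              by (simp add: A_def T_def t_def trace_scaleR trace_scaleR_mult scaleR_matrix_vector_assoc[symmetric]
                  matrix_scalar_ac scalar_matrix_assoc[symmetric] right_diff_distrib)
            finally show ?thesis .
          qed
          then have bd: "?r * a\<^sup>2 + d\<^sup>2 \<le> 2 * F 1 1 z + 2 * T"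
            unfolding F1 by (simp add: algebra_simps)
          have X0: "s * (a * (1 - X (W z))) \<le> s * a"
          proof -
            have "0 \<le> X (W z)"
            proof (cases "\<xi> (W z) < 1")
              case True
              then have "0 \<le> g1 n \<phi> (W z) * \<xi> (W z)" using xi'[OF XY(5)[OF z]] \<kappa>0 by linarith
              then show ?thesis using g1_pos[OF XY(5)[OF z]] XY[OF z] by (simp add: zero_le_mult_iff)
            qed (use XY[OF z] in simp)
            then have "a * (1 - X (W z)) \<le> a * 1" using a0 by (intro mult_left_mono) auto
            then show ?thesis using s0 by simp
          qed
          \<comment> \<open>Since G Y >= g + \<kappa> >= g wherever Y < 1, the drop G (1 - Y) is at
            most G - g, the eigenvalue of the unbiased estimate along x divided by s.\<close>
          have Y0: "s * (a * (1 - Y (W z))) \<le> s * \<bar>d\<bar>"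
          proof -
            have "a * (1 - Y (W z)) \<le> \<bar>d\<bar>"
            proof (cases "\<eta> (W z) < 1")
              case True
              then have "G (W z) * (1 - Y (W z)) \<le> G (W z) - g (W z)"
                using eta'[OF XY(5)[OF z]] \<kappa>0 XY[OF z] by (simp add: algebra_simps)
              then have "s * (G (W z) * (1 - Y (W z))) \<le> d" unfolding d_def by (rule mult_left_mono) (use s0 in simp)
              then show ?thesis by (simp add: a_def mult.assoc)
            next
              case False
              then have "Y (W z) = 1" using Y1[of "W z"] XY[OF z] by simp
              then show ?thesis by simp
            qed
            then show ?thesis using s0 by simp
          qed
          have am: "x * y \<le> x\<^sup>2 + y\<^sup>2" if "0 \<le> x" "0 \<le> y" for x y :: real
            using that sum_squares_bound[of x y] by (simp add: order_trans[OF _ sum_squares_bound])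
          have "s\<^sup>2 * k (W z) = ?r * (s * (a * (1 - X (W z)))) + s * (a * (1 - Y (W z)))"
            by (simp add: k_def a_def algebra_simps power2_eq_square)
          also have "\<dots> \<le> ?r * (s * a) + s * \<bar>d\<bar>"
            by (intro add_mono mult_left_mono X0 Y0 r0)
          also have "\<dots> \<le> ?r * (s\<^sup>2 + a\<^sup>2) + (s\<^sup>2 + \<bar>d\<bar>\<^sup>2)"
            using s0 a0 r0 by (intro add_mono mult_left_mono am) auto
          also have "\<dots> = real ?P * s\<^sup>2 + (?r * a\<^sup>2 + d\<^sup>2)" by (simp add: algebra_simps)
          also have "\<dots> \<le> real ?P * s\<^sup>2 + (2 * F 1 1 z + 2 * \<bar>T\<bar>)" using bd by linarith
          finally have fin: "s\<^sup>2 * k (W z) \<le> real ?P * s\<^sup>2 + (2 * F 1 1 z + 2 * \<bar>T\<bar>)" .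
          have "0 \<le> F 1 1 z" using loss_nn[of "\<lambda>_. 1" "\<lambda>_. 1" "fst z" "snd z"] by (simp add: loss[OF z])
          then have "ennreal (real ?P * s\<^sup>2 + (2 * F 1 1 z + 2 * \<bar>T\<bar>)) = ennreal (real ?P) * ennreal (s\<^sup>2) + (2 * ennreal (F 1 1 z) + ennreal (2 * \<bar>T\<bar>))"
            by (simp add: ennreal_mult)
          then show "ennreal ((snd z)\<^sup>2 * k (W z)) \<le> ennreal (real ?P) * ennreal ((snd z)\<^sup>2) + (2 * ennreal (F 1 1 z) + ennreal (2 * \<bar>T\<bar>))"
            using ennreal_leI[OF fin] by (simp add: s_def)
        qed
        also have "\<dots> = ennreal (real ?P) * (\<integral>\<^sup>+z. ennreal ((snd z)\<^sup>2) \<partial>sample_law n \<theta> v) + (2 * R0 + ennreal (2 * \<bar>T\<bar>))"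
        proof -
          interpret S: prob_space "sample_law n \<theta> v" by (rule prob_space_sample_law[OF v n])
          show ?thesis
            unfolding R0_def by (simp add: nn_integral_add nn_integral_cmult S.emeasure_space_1[simplified])
        qed
        also have "\<dots> < \<infinity>"
          using sample_law_second_moment[OF v n, of \<theta>] False
          by (auto simp: ennreal_mult_eq_top_iff less_top[symmetric])
        finally have "ennreal (2 * \<kappa>) * I2 < \<infinity>" by (simp add: ennreal_mult_less_top)
        then show ?thesis
          using main by (auto simp: add.commute[of _ "ennreal (2 * \<kappa>) * I2"] ennreal_add_left_cancel_le)
      qed simp
      then show ?thesis unfolding risk1 risk0 .
    qed
  qed
qed

end
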